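(* Let $k$ be a field, $\Pi$ a finite poset, $i_Z:Z\hookrightarrow\Pi$ the inclusion of a locally closed subset, and $(I^\bullet,\eta^\bullet)$ a bounded minimal injective complex on $\Pi$ represented by labeled matrices $\eta^d$. Then the proper pullback $\mathcal{I}i_Z^!I^\bullet$ is represented by the labeled matrices $\eta^d[Z,Z]$.
   Context: A subset $Z$ of a poset $\Pi$ is locally closed if $a,c\in Z$ and $a\le b\le c$ imply $b\in Z$. $\mathrm{St}\,\pi=\{\tau:\pi\le\tau\}$. A sheaf on a finite poset is a functor to finite-dimensional $k$-vector spaces. $[\pi]$ is the sheaf with $[\pi](\sigma)=k$ for $\sigma\le\pi$ and $0$ otherwise (identity maps between copies of $k$); injective sheaves are exactly the sheaves isomorphic to finite direct sums of these. A complex of injective sheaves is minimal if in each degree its number of indecomposable summands is least among all bounded complexes of injective sheaves quasi-isomorphic to it; every bounded complex of sheaves is quasi-isomorphic to a minimal injective complex (its minimal injective resolution), unique up to isomorphism. For a sheaf $F$ on $\Pi$, the proper pullback $i_Z^!F$ is the sheaf on $Z$ with $i_Z^!F(\zeta)=\{v\in F(\zeta): F(\zeta\le\tau)(v)=0\text{ for all }\tau\in\mathrm{St}_\Pi\zeta\setminus Z\}$ and restricted maps; it is functorial, applied to complexes degreewise, and $\mathcal{I}i_Z^!I^\bullet$ is the minimal injective resolution of $i_Z^!I^\bullet$, considered up to isomorphism of complexes. A $\Pi$-labeled matrix is a matrix over $k$ with each row and column labeled by an element of $\Pi$ (repetitions allowed), such that the entry in a row labeled $\sigma$ and column labeled $\pi$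 is nonzero only if $\sigma\le\pi$. $M[Z,Z]$ is the submatrix of rows and columns with labels in $Z$. With column labels $\pi_1,\dots,\pi_m$ and row labels $\sigma_1,\dots,\sigma_n$ it represents the natural transformation $\bigoplus_i[\pi_i]\to\bigoplus_j[\sigma_j]$ whose component at $\tau$ is $M[\mathrm{St}\,\tau,\mathrm{St}\,\tau]$. A complex of labeled matrices represents an injective complex in this way (with the columns of $\eta^{d+1}$ labeled as the rows of $\eta^d$). *)

theory Defs
  imports "Jordan_Normal_Form.Matrix" "Jordan_Normal_Form.DL_Submatrix"
begin

text \<open>A finite poset is a finite set \<open>P\<close> of elements of a type of class \<open>order\<close>; any
  subset \<open>Z\<close> of \<open>P\<close> is then a poset with the induced order.\<close>

definition St :: "'p::order set \<Rightarrow> 'p \<Rightarrow> 'p set" where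
  "St P \<pi> = {\<tau> \<in> P. \<pi> \<le> \<tau>}"

definition locally_closed :: "'p::order set \<Rightarrow> 'p set \<Rightarrow> bool" where
  "locally_closed P Z \<longleftrightarrow>
     Z \<subseteq> P \<and> (\<forall>a\<in>Z. \<forall>c\<in>Z. \<forall>b\<in>P. a \<le> b \<and> b \<le> c \<longrightarrow> b \<in> Z)"


section \<open>Finite-dimensional vector spaces\<close>

text \<open>Up to isomorphism, finite-dimensional spaces over \<open>k\<close> are linear subspaces of the spaces
  \<open>k\<^sup>n\<close>. Arbitrary subspaces are allowed, rather than only the spaces \<open>k\<^sup>n\<close> themselves, so that
  the stalks of a proper pullback are literally subspaces of the original stalks.\<close>

definition fd_space :: "'k::field vec set \<Rightarrow> bool" where
  "fd_space U \<longleftrightarrow> (\<exists>n. U \<subseteq> carrier_vec n \<and> 0\<^sub>v n \<in> U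
     \<and> (\<forall>u\<in>U. \<forall>v\<in>U. u + v \<in> U) \<and> (\<forall>c. \<forall>u\<in>U. c \<cdot>\<^sub>v u \<in> U))"

definition linear_on :: "'k::field vec set \<Rightarrow> 'k vec set \<Rightarrow> ('k vec \<Rightarrow> 'k vec) \<Rightarrow> bool" where
  "linear_on U W f \<longleftrightarrow> f \<in> U \<rightarrow> W
     \<and> (\<forall>u\<in>U. \<forall>v\<in>U. f (u + v) = f u + f v) \<and> (\<forall>c. \<forall>u\<in>U. f (c \<cdot>\<^sub>v u) = c \<cdot>\<^sub>v f u)"

definition is_zero :: "'k::field vec \<Rightarrow> bool" where
  "is_zero v \<longleftrightarrow> v = 0\<^sub>v (dim_vec v)"


section \<open>Sheaves\<close>

text \<open>The values of \<open>stalk\<close> and \<open>res\<close> outside the poset under consideration, and of \<open>res \<sigma> \<tau>\<close>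
  unless \<open>\<sigma> \<le> \<tau>\<close>, are irrelevant. The same holds for morphisms and complexes below.\<close>

record ('p, 'k) sheaf =
  stalk :: "'p \<Rightarrow> 'k vec set"
  res :: "'p \<Rightarrow> 'p \<Rightarrow> 'k vec \<Rightarrow> 'k vec"

type_synonym ('p, 'k) smap = "'p \<Rightarrow> 'k vec \<Rightarrow> 'k vec"

definition is_sheaf :: "'p::order set \<Rightarrow> ('p, 'k::field) sheaf \<Rightarrow> bool" where
  "is_sheaf P F \<longleftrightarrow>
     (\<forall>\<sigma>\<in>P. fd_space (stalk F \<sigma>)) \<and>
     (\<forall>\<sigma>\<in>P. \<forall>\<tau>\<in>P. \<sigma> \<le> \<tau> \<longrightarrow> linear_on (stalk F \<sigma>) (stalk F \<tau>) (res F \<sigma> \<tau>)) \<and>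
     (\<forall>\<sigma>\<in>P. \<forall>v\<in>stalk F \<sigma>. res F \<sigma> \<sigma> v = v) \<and>
     (\<forall>\<sigma>\<in>P. \<forall>\<tau>\<in>P. \<forall>\<rho>\<in>P. \<sigma> \<le> \<tau> \<and> \<tau> \<le> \<rho> \<longrightarrow>
        (\<forall>v\<in>stalk F \<sigma>. res F \<tau> \<rho> (res F \<sigma> \<tau> v) = res F \<sigma> \<rho> v))"

definition sheaf_hom ::
  "'p::order set \<Rightarrow> ('p, 'k::field) sheaf \<Rightarrow> ('p, 'k) sheaf \<Rightarrow> ('p, 'k) smap \<Rightarrow> bool" where
  "sheaf_hom P F G \<phi> \<longleftrightarrow>
     (\<forall>\<sigma>\<in>P. linear_on (stalk F \<sigma>) (stalk G \<sigma>) (\<phi> \<sigma>)) \<and>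
     (\<forall>\<sigma>\<in>P. \<forall>\<tau>\<in>P. \<sigma> \<le> \<tau> \<longrightarrow>
        (\<forall>v\<in>stalk F \<sigma>. \<phi> \<tau> (res F \<sigma> \<tau> v) = res G \<sigma> \<tau> (\<phi> \<sigma> v)))"

definition sheaf_iso :: "'p::order set \<Rightarrow> ('p, 'k::field) sheaf \<Rightarrow> ('p, 'k) sheaf \<Rightarrow> bool" where
  "sheaf_iso P F G \<longleftrightarrow>
     (\<exists>\<phi>. sheaf_hom P F G \<phi> \<and> (\<forall>\<sigma>\<in>P. bij_betw (\<phi> \<sigma>) (stalk F \<sigma>) (stalk G \<sigma>)))"


section \<open>Labeled matrices and injective sheaves\<close>

text \<open>\<open>rs\<close> and \<open>cs\<close> are the lists of row labels and column labels.\<close>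

definition labeled_matrix :: "'p::order set \<Rightarrow> 'p list \<Rightarrow> 'p list \<Rightarrow> 'k::field mat \<Rightarrow> bool" where
  "labeled_matrix P rs cs M \<longleftrightarrow>
     set rs \<subseteq> P \<and> set cs \<subseteq> P \<and> M \<in> carrier_mat (length rs) (length cs) \<and>
     (\<forall>i<length rs. \<forall>j<length cs. M $$ (i, j) \<noteq> 0 \<longrightarrow> rs ! i \<le> cs ! j)"

definition positions :: "'p list \<Rightarrow> 'p set \<Rightarrow> nat set" where
  "positions ps S = {i. i < length ps \<and> ps ! i \<in> S}"

text \<open>\<open>M[S,T]\<close>; its rows and columns are labeled by the sublists of labels in \<open>S\<close> and \<open>T\<close>.\<close>

definition labeled_submatrix ::
  "'p list \<Rightarrow> 'p list \<Rightarrow> 'k mat \<Rightarrow> 'p set \<Rightarrow> 'p set \<Rightarrow> 'k mat" where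
  "labeled_submatrix rs cs M S T = submatrix M (positions rs S) (positions cs T)"

definition restrict_labels :: "'p list \<Rightarrow> 'p set \<Rightarrow> 'p list" where
  "restrict_labels ps S = filter (\<lambda>\<pi>. \<pi> \<in> S) ps"

text \<open>\<open>inj_sum P [\<pi>\<^sub>1, \<dots>, \<pi>\<^sub>m]\<close> is the sheaf \<open>[\<pi>\<^sub>1] \<oplus> \<dots> \<oplus> [\<pi>\<^sub>m]\<close>: its stalk at \<open>\<sigma>\<close> has one
  coordinate for each \<open>i\<close> with \<open>\<sigma> \<le> \<pi>\<^sub>i\<close>, in the order of the list. For \<open>\<sigma> \<le> \<tau>\<close> the restriction
  map is the identity on the coordinates present at \<open>\<tau>\<close> and forgets the others, so its matrix is
  the submatrix \<open>[St \<tau>, St \<sigma>]\<close> of the identity matrix.\<close>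

definition inj_sum :: "'p::order set \<Rightarrow> 'p list \<Rightarrow> ('p, 'k::field) sheaf" where
  "inj_sum P ps = \<lparr>
     stalk = (\<lambda>\<sigma>. carrier_vec (length (restrict_labels ps (St P \<sigma>)))),
     res = (\<lambda>\<sigma> \<tau> v.
       labeled_submatrix ps ps (1\<^sub>m (length ps)) (St P \<tau>) (St P \<sigma>) *\<^sub>v v)\<rparr>"

text \<open>The natural transformation \<open>inj_sum P cs \<longrightarrow> inj_sum P rs\<close> represented by a labeled matrix.\<close>

definition matrix_map :: "'p::order set \<Rightarrow> 'p list \<Rightarrow> 'p list \<Rightarrow> 'k::field mat \<Rightarrow> ('p, 'k) smap" where
  "matrix_map P rs cs M = (\<lambda>\<tau> v. labeled_submatrix rs cs M (St P \<tau>) (St P \<tau>) *\<^sub>v v)"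

text \<open>\<open>F\<close> is an injective sheaf with \<open>n\<close> indecomposable summands. (The sheaves \<open>[\<pi>]\<close> are
  indecomposable, and \<open>n\<close> is determined by \<open>F\<close>.)\<close>

definition injective_with_summands :: "'p::order set \<Rightarrow> ('p, 'k::field) sheaf \<Rightarrow> nat \<Rightarrow> bool" where
  "injective_with_summands P F n \<longleftrightarrow>
     (\<exists>ps. set ps \<subseteq> P \<and> length ps = n \<and> sheaf_iso P F (inj_sum P ps))"

definition injective_sheaf :: "'p::order set \<Rightarrow> ('p, 'k::field) sheaf \<Rightarrow> bool" where
  "injective_sheaf P F \<longleftrightarrow> is_sheaf P F \<and> (\<exists>n. injective_with_summands P F n)"


section \<open>Complexes\<close>

record ('p, 'k) complex_of_sheaves =
  obj :: "int \<Rightarrow> ('p, 'k) sheaf"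
  dif :: "int \<Rightarrow> ('p, 'k) smap"

definition bounded_complex :: "'p::order set \<Rightarrow> ('p, 'k::field) complex_of_sheaves \<Rightarrow> bool" where
  "bounded_complex P A \<longleftrightarrow>
     (\<forall>d. is_sheaf P (obj A d)) \<and>
     (\<forall>d. sheaf_hom P (obj A d) (obj A (d + 1)) (dif A d)) \<and>
     (\<forall>d. \<forall>\<sigma>\<in>P. \<forall>v\<in>stalk (obj A d) \<sigma>. is_zero (dif A (d + 1) \<sigma> (dif A d \<sigma> v))) \<and>
     finite {d. \<exists>\<sigma>\<in>P. \<exists>v\<in>stalk (obj A d) \<sigma>. \<not> is_zero v}"

definition bounded_injective_complex ::
  "'p::order set \<Rightarrow> ('p, 'k::field) complex_of_sheaves \<Rightarrow> bool" where
  "bounded_injective_complex P A \<longleftrightarrow> bounded_complex P A \<and> (\<forall>d. injective_sheaf P (obj A d))"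

definition chain_map :: "'p::order set \<Rightarrow> ('p, 'k::field) complex_of_sheaves \<Rightarrow>
    ('p, 'k) complex_of_sheaves \<Rightarrow> (int \<Rightarrow> ('p, 'k) smap) \<Rightarrow> bool" where
  "chain_map P A B f \<longleftrightarrow>
     (\<forall>d. sheaf_hom P (obj A d) (obj B d) (f d)) \<and>
     (\<forall>d. \<forall>\<sigma>\<in>P. \<forall>v\<in>stalk (obj A d) \<sigma>. f (d + 1) \<sigma> (dif A d \<sigma> v) = dif B d \<sigma> (f d \<sigma> v))"

definition complex_iso :: "'p::order set \<Rightarrow> ('p, 'k::field) complex_of_sheaves \<Rightarrow>
    ('p, 'k) complex_of_sheaves \<Rightarrow> bool" where
  "complex_iso P A B \<longleftrightarrow> (\<exists>f. chain_map P A B f \<and>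
     (\<forall>d. \<forall>\<sigma>\<in>P. bij_betw (f d \<sigma>) (stalk (obj A d) \<sigma>) (stalk (obj B d) \<sigma>)))"

definition cocycles :: "('p, 'k::field) complex_of_sheaves \<Rightarrow> int \<Rightarrow> 'p \<Rightarrow> 'k vec set" where
  "cocycles A d \<sigma> = {v \<in> stalk (obj A d) \<sigma>. is_zero (dif A d \<sigma> v)}"

definition coboundaries :: "('p, 'k::field) complex_of_sheaves \<Rightarrow> int \<Rightarrow> 'p \<Rightarrow> 'k vec set" where
  "coboundaries A d \<sigma> = dif A (d - 1) \<sigma> ` stalk (obj A (d - 1)) \<sigma>"

text \<open>The last two conjuncts say that the maps induced on cohomology are injective and surjective
  at every point of the poset.\<close>

definition quasi_isomorphism :: "'p::order set \<Rightarrow> ('p, 'k::field) complex_of_sheaves \<Rightarrow>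
    ('p, 'k) complex_of_sheaves \<Rightarrow> (int \<Rightarrow> ('p, 'k) smap) \<Rightarrow> bool" where
  "quasi_isomorphism P A B f \<longleftrightarrow> chain_map P A B f \<and>
     (\<forall>d. \<forall>\<sigma>\<in>P. \<forall>v\<in>cocycles A d \<sigma>.
        f d \<sigma> v \<in> coboundaries B d \<sigma> \<longrightarrow> v \<in> coboundaries A d \<sigma>) \<and>
     (\<forall>d. \<forall>\<sigma>\<in>P. \<forall>w\<in>cocycles B d \<sigma>. \<exists>v\<in>cocycles A d \<sigma>.
        w - f d \<sigma> v \<in> coboundaries B d \<sigma>)"

text \<open>Two bounded complexes are quasi-isomorphic if they are connected by a finite zigzag of
  quasi-isomorphisms of bounded complexes, i.e. isomorphic in the bounded derived category.\<close>

definition quasi_isomorphic :: "'p::order set \<Rightarrow> ('p, 'k::field) complex_of_sheaves \<Rightarrow>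
    ('p, 'k) complex_of_sheaves \<Rightarrow> bool" where
  "quasi_isomorphic P =
     equivclp (\<lambda>A B. bounded_complex P A \<and> bounded_complex P B \<and> (\<exists>f. quasi_isomorphism P A B f))"

definition minimal_injective_complex ::
  "'p::order set \<Rightarrow> ('p, 'k::field) complex_of_sheaves \<Rightarrow> bool" where
  "minimal_injective_complex P A \<longleftrightarrow> bounded_injective_complex P A \<and>
     (\<forall>B. bounded_injective_complex P B \<and> quasi_isomorphic P A B \<longrightarrow>
        (\<forall>d m n. injective_with_summands P (obj A d) m \<and> injective_with_summands P (obj B d) n
           \<longrightarrow> m \<le> n))"

definition minimal_injective_resolution :: "'p::order set \<Rightarrow> ('p, 'k::field) complex_of_sheaves \<Rightarrow>
    ('p, 'k) complex_of_sheaves \<Rightarrow> bool" where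
  "minimal_injective_resolution P A J \<longleftrightarrow>
     bounded_complex P A \<and> minimal_injective_complex P J \<and> quasi_isomorphic P A J"

text \<open>Here \<open>\<eta> d\<close> has columns labeled by \<open>L d\<close> and rows labeled by \<open>L (d + 1)\<close>.\<close>

definition matrix_complex ::
  "'p::order set \<Rightarrow> (int \<Rightarrow> 'p list) \<Rightarrow> (int \<Rightarrow> 'k::field mat) \<Rightarrow> ('p, 'k) complex_of_sheaves" where
  "matrix_complex P L \<eta> = \<lparr>
     obj = (\<lambda>d. inj_sum P (L d)),
     dif = (\<lambda>d. matrix_map P (L (d + 1)) (L d) (\<eta> d))\<rparr>"

text \<open>A choice of direct sum decompositions is part of a representation, hence the isomorphism.\<close>

definition represented_by :: "'p::order set \<Rightarrow> ('p, 'k::field) complex_of_sheaves \<Rightarrow>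
    (int \<Rightarrow> 'p list) \<Rightarrow> (int \<Rightarrow> 'k mat) \<Rightarrow> bool" where
  "represented_by P A L \<eta> \<longleftrightarrow>
     (\<forall>d. labeled_matrix P (L (d + 1)) (L d) (\<eta> d)) \<and> complex_iso P A (matrix_complex P L \<eta>)"


section \<open>Proper pullback\<close>

definition proper_pullback :: "'p::order set \<Rightarrow> 'p set \<Rightarrow> ('p, 'k::field) sheaf \<Rightarrow> ('p, 'k) sheaf" where
  "proper_pullback P Z F = \<lparr>
     stalk = (\<lambda>\<zeta>. {v \<in> stalk F \<zeta>. \<forall>\<tau> \<in> St P \<zeta> - Z. is_zero (res F \<zeta> \<tau> v)}),
     res = res F\<rparr>"

definition proper_pullback_complex :: "'p::order set \<Rightarrow> 'p set \<Rightarrow>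
    ('p, 'k::field) complex_of_sheaves \<Rightarrow> ('p, 'k) complex_of_sheaves" where
  "proper_pullback_complex P Z A = \<lparr>obj = (\<lambda>d. proper_pullback P Z (obj A d)), dif = dif A\<rparr>"

end

theory Submission
  imports Defs "HOL-Library.Function_Algebras"
begin

text \<open>In the coordinates of the summands a morphism \<open>F \<rightarrow> [\<pi>\<^sub>1] \<oplus> \<dots> \<oplus> [\<pi>\<^sub>n]\<close> is a family of linear
  functionals on the spaces \<open>F(\<pi>\<^sub>i)\<close>. Extending functionals, one lifts chain maps into a complex of
  injectives along quasi-isomorphisms, up to homotopy; so a zigzag of quasi-isomorphisms ending in a
  complex of injectives collapses to a single one. Call a complex of labeled matrices radical if no
  nonzero entry joins equal labels. If \<open>N\<close> is radical and \<open>N \<rightarrow> M \<rightarrow> N\<close> is homotopic to the identity,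
  then the composite differs from the identity only by entries joining strictly smaller to strictly
  larger labels, so it is invertible. Hence radical complexes are minimal, and quasi-isomorphic
  radical complexes are isomorphic. Conversely a minimal complex is radical, because a nonzero entry
  between equal labels can be eliminated. As a submatrix of a radical complex is radical, it remains to
  see that \<open>i\<^sub>Z\<^sup>!I\<close> is itself represented by the submatrices: by local closedness, a section of \<open>[\<pi>]\<close> at a point of
  \<open>Z\<close> restricts to zero outside \<open>Z\<close> iff it is zero or \<open>\<pi> \<in> Z\<close>.\<close>

section \<open>Coordinates\<close>

text \<open>Over a field, Hom(F, [\<pi>]) is the dual space of F(\<pi>), which is exact in F; this
  is why extending functionals at single points is all the injectivity that is needed. The lift
  \<open>h\<close> and the homotopy \<open>s\<close> are not found separately. In each degree the
  pair is one functional on the next term of the mapping cone of \<open>q\<close>, prescribed on the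
  image of the cone differential, and exactness of the cone makes the prescription consistent. The
  obstacle is that a zigzag through arbitrary bounded complexes offers no map at all between the two
  complexes to be compared. If the target of a map is a complex of injectives, every arrow of the
  zigzag can be passed in either direction. The homotopy is harmless because of the labels: in a
  product of a homotopy with a radical differential, an entry between equal labels would squeeze the
  middle label to equality, which radicality forbids. Minimality then becomes a count: if
  \<open>B A\<close> is unipotent, \<open>A\<close> has at least as many rows as columns.\<close>

definition pos :: "'p::order list \<Rightarrow> 'p \<Rightarrow> nat set" where
  "pos ps p = {i. i < length ps \<and> p \<le> ps ! i}"

text \<open>An index names the same summand at every point, whereas its place in a stalk vector
  changes with the point. In this form restriction maps are mere cutoffs.\<close>

definition coords :: "'p::order list \<Rightarrow> 'p \<Rightarrow> (nat \<Rightarrow> 'k::field) set" where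
  "coords ps p = {u. \<forall>i. u i \<noteq> 0 \<longrightarrow> i \<in> pos ps p}"

text \<open>The cardinality is the rank of \<open>i\<close> in \<open>pos ps p\<close>, inverse to
  \<open>pick\<close>; it is the number under which \<open>submatrix\<close> lists the summand
  \<open>i\<close>.\<close>

definition to_coords :: "'p::order list \<Rightarrow> 'p \<Rightarrow> 'k::field vec \<Rightarrow> nat \<Rightarrow> 'k" where
  "to_coords ps p v = (\<lambda>i. if i \<in> pos ps p then v $ card {a \<in> pos ps p. a < i} else 0)"

definition of_coords :: "'p::order list \<Rightarrow> 'p \<Rightarrow> (nat \<Rightarrow> 'k::field) \<Rightarrow> 'k vec" where
  "of_coords ps p u = vec (card (pos ps p)) (\<lambda>r. u (pick (pos ps p) r))"

lemma finite_pos [simp]: "finite (pos ps p)"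
  by (simp add: pos_def)

lemma positions_St: "set ps \<subseteq> P \<Longrightarrow> positions ps (St P p) = pos ps p"
  by (auto simp: positions_def St_def pos_def)

lemma card_below_pos: "i \<in> pos ps p \<Longrightarrow> card {a \<in> pos ps p. a < i} < card (pos ps p)"
  by (intro psubset_card_mono) auto

lemma length_restrict_St:
  assumes "set ps \<subseteq> P"
  shows "length (restrict_labels ps (St P p)) = card (pos ps p)"
proof -
  have "length (restrict_labels ps (St P p)) = card {i. i < length ps \<and> ps ! i \<in> St P p}"
    by (simp add: restrict_labels_def length_filter_conv_card)
  also have "{i. i < length ps \<and> ps ! i \<in> St P p} = pos ps p"
    using positions_St[OF assms] by (simp add: positions_def)
  finally show ?thesis .
qed

lemma stalk_inj_sum:
  "set ps \<subseteq> P \<Longrightarrow> stalk (inj_sum P ps) p = carrier_vec (card (pos ps p))"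
  by (simp add: inj_sum_def length_restrict_St)

lemma to_coords_mem: "to_coords ps p v \<in> coords ps p"
  by (simp add: to_coords_def coords_def)

lemma of_coords_carrier: "of_coords ps p u \<in> carrier_vec (card (pos ps p))"
  by (simp add: of_coords_def)

lemma dim_of_coords [simp]: "dim_vec (of_coords ps p u) = card (pos ps p)"
  by (simp add: of_coords_def)

lemma to_of_coords:
  assumes "u \<in> coords ps p"
  shows "to_coords ps p (of_coords ps p u) = u"
proof
  fix i show "to_coords ps p (of_coords ps p u) i = u i"
    using assms card_below_pos[of i ps p] pick_card_in_set[of i "pos ps p"]
    by (auto simp: to_coords_def of_coords_def coords_def)
qed

lemma of_to_coords:
  assumes "v \<in> carrier_vec (card (pos ps p))"
  shows "of_coords ps p (to_coords ps p v) = v"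
proof (rule eq_vecI)
  fix r assume "r < dim_vec v"
  then have r: "r < card (pos ps p)" using assms by simp
  then show "of_coords ps p (to_coords ps p v) $ r = v $ r"
    using pick_in_set_le[OF r] card_pick_le[OF r] by (simp add: to_coords_def of_coords_def)
qed (use assms in simp)

lemma to_coords_add:
  assumes "v \<in> carrier_vec (card (pos ps p))" "w \<in> carrier_vec (card (pos ps p))"
  shows "to_coords ps p (v + w) i = to_coords ps p v i + to_coords ps p w i"
  using assms card_below_pos[of i ps p] by (auto simp: to_coords_def)

lemma to_coords_smult:
  assumes "v \<in> carrier_vec (card (pos ps p))"
  shows "to_coords ps p (c \<cdot>\<^sub>v v) i = c * to_coords ps p v i"
  using assms card_below_pos[of i ps p] by (auto simp: to_coords_def)

lemma to_coords_inject:
  assumes "v \<in> carrier_vec (card (pos ps p))" "w \<in> carrier_vec (card (pos ps p))"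
    and "to_coords ps p v = to_coords ps p w"
  shows "v = w"
  using assms of_to_coords by metis

lemma coords_zero: "(\<lambda>i. 0) \<in> coords ps p"
  by (simp add: coords_def)

lemma is_zero_coords:
  assumes "v \<in> carrier_vec (card (pos ps p))"
  shows "is_zero v \<longleftrightarrow> to_coords ps p v = (\<lambda>i. 0)"
proof -
  have "to_coords ps p (0\<^sub>v (card (pos ps p))) = (\<lambda>i. 0)"
    using card_below_pos[of _ ps p] by (auto simp: to_coords_def fun_eq_iff)
  then show ?thesis
    using assms to_coords_inject[OF assms zero_carrier_vec] by (auto simp: is_zero_def)
qed

section \<open>Matrices acting on coordinates\<close>

definition entries :: "'k::zero mat \<Rightarrow> nat \<Rightarrow> nat \<Rightarrow> 'k" where
  "entries M i j = (if i < dim_row M \<and> j < dim_col M then M $$ (i, j) else 0)"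

text \<open>The matrix \<open>A\<close> acting on coordinates, cut off to the coordinates present at the point; without the
  cutoff \<open>A i j \<noteq> 0\<close> and \<open>p \<le> cs ! j\<close> would not force \<open>p \<le> rs ! i\<close>.\<close>

definition app :: "'p::order list \<Rightarrow> 'p \<Rightarrow> (nat \<Rightarrow> nat \<Rightarrow> 'k::field) \<Rightarrow> nat \<Rightarrow> (nat \<Rightarrow> 'k) \<Rightarrow> nat \<Rightarrow> 'k" where
  "app rs p A n u = (\<lambda>i. if i \<in> pos rs p then \<Sum>j<n. A i j * u j else 0)"

text \<open>The support condition ties an otherwise infinite array to its format, so that equal maps
  have equal arrays (\<open>labeled_eqI\<close>).\<close>

definition labeled :: "'p::order list \<Rightarrow> 'p list \<Rightarrow> (nat \<Rightarrow> nat \<Rightarrow> 'k::field) \<Rightarrow> bool" where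
  "labeled rs cs A \<longleftrightarrow> (\<forall>i j. A i j \<noteq> 0 \<longrightarrow> i < length rs \<and> j < length cs \<and> rs ! i \<le> cs ! j)"

definition mmult :: "nat \<Rightarrow> (nat \<Rightarrow> nat \<Rightarrow> 'k::field) \<Rightarrow> (nat \<Rightarrow> nat \<Rightarrow> 'k) \<Rightarrow> nat \<Rightarrow> nat \<Rightarrow> 'k" where
  "mmult n A B = (\<lambda>i j. \<Sum>k<n. A i k * B k j)"

lemma labeled_entries: "labeled_matrix P rs cs M \<Longrightarrow> labeled rs cs (entries M)"
  by (auto simp: labeled_def labeled_matrix_def entries_def split: if_splits)

lemma mmult_assoc: "mmult n (mmult m A B) C = mmult m A (mmult n B C)"
proof (intro ext)
  fix i j
  have "mmult n (mmult m A B) C i j = (\<Sum>k<n. \<Sum>l<m. A i l * (B l k * C k j))"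
    by (simp add: mmult_def sum_distrib_right mult.assoc)
  also have "\<dots> = mmult m A (mmult n B C) i j"
    by (subst sum.swap) (simp add: mmult_def sum_distrib_left)
  finally show "mmult n (mmult m A B) C i j = mmult m A (mmult n B C) i j" .
qed

lemma labeled_mmult: "labeled rs qs A \<Longrightarrow> labeled qs ps B \<Longrightarrow> labeled rs ps (mmult n A B)"
  unfolding labeled_def
proof (intro allI impI)
  fix i j
  assume A: "\<forall>i j. A i j \<noteq> 0 \<longrightarrow> i < length rs \<and> j < length qs \<and> rs ! i \<le> qs ! j"
    and B: "\<forall>i j. B i j \<noteq> 0 \<longrightarrow> i < length qs \<and> j < length ps \<and> qs ! i \<le> ps ! j"
    and "mmult n A B i j \<noteq> 0"
  then obtain k where "A i k * B k j \<noteq> 0"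
    unfolding mmult_def by (meson sum.not_neutral_contains_not_neutral)
  then have "A i k \<noteq> 0" "B k j \<noteq> 0" by auto
  then show "i < length rs \<and> j < length ps \<and> rs ! i \<le> ps ! j"
    using A B order_trans by blast
qed

lemma app_mem: "app rs p A n u \<in> coords rs p"
  by (simp add: app_def coords_def)

text \<open>The cutoff between the two factors loses nothing: if \<open>i \<in> pos rs p\<close> and
  \<open>A i k \<noteq> 0\<close>, then \<open>p \<le> rs ! i \<le> qs ! k\<close>, so the
  coordinate \<open>k\<close> is present at \<open>p\<close>.\<close>

lemma app_mmult:
  assumes "labeled rs qs A"
  shows "app rs p A m (app qs p B n u) = app rs p (mmult m A B) n u"
proof
  fix i
  have "(\<Sum>k<m. A i k * app qs p B n u k) = (\<Sum>k<m. A i k * (\<Sum>j<n. B k j * u j))" if "i \<in> pos rs p"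
  proof (rule sum.cong)
    fix k assume "k \<in> {..<m}"
    show "A i k * app qs p B n u k = A i k * (\<Sum>j<n. B k j * u j)"
    proof (cases "A i k = 0")
      case False
      then have "k \<in> pos qs p" using assms that by (auto simp: labeled_def pos_def intro: order_trans)
      then show ?thesis by (simp add: app_def)
    qed simp
  qed simp
  also have "\<dots> = (\<Sum>j<n. mmult m A B i j * u j)"
    unfolding mmult_def sum_distrib_left sum_distrib_right
    by (subst sum.swap) (simp add: mult.assoc)
  finally show "app rs p A m (app qs p B n u) i = app rs p (mmult m A B) n u i"
    by (simp add: app_def)
qed

lemma app_add: "app rs p A n (\<lambda>i. u i + w i) = (\<lambda>i. app rs p A n u i + app rs p A n w i)"
  by (auto simp: app_def algebra_simps sum.distrib)

lemma app_diff: "app rs p A n (\<lambda>i. u i - w i) = (\<lambda>i. app rs p A n u i - app rs p A n w i)"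
  by (auto simp: app_def algebra_simps sum_subtractf)

lemma app_smult: "app rs p A n (\<lambda>i. c * u i) = (\<lambda>i. c * app rs p A n u i)"
  by (auto simp: app_def algebra_simps sum_distrib_left)

lemma app_uminus: "app rs p A n (\<lambda>i. - u i) = (\<lambda>i. - app rs p A n u i)"
  by (auto simp: app_def sum_negf)

lemma app_zero: "app rs p A n (\<lambda>i. 0) = (\<lambda>i. 0)"
  by (auto simp: app_def)

text \<open>Trades the sum over places in a stalk vector, which matrix-vector multiplication
  produces, for a sum over summand indices.\<close>

lemma sum_pos:
  assumes "finite S" "\<And>j. j \<notin> S \<Longrightarrow> f j = (0::'k::field)" "S \<subseteq> {..<n}"
  shows "(\<Sum>r<card S. f (pick S r)) = (\<Sum>j<n. f j)"
proof -
  have "bij_betw (pick S) {..<card S} S"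
    unfolding bij_betw_def
  proof
    show "inj_on (pick S) {..<card S}"
      using card_pick_le[of _ S] by (intro inj_on_inverseI[where g = "\<lambda>i. card {a \<in> S. a < i}"]) simp
    show "pick S ` {..<card S} = S"
    proof
      show "S \<subseteq> pick S ` {..<card S}"
      proof
        fix i assume i: "i \<in> S"
        then have "card {a \<in> S. a < i} < card S" using i by (intro psubset_card_mono[OF assms(1)]) auto
        then show "i \<in> pick S ` {..<card S}" by (intro image_eqI[where x = "card {a \<in> S. a < i}"]) (simp_all add: pick_card_in_set[OF i])
      qed
    qed (auto intro: pick_in_set_le)
  qed
  then have "(\<Sum>r<card S. f (pick S r)) = (\<Sum>j\<in>S. f j)"
    by (rule sum.reindex_bij_betw)
  also have "\<dots> = (\<Sum>j<n. f j)"
    using assms by (intro sum.mono_neutral_left) auto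
  finally show ?thesis .
qed

text \<open>Two points \<open>p\<close> and \<open>\<tau>\<close> are allowed so that one
  computation serves morphisms (both points equal) and restriction maps (\<open>M\<close> the
  identity matrix).\<close>

lemma submatrix_mult_coords:
  fixes M :: "'k::field mat"
  assumes S: "set rs \<subseteq> P" "set cs \<subseteq> P" and M: "M \<in> carrier_mat (length rs) (length cs)"
    and v: "v \<in> carrier_vec (card (pos cs p))"
  shows "labeled_submatrix rs cs M (St P \<tau>) (St P p) *\<^sub>v v \<in> carrier_vec (card (pos rs \<tau>))"
    and "to_coords rs \<tau> (labeled_submatrix rs cs M (St P \<tau>) (St P p) *\<^sub>v v)
         = app rs \<tau> (entries M) (length cs) (to_coords cs p v)"
proof -
  let ?A = "labeled_submatrix rs cs M (St P \<tau>) (St P p)"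
  have eq: "{i. i < length rs \<and> i \<in> pos rs \<tau>} = pos rs \<tau>" "{i. i < length cs \<and> i \<in> pos cs p} = pos cs p"
    by (auto simp: pos_def)
  have A: "?A = mat (card (pos rs \<tau>)) (card (pos cs p)) (\<lambda>(i, j). M $$ (pick (pos rs \<tau>) i, pick (pos cs p) j))"
    using M by (simp add: labeled_submatrix_def submatrix_def positions_St[OF S(1)] positions_St[OF S(2)] eq)
  show "?A *\<^sub>v v \<in> carrier_vec (card (pos rs \<tau>))" by (intro carrier_vecI) (simp add: A)
  show "to_coords rs \<tau> (?A *\<^sub>v v) = app rs \<tau> (entries M) (length cs) (to_coords cs p v)"
  proof
    fix i
    show "to_coords rs \<tau> (?A *\<^sub>v v) i = app rs \<tau> (entries M) (length cs) (to_coords cs p v) i"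
    proof (cases "i \<in> pos rs \<tau>")
      case True
      note r = card_below_pos[OF True] and pk = pick_card_in_set[OF True]
      have "to_coords rs \<tau> (?A *\<^sub>v v) i = (\<Sum>r<card (pos cs p). M $$ (i, pick (pos cs p) r) * v $ r)"
        using True v r pk by (simp add: to_coords_def A scalar_prod_def atLeast0LessThan)
      also have "\<dots> = (\<Sum>r<card (pos cs p). entries M i (pick (pos cs p) r) * to_coords cs p v (pick (pos cs p) r))"
      proof (rule sum.cong)
        fix r assume "r \<in> {..<card (pos cs p)}"
        then have r: "r < card (pos cs p)" by simp
        note q = pick_in_set_le[OF r] card_pick_le[OF r]
        have "i < length rs" "pick (pos cs p) r < length cs" using True q by (auto simp: pos_def)
        then show "M $$ (i, pick (pos cs p) r) * v $ r = entries M i (pick (pos cs p) r) * to_coords cs p v (pick (pos cs p) r)"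
          using q M by (simp add: entries_def to_coords_def)
      qed simp
      also have "\<dots> = (\<Sum>j<length cs. entries M i j * to_coords cs p v j)"
        by (rule sum_pos) (auto simp: to_coords_def pos_def)
      finally show ?thesis using True by (simp add: app_def)
    qed (simp add: to_coords_def app_def)
  qed
qed

lemma matrix_map_coords:
  assumes "labeled_matrix P rs cs M" "v \<in> stalk (inj_sum P cs) p"
  shows "matrix_map P rs cs M p v \<in> stalk (inj_sum P rs) p"
    and "to_coords rs p (matrix_map P rs cs M p v) = app rs p (entries M) (length cs) (to_coords cs p v)"
  using assms submatrix_mult_coords[of rs P cs M v p p]
  by (auto simp: labeled_matrix_def matrix_map_def stalk_inj_sum)

lemma res_coords:
  fixes v :: "'k::field vec"
  assumes "set ps \<subseteq> P" "v \<in> stalk (inj_sum P ps) p"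
  shows "res (inj_sum P ps) p \<tau> v \<in> stalk (inj_sum P ps) \<tau>"
    and "to_coords ps \<tau> (res (inj_sum P ps) p \<tau> v) = (\<lambda>i. if i \<in> pos ps \<tau> then to_coords ps p v i else 0)"
proof -
  note * = submatrix_mult_coords[OF assms(1) assms(1) one_carrier_mat, of v p \<tau>]
  show "res (inj_sum P ps) p \<tau> v \<in> stalk (inj_sum P ps) \<tau>"
    using * assms by (simp add: stalk_inj_sum inj_sum_def[of P ps] length_restrict_St)
  have "(\<Sum>j<length ps. entries (1\<^sub>m (length ps)) i j * u j) = u i" if "i < length ps" for i and u :: "nat \<Rightarrow> 'k"
  proof -
    have "(\<Sum>j<length ps. entries (1\<^sub>m (length ps)) i j * u j) = (\<Sum>j<length ps. if i = j then u j else 0)"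
      using that by (intro sum.cong) (auto simp: entries_def)
    also have "\<dots> = u i" using that by simp
    finally show ?thesis .
  qed
  then show "to_coords ps \<tau> (res (inj_sum P ps) p \<tau> v) = (\<lambda>i. if i \<in> pos ps \<tau> then to_coords ps p v i else 0)"
    using * assms by (auto simp: stalk_inj_sum inj_sum_def[of P ps] length_restrict_St app_def pos_def fun_eq_iff)
qed

section \<open>Morphisms into injective sheaves\<close>

text \<open>The coordinates of a morphism into \<open>inj_sum P ps\<close>.\<close>

definition coord_map :: "'p::order set \<Rightarrow> ('p, 'k::field) sheaf \<Rightarrow> 'p list \<Rightarrow> ('p \<Rightarrow> 'k vec \<Rightarrow> nat \<Rightarrow> 'k) \<Rightarrow> bool" where
  "coord_map P F ps h \<longleftrightarrow>
     (\<forall>p\<in>P. \<forall>v\<in>stalk F p. h p v \<in> coords ps p) \<and>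
     (\<forall>p\<in>P. \<forall>v\<in>stalk F p. \<forall>w\<in>stalk F p. h p (v + w) = (\<lambda>i. h p v i + h p w i)) \<and>
     (\<forall>p\<in>P. \<forall>c. \<forall>v\<in>stalk F p. h p (c \<cdot>\<^sub>v v) = (\<lambda>i. c * h p v i)) \<and>
     (\<forall>p\<in>P. \<forall>\<tau>\<in>P. p \<le> \<tau> \<longrightarrow> (\<forall>v\<in>stalk F p. \<forall>i\<in>pos ps \<tau>. h \<tau> (res F p \<tau> v) i = h p v i))"

lemma coord_mapD:
  assumes "coord_map P F ps h" "p \<in> P" "v \<in> stalk F p"
  shows "h p v \<in> coords ps p"
    and "w \<in> stalk F p \<Longrightarrow> h p (v + w) = (\<lambda>i. h p v i + h p w i)"
    and "h p (c \<cdot>\<^sub>v v) = (\<lambda>i. c * h p v i)"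
    and "\<tau> \<in> P \<Longrightarrow> p \<le> \<tau> \<Longrightarrow> i \<in> pos ps \<tau> \<Longrightarrow> h \<tau> (res F p \<tau> v) i = h p v i"
  using assms by (simp_all add: coord_map_def)

lemma fd_spaceE:
  assumes "fd_space U"
  obtains n where "U \<subseteq> carrier_vec n" "0\<^sub>v n \<in> U"
    "\<And>u v. u \<in> U \<Longrightarrow> v \<in> U \<Longrightarrow> u + v \<in> U" "\<And>c u. u \<in> U \<Longrightarrow> c \<cdot>\<^sub>v u \<in> U"
  using assms unfolding fd_space_def by blast

lemma fd_space_carrier: "fd_space (carrier_vec n)"
  by (auto simp: fd_space_def)

lemma to_coords_outside: "i \<notin> pos ps p \<Longrightarrow> to_coords ps p v i = 0"
  by (simp add: to_coords_def)

lemma pos_mono: "i \<in> pos ps \<tau> \<Longrightarrow> p \<le> \<tau> \<Longrightarrow> i \<in> pos ps p"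
  by (auto simp: pos_def)

lemma of_coords_add: "of_coords ps p (\<lambda>i. u i + w i) = of_coords ps p u + of_coords ps p w"
  by (auto simp: of_coords_def)

lemma of_coords_smult: "of_coords ps p (\<lambda>i. c * u i) = c \<cdot>\<^sub>v of_coords ps p u"
  by (auto simp: of_coords_def)

lemma is_sheaf_inj_sum:
  assumes "set ps \<subseteq> P"
  shows "is_sheaf P (inj_sum P ps :: ('p::order, 'k::field) sheaf)"
proof -
  note st = stalk_inj_sum[OF assms]
  note r = res_coords[OF assms, unfolded st]
  show ?thesis unfolding is_sheaf_def linear_on_def st
  proof (intro conjI ballI allI impI)
    fix p \<tau> assume "p \<in> P" "\<tau> \<in> P" "p \<le> \<tau>"
    show "res (inj_sum P ps) p \<tau> \<in> carrier_vec (card (pos ps p)) \<rightarrow> carrier_vec (card (pos ps \<tau>))"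
      using r(1) by auto
    fix u v :: "'k vec" and c
    assume u: "u \<in> carrier_vec (card (pos ps p))"
    show "res (inj_sum P ps) p \<tau> (c \<cdot>\<^sub>v u) = c \<cdot>\<^sub>v res (inj_sum P ps) p \<tau> u"
      using u by (intro to_coords_inject[where ps = ps and p = \<tau>]) (auto simp: r to_coords_smult fun_eq_iff)
    assume v: "v \<in> carrier_vec (card (pos ps p))"
    show "res (inj_sum P ps) p \<tau> (u + v) = res (inj_sum P ps) p \<tau> u + res (inj_sum P ps) p \<tau> v"
      using u v by (intro to_coords_inject[where ps = ps and p = \<tau>]) (auto simp: r to_coords_add fun_eq_iff)
  next
    fix p and v :: "'k vec" assume "p \<in> P" "v \<in> carrier_vec (card (pos ps p))"
    then show "res (inj_sum P ps) p p v = v"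
      by (intro to_coords_inject[where ps = ps and p = p]) (auto simp: r fun_eq_iff to_coords_outside)
  next
    fix p \<tau> \<rho> and v :: "'k vec"
    assume "p \<in> P" "\<tau> \<in> P" "\<rho> \<in> P" "p \<le> \<tau> \<and> \<tau> \<le> \<rho>" "v \<in> carrier_vec (card (pos ps p))"
    then show "res (inj_sum P ps) \<tau> \<rho> (res (inj_sum P ps) p \<tau> v) = res (inj_sum P ps) p \<rho> v"
      by (intro to_coords_inject[where ps = ps and p = \<rho>]) (auto simp: r fun_eq_iff intro: pos_mono)
  qed (auto simp: fd_space_carrier)
qed

lemma coord_map_of_hom:
  assumes "sheaf_hom P F (inj_sum P ps) \<phi>" "set ps \<subseteq> P"
  shows "coord_map P F ps (\<lambda>p v. to_coords ps p (\<phi> p v))"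
  unfolding coord_map_def
proof (intro conjI ballI allI impI)
  fix p v assume s: "p \<in> P" "v \<in> stalk F p"
  have lin: "linear_on (stalk F p) (carrier_vec (card (pos ps p))) (\<phi> p)"
    using assms s by (simp add: sheaf_hom_def stalk_inj_sum)
  then have c: "\<phi> p w \<in> carrier_vec (card (pos ps p))" if "w \<in> stalk F p" for w
    using that by (auto simp: linear_on_def)
  show "to_coords ps p (\<phi> p v) \<in> coords ps p" by (rule to_coords_mem)
  show "to_coords ps p (\<phi> p (c \<cdot>\<^sub>v v)) = (\<lambda>i. c * to_coords ps p (\<phi> p v) i)" for c
    using lin c s by (auto simp: linear_on_def to_coords_smult)
  show "to_coords ps p (\<phi> p (v + w)) = (\<lambda>i. to_coords ps p (\<phi> p v) i + to_coords ps p (\<phi> p w) i)"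
    if "w \<in> stalk F p" for w
    using lin c s that by (auto simp: linear_on_def to_coords_add)
  fix \<tau> i assume t: "\<tau> \<in> P" "p \<le> \<tau>" "i \<in> pos ps \<tau>"
  have "\<phi> \<tau> (res F p \<tau> v) = res (inj_sum P ps) p \<tau> (\<phi> p v)"
    using assms s t by (simp add: sheaf_hom_def)
  then show "to_coords ps \<tau> (\<phi> \<tau> (res F p \<tau> v)) i = to_coords ps p (\<phi> p v) i"
    using res_coords(2)[OF assms(2), of "\<phi> p v" p \<tau>] c[OF s(2)] t(3) by (simp add: stalk_inj_sum[OF assms(2)])
qed

lemma hom_of_coord_map:
  assumes "is_sheaf P F" "coord_map P F ps h" "set ps \<subseteq> P"
  shows "sheaf_hom P F (inj_sum P ps) (\<lambda>p v. of_coords ps p (h p v))"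
  unfolding sheaf_hom_def linear_on_def stalk_inj_sum[OF assms(3)]
proof (intro conjI ballI allI impI)
  note h = coord_mapD[OF assms(2)]
  note toof = to_of_coords[OF h(1)]
  note oc = of_coords_carrier
  fix p assume s: "p \<in> P"
  show "(\<lambda>v. of_coords ps p (h p v)) \<in> stalk F p \<rightarrow> carrier_vec (card (pos ps p))"
    using oc by auto
  fix u assume u: "u \<in> stalk F p"
  show "of_coords ps p (h p (c \<cdot>\<^sub>v u)) = c \<cdot>\<^sub>v of_coords ps p (h p u)" for c
    using s u by (simp add: h(3) of_coords_smult)
  show "of_coords ps p (h p (u + w)) = of_coords ps p (h p u) + of_coords ps p (h p w)"
    if "w \<in> stalk F p" for w
    using s u that by (simp add: h(2) of_coords_add)
  fix \<tau> assume t: "\<tau> \<in> P" "p \<le> \<tau>"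
  have r: "res F p \<tau> u \<in> stalk F \<tau>"
    using assms(1) s t u unfolding is_sheaf_def linear_on_def by blast
  have z: "h \<tau> (res F p \<tau> u) i = 0" if "i \<notin> pos ps \<tau>" for i
    using h(1)[OF t(1) r] that unfolding coords_def by blast
  note rc = res_coords[OF assms(3), unfolded stalk_inj_sum[OF assms(3)], OF oc]
  show "of_coords ps \<tau> (h \<tau> (res F p \<tau> u)) = res (inj_sum P ps) p \<tau> (of_coords ps p (h p u))"
    by (rule to_coords_inject[where ps = ps and p = \<tau>])
      (use s u t oc r rc(1) z in \<open>auto simp: toof rc(2) h(4) fun_eq_iff\<close>)
qed

lemma coord_map_comp_hom:
  assumes "sheaf_hom P F G \<phi>" "coord_map P G ps h"
  shows "coord_map P F ps (\<lambda>p v. h p (\<phi> p v))"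
proof -
  have c: "\<phi> p v \<in> stalk G p" "w \<in> stalk F p \<Longrightarrow> \<phi> p (v + w) = \<phi> p v + \<phi> p w" "\<phi> p (c \<cdot>\<^sub>v v) = c \<cdot>\<^sub>v \<phi> p v"
    "\<tau> \<in> P \<Longrightarrow> p \<le> \<tau> \<Longrightarrow> \<phi> \<tau> (res F p \<tau> v) = res G p \<tau> (\<phi> p v)"
    if "p \<in> P" "v \<in> stalk F p" for p \<tau> v w c
    using assms(1) that unfolding sheaf_hom_def linear_on_def by blast+
  show ?thesis
    unfolding coord_map_def using assms(2)
    by (auto simp: c coord_mapD)
qed

text \<open>Naturality comes from the labels: for \<open>i \<in> pos qs \<tau>\<close> a nonzero
  \<open>A i j\<close> forces \<open>j \<in> pos ps \<tau>\<close>, and at such \<open>j\<close> the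
  map \<open>h\<close> already commutes with restriction to \<open>\<tau>\<close>.\<close>

lemma coord_map_app:
  assumes "coord_map P F ps h" "labeled qs ps A"
  shows "coord_map P F qs (\<lambda>p v. app qs p A (length ps) (h p v))"
proof -
  have "app qs \<tau> A (length ps) (h \<tau> (res F p \<tau> v)) i = app qs p A (length ps) (h p v) i"
    if s: "p \<in> P" "\<tau> \<in> P" "p \<le> \<tau>" "v \<in> stalk F p" "i \<in> pos qs \<tau>" for p \<tau> v i
  proof -
    have i: "i \<in> pos qs p" using s by (auto simp: pos_def)
    have "(\<Sum>j<length ps. A i j * h \<tau> (res F p \<tau> v) j) = (\<Sum>j<length ps. A i j * h p v j)"
    proof (rule sum.cong)
      fix j
      show "A i j * h \<tau> (res F p \<tau> v) j = A i j * h p v j"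
      proof (cases "A i j = 0")
        case False
        then have "j \<in> pos ps \<tau>" using assms(2) s(5) by (auto simp: labeled_def pos_def intro: order_trans)
        then show ?thesis using coord_mapD(4)[OF assms(1)] s by simp
      qed simp
    qed simp
    then show ?thesis using i s by (simp add: app_def)
  qed
  then show ?thesis
    using assms(1) unfolding coord_map_def
    by (auto simp: app_mem coord_mapD app_add app_smult)
qed

lemma coords_add: "u \<in> coords ps p \<Longrightarrow> w \<in> coords ps p \<Longrightarrow> (\<lambda>i. u i + w i) \<in> coords ps p"
  unfolding coords_def by (smt (verit, best) add.right_neutral mem_Collect_eq)

lemma coord_map_add:
  assumes "coord_map P F ps g" "coord_map P F ps h"
  shows "coord_map P F ps (\<lambda>p v i. g p v i + h p v i)"
  unfolding coord_map_def
  by (intro conjI ballI allI impI)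
    (simp_all add: coords_add coord_mapD[OF assms(1)] coord_mapD[OF assms(2)] algebra_simps)

lemma coord_map_id:
  assumes "set ps \<subseteq> P"
  shows "coord_map P (inj_sum P ps) ps (to_coords ps)"
proof -
  have "sheaf_hom P (inj_sum P ps) (inj_sum P ps) (\<lambda>p v. v)"
    using is_sheaf_inj_sum[OF assms] by (auto simp: sheaf_hom_def linear_on_def)
  from coord_map_of_hom[OF this assms] show ?thesis .
qed

section \<open>The matrix of a morphism between injective sheaves\<close>

definition unit :: "nat \<Rightarrow> nat \<Rightarrow> 'k::field" where
  "unit j = (\<lambda>i. if i = j then 1 else 0)"

lemma unit_mem: "j \<in> pos ps p \<Longrightarrow> unit j \<in> coords ps p"
  by (simp add: unit_def coords_def)

lemma app_unit: "j < n \<Longrightarrow> i \<in> pos rs p \<Longrightarrow> app rs p A n (unit j) i = A i j"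
  by (simp add: app_def unit_def if_distrib cong: if_cong)

lemma coords_expand:
  fixes u :: "nat \<Rightarrow> 'k::field"
  assumes "additive": "\<And>u w. u \<in> coords ps p \<Longrightarrow> w \<in> coords ps p \<Longrightarrow> f (\<lambda>i. u i + w i) = f u + (f w :: 'k)"
    and scale: "\<And>c u. u \<in> coords ps p \<Longrightarrow> f (\<lambda>i. c * u i) = c * f u"
    and u: "u \<in> coords ps p"
  shows "f u = (\<Sum>j\<in>pos ps p. f (unit j) * u j)"
proof -
  have "f (\<lambda>i. if i \<in> S then u i else 0) = (\<Sum>j\<in>S. f (unit j) * u j)" if "finite S" "S \<subseteq> pos ps p" for S
    using that
  proof (induction S)
    case empty
    show ?case using scale[OF u, of 0] by simp
  next
    case (insert j S)
    have "(\<lambda>i. if i \<in> insert j S then u i else 0) = (\<lambda>i. u j * unit j i + (if i \<in> S then u i else 0))"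
      using insert by (auto simp: unit_def)
    then have "f (\<lambda>i. if i \<in> insert j S then u i else 0) = f (\<lambda>i. u j * unit j i + (if i \<in> S then u i else 0))"
      by simp
    also have "\<dots> = f (\<lambda>i. u j * unit j i) + f (\<lambda>i. if i \<in> S then u i else 0)"
      using insert by (intro "additive") (auto simp: coords_def unit_def)
    also have "f (\<lambda>i. u j * unit j i) = u j * f (unit j)"
      using insert by (intro scale unit_mem) simp
    finally show ?case using insert by simp
  qed
  from this[of "pos ps p"] have "f (\<lambda>i. if i \<in> pos ps p then u i else 0) = (\<Sum>j\<in>pos ps p. f (unit j) * u j)"
    by simp
  moreover have "(\<lambda>i. if i \<in> pos ps p then u i else 0) = u" using u by (auto simp: coords_def fun_eq_iff)
  ultimately show ?thesis by simp
qed

text \<open>Row \<open>i\<close> is determined at the single point \<open>qs ! i\<close>: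
  restricting to it does not change coordinate \<open>i\<close>, and there this coordinate is a
  functional on a coordinate space, given by its values on unit vectors. A summand \<open>j\<close>
  absent at \<open>qs ! i\<close> gets the entry 0, which makes the matrix labeled.\<close>

lemma coord_map_matrix:
  fixes h :: "'p::order \<Rightarrow> 'k::field vec \<Rightarrow> nat \<Rightarrow> 'k"
  assumes h: "coord_map P (inj_sum P ps) qs h" and ps: "set ps \<subseteq> P" and qs: "set qs \<subseteq> P"
  obtains A where "labeled qs ps A"
    and "\<And>p v. p \<in> P \<Longrightarrow> v \<in> stalk (inj_sum P ps) p \<Longrightarrow> h p v = app qs p A (length ps) (to_coords ps p v)"
proof
  define A where "A i j = (if i < length qs \<and> j \<in> pos ps (qs ! i)
      then h (qs ! i) (of_coords ps (qs ! i) (unit j)) i else 0)" for i j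
  show "labeled qs ps A" by (auto simp: labeled_def A_def pos_def split: if_splits)
  fix p and v :: "'k vec" assume s: "p \<in> P" and v: "v \<in> stalk (inj_sum P ps) p"
  show "h p v = app qs p A (length ps) (to_coords ps p v)"
  proof
    fix i
    show "h p v i = app qs p A (length ps) (to_coords ps p v) i"
    proof (cases "i \<in> pos qs p")
      case False
      then show ?thesis using coord_mapD(1)[OF h s v] by (auto simp: app_def coords_def)
    next
      case True
      define \<pi> where "\<pi> = qs ! i"
      have \<pi>: "\<pi> \<in> P" "p \<le> \<pi>" "i \<in> pos qs \<pi>" using True qs by (auto simp: pos_def \<pi>_def)
      define w where "w = res (inj_sum P ps) p \<pi> v"
      note w = res_coords[OF ps v, of \<pi>, folded w_def]
      have wc: "w = of_coords ps \<pi> (to_coords ps \<pi> w)"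
        using w(1) by (simp add: of_to_coords stalk_inj_sum[OF ps])
      define f where "f u = h \<pi> (of_coords ps \<pi> u) i" for u
      have oc: "of_coords ps \<pi> u \<in> stalk (inj_sum P ps) \<pi>" for u :: "nat \<Rightarrow> 'k"
        by (simp add: stalk_inj_sum[OF ps] of_coords_carrier)
      have "f (to_coords ps \<pi> w) = (\<Sum>j\<in>pos ps \<pi>. f (unit j) * to_coords ps \<pi> w j)"
        unfolding f_def
        by (intro coords_expand to_coords_mem) (simp_all add: of_coords_add of_coords_smult coord_mapD(2,3)[OF h \<pi>(1) oc] oc)
      also have "\<dots> = (\<Sum>j\<in>pos ps \<pi>. A i j * to_coords ps p v j)"
      proof (rule sum.cong)
        fix j assume j: "j \<in> pos ps \<pi>"
        have "A i j = f (unit j)" using True j by (simp add: f_def A_def \<pi>_def pos_def)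
        then show "f (unit j) * to_coords ps \<pi> w j = A i j * to_coords ps p v j"
          using j by (simp add: w(2))
      qed simp
      also have "\<dots> = (\<Sum>j<length ps. A i j * to_coords ps p v j)"
        by (rule sum.mono_neutral_left) (auto simp: pos_def A_def \<pi>_def)
      also have "f (to_coords ps \<pi> w) = h p v i"
        using coord_mapD(4)[OF h s v \<pi>] by (simp add: f_def wc[symmetric] w_def[symmetric])
      finally show ?thesis using True by (simp add: app_def)
    qed
  qed
qed

lemma coord_map_matrices:
  fixes h :: "'i \<Rightarrow> 'p::order \<Rightarrow> 'k::field vec \<Rightarrow> nat \<Rightarrow> 'k"
  assumes "\<And>d. coord_map P (inj_sum P (ps d)) (qs d) (h d)" "\<And>d. set (ps d) \<subseteq> P" "\<And>d. set (qs d) \<subseteq> P"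
  obtains A where "\<And>d. labeled (qs d) (ps d) (A d)"
    and "\<And>d p v. p \<in> P \<Longrightarrow> v \<in> stalk (inj_sum P (ps d)) p \<Longrightarrow>
      h d p v = app (qs d) p (A d) (length (ps d)) (to_coords (ps d) p v)"
proof -
  have "\<exists>A. labeled (qs d) (ps d) A \<and> (\<forall>p\<in>P. \<forall>v\<in>stalk (inj_sum P (ps d)) p.
      h d p v = app (qs d) p A (length (ps d)) (to_coords (ps d) p v))" for d
    by (rule coord_map_matrix[OF assms]) blast
  then show thesis using that by metis
qed

text \<open>The entry in place \<open>(i, j)\<close> is read off at the point \<open>qs ! i\<close>
  from the unit vector \<open>j\<close>, which is a section there exactly when the labels allow a
  nonzero entry.\<close>

lemma labeled_eqI:
  assumes A: "labeled qs ps A" and B: "labeled qs ps B" and "set qs \<subseteq> P"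
    and eq: "\<And>p u. p \<in> P \<Longrightarrow> u \<in> coords ps p \<Longrightarrow> app qs p A (length ps) u = app qs p B (length ps) u"
  shows "A = B"
proof (intro ext)
  fix i j
  show "A i j = B i j"
  proof (cases "i < length qs \<and> j < length ps \<and> qs ! i \<le> ps ! j")
    case True
    then have "i \<in> pos qs (qs ! i)" "j \<in> pos ps (qs ! i)" "qs ! i \<in> P" using assms(3) by (auto simp: pos_def)
    then show ?thesis using eq[OF _ unit_mem, of "qs ! i" j] True
      by (metis app_unit)
  next
    case False
    then show ?thesis using A B unfolding labeled_def by metis
  qed
qed

lemma entries_mat:
  "labeled rs cs A \<Longrightarrow> entries (mat (length rs) (length cs) (\<lambda>(i, j). A i j)) = A"
  by (fastforce simp: entries_def labeled_def fun_eq_iff)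

lemma labeled_matrix_mat:
  "labeled rs cs A \<Longrightarrow> set rs \<subseteq> P \<Longrightarrow> set cs \<subseteq> P \<Longrightarrow>
    labeled_matrix P rs cs (mat (length rs) (length cs) (\<lambda>(i, j). A i j))"
  by (auto simp: labeled_matrix_def labeled_def)

section \<open>Extension of functionals\<close>

definition functional_on :: "'k::field vec set \<Rightarrow> ('k vec \<Rightarrow> 'k) \<Rightarrow> bool" where
  "functional_on U f \<longleftrightarrow> (\<forall>u\<in>U. \<forall>v\<in>U. f (u + v) = f u + f v) \<and> (\<forall>c. \<forall>u\<in>U. f (c \<cdot>\<^sub>v u) = c * f u)"

text \<open>\<open>T\<close> is the graph of a linear functional on a subspace, with
  \<open>single\<close> making it single-valued. The values on a basis of the domain are extended to
  the whole function space.\<close>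

lemma extend_functional:
  fixes T :: "(('a \<Rightarrow> 'k::field) \<times> 'k) set"
  assumes ne: "T \<noteq> {}"
    and add: "\<And>v c w d. (v, c) \<in> T \<Longrightarrow> (w, d) \<in> T \<Longrightarrow> ((\<lambda>i. v i + w i), c + d) \<in> T"
    and scale: "\<And>v c a. (v, c) \<in> T \<Longrightarrow> ((\<lambda>i. a * v i), a * c) \<in> T"
    and single: "\<And>c. ((\<lambda>i. 0), c) \<in> T \<Longrightarrow> c = 0"
  obtains f where "\<And>v w. f (\<lambda>i. v i + w i) = f v + f w" "\<And>a v. f (\<lambda>i. a * v i) = a * f v"
    "\<And>v c. (v, c) \<in> T \<Longrightarrow> f v = c"
proof -
  interpret V: vector_space "\<lambda>a (v :: 'a \<Rightarrow> 'k) i. a * v i"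
    by unfold_locales (auto simp: algebra_simps)
  interpret K: vector_space "(*) :: 'k \<Rightarrow> 'k \<Rightarrow> 'k"
    by unfold_locales (auto simp: algebra_simps)
  interpret VK: vector_space_pair "\<lambda>a (v :: 'a \<Rightarrow> 'k) i. a * v i" "(*) :: 'k \<Rightarrow> 'k \<Rightarrow> 'k"
    by unfold_locales
  have unique: "c = d" if "(v, c) \<in> T" "(v, d) \<in> T" for v c d
  proof -
    have "((\<lambda>i. v i + - 1 * v i), c + - 1 * d) \<in> T" by (intro add scale that)
    then show ?thesis using single[of "c - d"] by simp
  qed
  define g where "g v = (THE c. (v, c) \<in> T)" for v
  have g: "g v = c" if "(v, c) \<in> T" for v c
    unfolding g_def using that unique by blast
  obtain B where B: "B \<subseteq> fst ` T" "V.independent B" "fst ` T \<subseteq> V.span B"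
    using V.maximal_independent_subset by metis
  obtain f where f: "Vector_Spaces.linear (\<lambda>a v i. a * v i) (*) f" "\<forall>x\<in>B. f x = g x"
    using VK.linear_independent_extend[OF B(2)] by blast
  interpret F: Vector_Spaces.linear "\<lambda>a (v :: 'a \<Rightarrow> 'k) i. a * v i" "(*) :: 'k \<Rightarrow> 'k \<Rightarrow> 'k" f
    by (rule f(1))
  have f_add: "f (\<lambda>i. v i + w i) = f v + f w" for v w
    using F.add[of v w] by (simp add: plus_fun_def)
  have f_scale: "f (\<lambda>i. a * v i) = a * f v" for a v
    by (rule F.scale)
  \<comment> \<open>Agreement on the basis spreads to its span because \<open>T\<close> is closed
    under sums and multiples; uniqueness of values then gives the extension property.\<close>
  have "(v, f v) \<in> T" if "v \<in> V.span B" for v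
    using that
  proof (induction rule: V.span_induct_alt)
    case base
    obtain v c where "(v, c) \<in> T" using ne by auto
    from scale[OF this, of 0] show ?case using F.zero by (simp add: zero_fun_def)
  next
    case (step a x y)
    obtain c where c: "(x, c) \<in> T" using B(1) step(1) by force
    then have "(x, f x) \<in> T" using g f(2) step(1) by auto
    from add[OF scale[OF this, of a] step(2)]
    show ?case by (simp add: plus_fun_def f_add f_scale)
  qed
  then have "f v = c" if "(v, c) \<in> T" for v c
    using B(3) that unique by (metis fst_conv image_subset_iff)
  then show thesis using that f_add f_scale by blast
qed

text \<open>A functional on a direct sum is a pair of functionals. Both spaces are embedded into
  functions on \<open>nat + nat\<close>, and \<open>h\<close> and \<open>s\<close> are the two
  restrictions of one extension.\<close>

lemma extend_functional_pair:
  fixes X Y :: "'k::field vec set" and T :: "('k vec \<times> 'k vec \<times> 'k) set"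
  assumes X: "fd_space X" and Y: "fd_space Y" and T: "T \<noteq> {}" "T \<subseteq> Y \<times> X \<times> UNIV"
    and add: "\<And>y x c y' x' c'. (y, x, c) \<in> T \<Longrightarrow> (y', x', c') \<in> T \<Longrightarrow> (y + y', x + x', c + c') \<in> T"
    and scale: "\<And>y x c a. (y, x, c) \<in> T \<Longrightarrow> (a \<cdot>\<^sub>v y, a \<cdot>\<^sub>v x, a * c) \<in> T"
    and single: "\<And>y x c. (y, x, c) \<in> T \<Longrightarrow> is_zero y \<Longrightarrow> is_zero x \<Longrightarrow> c = 0"
  obtains h s where "functional_on Y h" "functional_on X s" "\<And>y x c. (y, x, c) \<in> T \<Longrightarrow> h y + s x = c"
proof -
  obtain m where m: "X \<subseteq> carrier_vec m" using X by (rule fd_spaceE)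
  obtain n where n: "Y \<subseteq> carrier_vec n" using Y by (rule fd_spaceE)
  \<comment> \<open>The cutoff at \<open>l\<close> replaces the unspecified values of a vector
    beyond its dimension by 0, so that \<open>z\<close> is additive on all indices.\<close>
  define z where "z l v i = (if i < l then v $ i else 0)" for l :: nat and v :: "'k vec" and i
  define e :: "'k vec \<Rightarrow> 'k vec \<Rightarrow> nat + nat \<Rightarrow> 'k" where
    "e y x = case_sum (z n y) (z m x)" for y x
  have z_add: "z l (v + w) i = z l v i + z l w i" if "v \<in> carrier_vec l" "w \<in> carrier_vec l" for l v w i
    using that by (simp add: z_def)
  have z_scale: "z l (a \<cdot>\<^sub>v v) i = a * z l v i" if "v \<in> carrier_vec l" for l a v i
    using that by (simp add: z_def)
  have z_zero: "is_zero v" if "v \<in> carrier_vec l" "\<And>i. z l v i = 0" for l v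
    unfolding is_zero_def using that by (intro eq_vecI) (auto simp: z_def, metis)
  define T' where "T' = (\<lambda>(y, x, c). (e y x, c)) ` T"
  have c: "y \<in> carrier_vec n" "x \<in> carrier_vec m" if "(y, x, c) \<in> T" for y x c
    using that T(2) m n by auto
  obtain f where f: "\<And>v w. f (\<lambda>i. v i + w i) = f v + f w" "\<And>a v. f (\<lambda>i. a * v i) = a * f v"
    "\<And>v c. (v, c) \<in> T' \<Longrightarrow> f v = c"
  proof (rule extend_functional[of T'])
    show "T' \<noteq> {}" using T(1) by (simp add: T'_def)
    show "((\<lambda>i. v i + w i), c + d) \<in> T'" if "(v, c) \<in> T'" "(w, d) \<in> T'" for v c w d
    proof -
      obtain y x y' x' where *: "(y, x, c) \<in> T" "v = e y x" "(y', x', d) \<in> T" "w = e y' x'"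
        using \<open>(v, c) \<in> T'\<close> \<open>(w, d) \<in> T'\<close> by (auto simp: T'_def)
      have "(\<lambda>i. v i + w i) = e (y + y') (x + x')"
        using c[OF *(1)] c[OF *(3)] by (auto simp: * e_def z_add fun_eq_iff split: sum.split)
      then show ?thesis using add[OF *(1) *(3)] unfolding T'_def by force
    qed
    show "((\<lambda>i. a * v i), a * c) \<in> T'" if "(v, c) \<in> T'" for v c a
    proof -
      obtain y x where *: "(y, x, c) \<in> T" "v = e y x"
        using \<open>(v, c) \<in> T'\<close> by (auto simp: T'_def)
      have "(\<lambda>i. a * v i) = e (a \<cdot>\<^sub>v y) (a \<cdot>\<^sub>v x)"
        using c[OF *(1)] by (auto simp: * e_def z_scale fun_eq_iff split: sum.split)
      then show ?thesis using scale[OF *(1), of a] unfolding T'_def by force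
    qed
    show "c = 0" if "((\<lambda>i. 0), c) \<in> T'" for c
    proof -
      obtain y x where *: "(y, x, c) \<in> T" "e y x = (\<lambda>i. 0)"
        using \<open>((\<lambda>i. 0), c) \<in> T'\<close> by (auto simp: T'_def)
      have "z n y i = 0" "z m x i = 0" for i
        using fun_cong[OF *(2), of "Inl i"] fun_cong[OF *(2), of "Inr i"] by (simp_all add: e_def)
      then show ?thesis using single[OF *(1)] z_zero c[OF *(1)] by blast
    qed
  qed blast
  define eY :: "'k vec \<Rightarrow> nat + nat \<Rightarrow> 'k" where "eY y = case_sum (z n y) (\<lambda>i. 0)" for y
  define eX :: "'k vec \<Rightarrow> nat + nat \<Rightarrow> 'k" where "eX x = case_sum (\<lambda>i. 0) (z m x)" for x
  define h where "h y = f (eY y)" for y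
  define s where "s x = f (eX x)" for x
  show thesis
  proof
    show "functional_on Y h" unfolding functional_on_def h_def
    proof (intro conjI ballI allI)
      fix u v c assume u: "u \<in> Y"
      have "eY (c \<cdot>\<^sub>v u) = (\<lambda>i. c * eY u i)"
        using u n by (auto simp: eX_def eY_def z_scale fun_eq_iff split: sum.split)
      then show "f (eY (c \<cdot>\<^sub>v u)) = c * f (eY u)" by (simp only: f(2))
      assume v: "v \<in> Y"
      have "eY (u + v) = (\<lambda>i. eY u i + eY v i)"
        using u v n by (auto simp: eX_def eY_def z_add fun_eq_iff subset_iff split: sum.split)
      then show "f (eY (u + v)) = f (eY u) + f (eY v)" by (simp only: f(1))
    qed
    show "functional_on X s" unfolding functional_on_def s_def
    proof (intro conjI ballI allI)
      fix u v c assume u: "u \<in> X"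
      have "eX (c \<cdot>\<^sub>v u) = (\<lambda>i. c * eX u i)"
        using u m by (auto simp: eX_def eY_def z_scale fun_eq_iff split: sum.split)
      then show "f (eX (c \<cdot>\<^sub>v u)) = c * f (eX u)" by (simp only: f(2))
      assume v: "v \<in> X"
      have "eX (u + v) = (\<lambda>i. eX u i + eX v i)"
        using u v m by (auto simp: eX_def eY_def z_add fun_eq_iff subset_iff split: sum.split)
      then show "f (eX (u + v)) = f (eX u) + f (eX v)" by (simp only: f(1))
    qed
    fix y x c assume t: "(y, x, c) \<in> T"
    have "h y + s x = f (\<lambda>i. eY y i + eX x i)"
      by (simp only: h_def s_def f(1))
    also have "(\<lambda>i. eY y i + eX x i) = e y x"
      by (auto simp: e_def eX_def eY_def fun_eq_iff split: sum.split)
    also have "f (e y x) = c" using t by (intro f) (force simp: T'_def)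
    finally show "h y + s x = c" .
  qed
qed

section \<open>Lifting along quasi-isomorphisms\<close>

lemma fd_space_add: "fd_space U \<Longrightarrow> u \<in> U \<Longrightarrow> v \<in> U \<Longrightarrow> u + v \<in> U"
  and fd_space_smult: "fd_space U \<Longrightarrow> u \<in> U \<Longrightarrow> c \<cdot>\<^sub>v u \<in> U"
  by (auto simp: fd_space_def)

lemma fd_space_dim: "fd_space U \<Longrightarrow> \<exists>n. U \<subseteq> carrier_vec n"
  by (auto simp: fd_space_def)

lemma sheafD:
  assumes "is_sheaf P F" "p \<in> P"
  shows "fd_space (stalk F p)"
    and "u \<in> stalk F p \<Longrightarrow> v \<in> stalk F p \<Longrightarrow> u + v \<in> stalk F p"
    and "u \<in> stalk F p \<Longrightarrow> c \<cdot>\<^sub>v u \<in> stalk F p"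
    and "\<tau> \<in> P \<Longrightarrow> p \<le> \<tau> \<Longrightarrow> u \<in> stalk F p \<Longrightarrow> res F p \<tau> u \<in> stalk F \<tau>"
    and "\<tau> \<in> P \<Longrightarrow> p \<le> \<tau> \<Longrightarrow> u \<in> stalk F p \<Longrightarrow> v \<in> stalk F p \<Longrightarrow>
      res F p \<tau> (u + v) = res F p \<tau> u + res F p \<tau> v"
    and "\<tau> \<in> P \<Longrightarrow> p \<le> \<tau> \<Longrightarrow> u \<in> stalk F p \<Longrightarrow> res F p \<tau> (c \<cdot>\<^sub>v u) = c \<cdot>\<^sub>v res F p \<tau> u"
    and "\<tau> \<in> P \<Longrightarrow> \<rho> \<in> P \<Longrightarrow> p \<le> \<tau> \<Longrightarrow> \<tau> \<le> \<rho> \<Longrightarrow> u \<in> stalk F p \<Longrightarrow>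
      res F \<tau> \<rho> (res F p \<tau> u) = res F p \<rho> u"
  subgoal using assms by (simp add: is_sheaf_def)
  subgoal using assms fd_space_add by (auto simp: is_sheaf_def)
  subgoal using assms fd_space_smult by (auto simp: is_sheaf_def)
  subgoal using assms by (simp add: is_sheaf_def linear_on_def Pi_iff)
  subgoal using assms by (simp add: is_sheaf_def linear_on_def)
  subgoal using assms by (simp add: is_sheaf_def linear_on_def)
  subgoal using assms unfolding is_sheaf_def by blast
  done

lemma sheaf_homD:
  assumes "sheaf_hom P F G \<phi>" "p \<in> P" "u \<in> stalk F p"
  shows "\<phi> p u \<in> stalk G p"
    and "v \<in> stalk F p \<Longrightarrow> \<phi> p (u + v) = \<phi> p u + \<phi> p v"
    and "\<phi> p (c \<cdot>\<^sub>v u) = c \<cdot>\<^sub>v \<phi> p u"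
    and "\<tau> \<in> P \<Longrightarrow> p \<le> \<tau> \<Longrightarrow> \<phi> \<tau> (res F p \<tau> u) = res G p \<tau> (\<phi> p u)"
  using assms by (simp_all add: sheaf_hom_def linear_on_def Pi_iff)

lemma minus_vec_eq: "u - v = u + (- 1) \<cdot>\<^sub>v v" for u v :: "'k::field vec"
  by (rule eq_vecI) auto

lemma coord_map_minus:
  assumes "is_sheaf P F" "coord_map P F ps h" "p \<in> P" "u \<in> stalk F p" "v \<in> stalk F p"
  shows "h p (u - v) = (\<lambda>i. h p u i - h p v i)"
  using assms by (simp add: minus_vec_eq coord_mapD sheafD)

lemma is_zero_iff: "is_zero v \<longleftrightarrow> (\<forall>i<dim_vec v. v $ i = 0)"
  unfolding is_zero_def by (metis eq_vecI index_zero_vec)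

lemma is_zero_smult: "is_zero v \<Longrightarrow> 0 \<cdot>\<^sub>v v = v"
  by (rule eq_vecI) (auto simp: is_zero_iff)

lemma is_zero_zero_smult: "is_zero (0 \<cdot>\<^sub>v v)"
  by (simp add: is_zero_iff)

lemma coord_map_zero:
  assumes "coord_map P F ps h" "p \<in> P" "v \<in> stalk F p" "is_zero v"
  shows "h p v = (\<lambda>i. 0)"
  using coord_mapD(3)[OF assms(1-3), of 0] is_zero_smult[OF assms(4)] by simp

lemma sheaf_hom_zero:
  assumes "sheaf_hom P F G \<phi>" "p \<in> P" "v \<in> stalk F p" "is_zero v"
  shows "is_zero (\<phi> p v)"
  using sheaf_homD(3)[OF assms(1-3), of 0] is_zero_smult[OF assms(4)] is_zero_zero_smult by metis

lemma sheaf_nonempty: "is_sheaf P F \<Longrightarrow> p \<in> P \<Longrightarrow> \<exists>v. v \<in> stalk F p"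
  using sheafD(1) by (blast elim: fd_spaceE)

lemma is_zero_add_imp:
  assumes "is_zero (a + b)" "a \<in> carrier_vec n" "b \<in> carrier_vec n"
  shows "b = (- 1) \<cdot>\<^sub>v a"
proof (rule eq_vecI)
  fix i assume "i < dim_vec ((- 1) \<cdot>\<^sub>v a)"
  then have i: "i < n" using assms by simp
  then have "(a + b) $ i = 0" using assms by (auto simp: is_zero_iff)
  then show "b $ i = ((- 1) \<cdot>\<^sub>v a) $ i" using i assms by (simp add: eq_neg_iff_add_eq_0 add.commute)
qed (use assms in simp)

lemma complexD:
  assumes "bounded_complex P A"
  shows "is_sheaf P (obj A d)" "sheaf_hom P (obj A d) (obj A (d + 1)) (dif A d)"
    and "p \<in> P \<Longrightarrow> v \<in> stalk (obj A d) p \<Longrightarrow> is_zero (dif A (d + 1) p (dif A d p v))"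
  using assms by (auto simp: bounded_complex_def)

lemma coboundaries_Suc: "coboundaries A (d + 1) p = dif A d p ` stalk (obj A d) p"
  by (simp add: coboundaries_def)

section \<open>Complexes and chain maps in coordinates\<close>

definition coord_complex :: "'p::order set \<Rightarrow> (int \<Rightarrow> 'p list) \<Rightarrow> (int \<Rightarrow> nat \<Rightarrow> nat \<Rightarrow> 'k::field) \<Rightarrow> bool" where
  "coord_complex P L m \<longleftrightarrow>
     (\<forall>d. set (L d) \<subseteq> P) \<and> (\<forall>d. labeled (L (d + 1)) (L d) (m d)) \<and>
     (\<forall>d. mmult (length (L (d + 1))) (m (d + 1)) (m d) = (\<lambda>i j. 0)) \<and> finite {d. L d \<noteq> []}"

definition cdif :: "(int \<Rightarrow> 'p::order list) \<Rightarrow> (int \<Rightarrow> nat \<Rightarrow> nat \<Rightarrow> 'k::field) \<Rightarrow> int \<Rightarrow> 'p \<Rightarrow> (nat \<Rightarrow> 'k) \<Rightarrow> nat \<Rightarrow> 'k" where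
  "cdif L m d p u = app (L (d + 1)) p (m d) (length (L d)) u"

definition coord_chain :: "'p::order set \<Rightarrow> ('p, 'k::field) complex_of_sheaves \<Rightarrow> (int \<Rightarrow> 'p list) \<Rightarrow>
    (int \<Rightarrow> nat \<Rightarrow> nat \<Rightarrow> 'k) \<Rightarrow> (int \<Rightarrow> 'p \<Rightarrow> 'k vec \<Rightarrow> nat \<Rightarrow> 'k) \<Rightarrow> bool" where
  "coord_chain P A L m f \<longleftrightarrow> (\<forall>d. coord_map P (obj A d) (L d) (f d)) \<and>
     (\<forall>d. \<forall>p\<in>P. \<forall>v\<in>stalk (obj A d) p. f (d + 1) p (dif A d p v) = cdif L m d p (f d p v))"

lemma coord_complexD:
  assumes "coord_complex P L m"
  shows "set (L d) \<subseteq> P" "labeled (L (d + 1)) (L d) (m d)"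
    "mmult (length (L (d + 1))) (m (d + 1)) (m d) = (\<lambda>i j. 0)" "finite {d. L d \<noteq> []}"
  using assms by (auto simp: coord_complex_def)

lemma cdif_cdif:
  assumes "coord_complex P L m"
  shows "cdif L m (d + 1) p (cdif L m d p u) = (\<lambda>i. 0)"
  unfolding cdif_def app_mmult[OF coord_complexD(2)[OF assms]] coord_complexD(3)[OF assms]
  by (auto simp: app_def fun_eq_iff)

lemma cdif_linear:
  "cdif L m d p (\<lambda>i. u i + w i) = (\<lambda>i. cdif L m d p u i + cdif L m d p w i)"
  "cdif L m d p (\<lambda>i. u i - w i) = (\<lambda>i. cdif L m d p u i - cdif L m d p w i)"
  "cdif L m d p (\<lambda>i. c * u i) = (\<lambda>i. c * cdif L m d p u i)"
  "cdif L m d p (\<lambda>i. - u i) = (\<lambda>i. - cdif L m d p u i)"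
  "cdif L m d p (\<lambda>i. 0) = (\<lambda>i. 0)"
  by (simp_all add: cdif_def app_add app_diff app_smult app_uminus app_zero)

lemma coord_map_cdif:
  "coord_complex P L m \<Longrightarrow> coord_map P F (L d) h \<Longrightarrow> coord_map P F (L (d + 1)) (\<lambda>p v. cdif L m d p (h p v))"
  unfolding cdif_def by (intro coord_map_app coord_complexD(2))

text \<open>The isomorphism of Hom(F, [\<pi>]) with the dual of F(\<pi>), summand by summand: at a
  point below the label, restrict to the label and apply the functional. Functoriality of
  \<open>F\<close> makes this natural.\<close>

lemma coord_map_of_functionals:
  assumes F: "is_sheaf P F" and ps: "set ps \<subseteq> P"
    and f: "\<And>i. i < length ps \<Longrightarrow> functional_on (stalk F (ps ! i)) (f i)"
  shows "coord_map P F ps (\<lambda>p v i. if i \<in> pos ps p then f i (res F p (ps ! i) v) else 0)"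
proof -
  have i: "ps ! i \<in> P" "p \<le> ps ! i" "functional_on (stalk F (ps ! i)) (f i)" if "i \<in> pos ps p" for i p
    using that f ps by (auto simp: pos_def)
  have fl: "v \<in> stalk F (ps ! i) \<Longrightarrow> f i (u + v) = f i u + f i v" "f i (c \<cdot>\<^sub>v u) = c * f i u"
    if "i \<in> pos ps p" "u \<in> stalk F (ps ! i)" for i u v c p
    using that i(3) by (auto simp: functional_on_def)
  show ?thesis
    unfolding coord_map_def
    by (intro conjI ballI allI impI)
      (auto simp: coords_def fun_eq_iff i fl sheafD[OF F] intro: pos_mono)
qed

text \<open>One degree of the construction of \<open>h\<close> and \<open>s\<close> with \<open>h q = g + \<partial> s + s \<partial>\<close>. The condition \<open>cons\<close> says
  that the values prescribed for \<open>(h', s')\<close> on the image of the differential of the cone of \<open>q\<close> are well defined.\<close>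

lemma lift_step:
  assumes d': "d' = d + 1" and X: "bounded_complex P X" and Y: "bounded_complex P Y" and q: "chain_map P X Y q"
    and A: "coord_complex P L m" and g: "coord_chain P X L m g"
    and h: "coord_map P (obj Y d) (L d) h" and s: "coord_map P (obj X d') (L d) s"
    and cons: "\<And>p x y i. p \<in> P \<Longrightarrow> x \<in> stalk (obj X d') p \<Longrightarrow> y \<in> stalk (obj Y d) p \<Longrightarrow>
      is_zero (dif Y d p y + q d' p x) \<Longrightarrow> is_zero (dif X d' p x) \<Longrightarrow>
      cdif L m d p (h p y) i + g d' p x i + cdif L m d p (s p x) i = 0"
  obtains h' s' where "coord_map P (obj Y d') (L d') h'"
    "coord_map P (obj X (d' + 1)) (L d') s'"
    "\<And>p y. p \<in> P \<Longrightarrow> y \<in> stalk (obj Y d) p \<Longrightarrow> h' p (dif Y d p y) = cdif L m d p (h p y)"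
    "\<And>p x. p \<in> P \<Longrightarrow> x \<in> stalk (obj X d') p \<Longrightarrow>
      (\<lambda>i. h' p (q d' p x) i - s' p (dif X d' p x) i)
      = (\<lambda>i. g d' p x i + cdif L m d p (s p x) i)"
proof -
  let ?ps = "L d'"
  note sX = complexD(1)[OF X] and sY = complexD(1)[OF Y]
  note dX = sheaf_homD[OF complexD(2)[OF X, of d']] and dY = sheaf_homD[OF complexD(2)[OF Y, of d, folded d']]
  have "sheaf_hom P (obj X d) (obj Y d) (q d)" for d using q by (simp add: chain_map_def)
  note qD = sheaf_homD[OF this]
  have gm: "coord_map P (obj X d) (L d) (g d)" for d using g by (simp add: coord_chain_def)
  define a where "a p y = cdif L m d p (h p y)" for p y
  define b where "b p x = (\<lambda>i. g d' p x i + cdif L m d p (s p x) i)" for p x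
  have am: "coord_map P (obj Y d) ?ps a" unfolding a_def by (rule coord_map_cdif[OF A h, folded d'])
  have bm: "coord_map P (obj X d') ?ps b"
    unfolding b_def by (intro coord_map_add gm coord_map_cdif[OF A s, folded d'])
  note aD = coord_mapD[OF am] and bD = coord_mapD[OF bm]
  define Q where "Q i \<pi> f e \<longleftrightarrow> functional_on (stalk (obj Y d') \<pi>) f \<and> functional_on (stalk (obj X (d' + 1)) \<pi>) e \<and>
      (\<forall>y\<in>stalk (obj Y d) \<pi>. f (dif Y d \<pi> y) = a \<pi> y i) \<and>
      (\<forall>x\<in>stalk (obj X d') \<pi>. f (q d' \<pi> x) - e (dif X d' \<pi> x) = b \<pi> x i)" for i \<pi> f e
  have "\<exists>f e. Q i \<pi> f e"
    if \<pi>: "\<pi> \<in> P" for i \<pi>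
  proof -
    \<comment> \<open>The first two components are, up to sign, the cone differential applied to the
      pair of \<open>y\<close> and \<open>x\<close>; the third is the value that the new pair of
      functionals must take there.\<close>
    define el where "el x y = (dif Y d \<pi> y + q d' \<pi> x, dif X d' \<pi> x, a \<pi> y i + b \<pi> x i)" for x y
    define T where "T = {el x y |x y. x \<in> stalk (obj X d') \<pi> \<and> y \<in> stalk (obj Y d) \<pi>}"
    obtain nY where nY: "stalk (obj Y d') \<pi> \<subseteq> carrier_vec nY"
      using fd_space_dim[OF sheafD(1)[OF sY \<pi>]] by blast
    obtain nX where nX: "stalk (obj X (d' + 1)) \<pi> \<subseteq> carrier_vec nX"
      using fd_space_dim[OF sheafD(1)[OF sX \<pi>]] by blast
    have cv: "dif Y d \<pi> y \<in> carrier_vec nY" "q d' \<pi> x \<in> carrier_vec nY" "dif X d' \<pi> x \<in> carrier_vec nX"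
      if "x \<in> stalk (obj X d') \<pi>" "y \<in> stalk (obj Y d) \<pi>" for x y
      using dX(1)[OF \<pi> that(1)] dY(1)[OF \<pi> that(2)] qD(1)[OF \<pi> that(1)] nX nY by auto
    obtain f e where fe: "functional_on (stalk (obj Y d') \<pi>) f" "functional_on (stalk (obj X (d' + 1)) \<pi>) e"
      "\<And>y x c. (y, x, c) \<in> T \<Longrightarrow> f y + e x = c"
    proof (rule extend_functional_pair[of "stalk (obj X (d' + 1)) \<pi>" "stalk (obj Y d') \<pi>" T])
      show "fd_space (stalk (obj X (d' + 1)) \<pi>)" "fd_space (stalk (obj Y d') \<pi>)"
        by (rule sheafD(1)[OF sX \<pi>], rule sheafD(1)[OF sY \<pi>])
      show "T \<noteq> {}" using sheaf_nonempty[OF sX \<pi>] sheaf_nonempty[OF sY \<pi>] unfolding T_def by blast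
      show "T \<subseteq> stalk (obj Y d') \<pi> \<times> stalk (obj X (d' + 1)) \<pi> \<times> UNIV"
        using \<pi> by (auto simp: T_def el_def dX qD dY sheafD[OF sY])
    next
      fix y x c y' x' c' assume "(y, x, c) \<in> T" "(y', x', c') \<in> T"
      then obtain x0 y0 x1 y1 where *: "(y, x, c) = el x0 y0" "(y', x', c') = el x1 y1"
        "x0 \<in> stalk (obj X d') \<pi>" "y0 \<in> stalk (obj Y d) \<pi>"
        "x1 \<in> stalk (obj X d') \<pi>" "y1 \<in> stalk (obj Y d) \<pi>"
        by (auto simp: T_def)
      have "(y + y', x + x', c + c') = el (x0 + x1) (y0 + y1)"
        using * cv[OF *(3,4)] cv[OF *(5,6)] \<pi>
        by (auto simp: el_def dX dY qD aD bD intro!: eq_vecI)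
      then show "(y + y', x + x', c + c') \<in> T"
        using * \<pi> unfolding T_def by (auto intro!: exI sheafD(2)[OF sX] sheafD(2)[OF sY])
    next
      fix y x c z assume "(y, x, c) \<in> T"
      then obtain x0 y0 where *: "(y, x, c) = el x0 y0"
        "x0 \<in> stalk (obj X d') \<pi>" "y0 \<in> stalk (obj Y d) \<pi>"
        by (auto simp: T_def)
      have "(z \<cdot>\<^sub>v y, z \<cdot>\<^sub>v x, z * c) = el (z \<cdot>\<^sub>v x0) (z \<cdot>\<^sub>v y0)"
        using * cv[OF *(2,3)] \<pi>
        by (auto simp: el_def dX dY qD aD bD algebra_simps intro!: eq_vecI)
      then show "(z \<cdot>\<^sub>v y, z \<cdot>\<^sub>v x, z * c) \<in> T"
        using * \<pi> unfolding T_def by (auto intro!: exI sheafD(3)[OF sX] sheafD(3)[OF sY])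
    next
      fix y x c assume "(y, x, c) \<in> T" "is_zero y" "is_zero x"
      then show "c = 0" using cons[OF \<pi>] by (auto simp: T_def el_def a_def b_def add.assoc)
    qed blast
    note fl = fe(1,2)[unfolded functional_on_def]
    have E: "f (dif Y d \<pi> y) + f (q d' \<pi> x) + e (dif X d' \<pi> x) = a \<pi> y i + b \<pi> x i"
      if "x \<in> stalk (obj X d') \<pi>" "y \<in> stalk (obj Y d) \<pi>" for x y
    proof -
      have "el x y \<in> T" using that by (auto simp: T_def)
      then have "f (dif Y d \<pi> y + q d' \<pi> x) + e (dif X d' \<pi> x) = a \<pi> y i + b \<pi> x i"
        unfolding el_def by (rule fe(3))
      then show ?thesis using fl that \<pi> by (simp add: dX dY qD)
    qed
    \<comment> \<open>\<open>E\<close> states both requirements at once; putting one argument to 0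
      separates them. The zero is a multiple of some element because the dimension of the stalk has
      no name.\<close>
    have "f (dif Y d \<pi> y) = a \<pi> y i" if y: "y \<in> stalk (obj Y d) \<pi>" for y
    proof -
      obtain x where x: "x \<in> stalk (obj X d') \<pi>" using sheaf_nonempty[OF sX \<pi>] by blast
      have "0 \<cdot>\<^sub>v x \<in> stalk (obj X d') \<pi>" by (intro sheafD(3)[OF sX \<pi>] x)
      from E[OF this y] show ?thesis using x \<pi> fl by (simp add: dX qD bD)
    qed
    moreover have "f (q d' \<pi> x) + e (dif X d' \<pi> x) = b \<pi> x i"
      if x: "x \<in> stalk (obj X d') \<pi>" for x
    proof -
      obtain y where y: "y \<in> stalk (obj Y d) \<pi>" using sheaf_nonempty[OF sY \<pi>] by blast
      have "0 \<cdot>\<^sub>v y \<in> stalk (obj Y d) \<pi>" by (intro sheafD(3)[OF sY \<pi>] y)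
      from E[OF x this] show ?thesis using y \<pi> fl by (simp add: dY aD)
    qed
    \<comment> \<open>The sign turns the sum delivered by the extension into the difference demanded
      by \<open>Q\<close>, so that the homotopy identity has no minus signs in the end.\<close>
    moreover have "functional_on (stalk (obj X (d' + 1)) \<pi>) (\<lambda>v. - e v)"
      using fe(2) by (simp add: functional_on_def)
    ultimately have "Q i \<pi> f (\<lambda>v. - e v)" using fe(1) by (simp add: Q_def)
    then show ?thesis by blast
  qed
  then have "\<forall>i \<pi>. \<exists>w. \<pi> \<in> P \<longrightarrow> Q i \<pi> (fst w) (snd w)"
    by (metis fst_conv snd_conv)
  then obtain w where w: "\<forall>i \<pi>. \<pi> \<in> P \<longrightarrow> Q i \<pi> (fst (w i \<pi>)) (snd (w i \<pi>))"
    unfolding choice_iff by blast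
  define f where "f i \<pi> = fst (w i \<pi>)" for i \<pi>
  define e where "e i \<pi> = snd (w i \<pi>)" for i \<pi>
  have
    f: "\<And>i \<pi>. \<pi> \<in> P \<Longrightarrow> functional_on (stalk (obj Y d') \<pi>) (f i \<pi>)" and
    e: "\<And>i \<pi>. \<pi> \<in> P \<Longrightarrow> functional_on (stalk (obj X (d' + 1)) \<pi>) (e i \<pi>)" and
    fa: "\<And>i \<pi> y. \<pi> \<in> P \<Longrightarrow> y \<in> stalk (obj Y d) \<pi> \<Longrightarrow> f i \<pi> (dif Y d \<pi> y) = a \<pi> y i" and
    fb: "\<And>i \<pi> x. \<pi> \<in> P \<Longrightarrow> x \<in> stalk (obj X d') \<pi> \<Longrightarrow>
      f i \<pi> (q d' \<pi> x) - e i \<pi> (dif X d' \<pi> x) = b \<pi> x i"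
    using w by (simp_all add: Q_def f_def e_def)
  define h' where "h' p v = (\<lambda>i. if i \<in> pos ?ps p then f i (?ps ! i) (res (obj Y d') p (?ps ! i) v) else 0)" for p v
  define s' where "s' p v = (\<lambda>i. if i \<in> pos ?ps p then e i (?ps ! i) (res (obj X (d' + 1)) p (?ps ! i) v) else 0)" for p v
  have ps: "set ?ps \<subseteq> P" by (rule coord_complexD(1)[OF A])
  have lab: "?ps ! i \<in> P" "p \<le> ?ps ! i" "i \<in> pos ?ps (?ps ! i)" if "i \<in> pos ?ps p" for i p
    using that ps by (auto simp: pos_def)
  show thesis
  proof
    show "coord_map P (obj Y d') ?ps h'" unfolding h'_def
      using ps by (intro coord_map_of_functionals sY f) auto
    show "coord_map P (obj X (d' + 1)) ?ps s'" unfolding s'_def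
      using ps by (intro coord_map_of_functionals sX e) auto
    fix p assume p: "p \<in> P"
    \<comment> \<open>Both identities are checked one coordinate at a time: coordinates absent at
      \<open>p\<close> vanish on both sides, and a present coordinate is moved by naturality to its
      own label, where the functionals were chosen.\<close>
    have out: "a p y i = 0" "b p x i = 0"
      if "i \<notin> pos ?ps p" "y \<in> stalk (obj Y d) p" "x \<in> stalk (obj X d') p" for i x y
      using aD(1)[OF p that(2)] bD(1)[OF p that(3)] that(1) by (auto simp: coords_def)
    show "h' p (dif Y d p y) = cdif L m d p (h p y)" if y: "y \<in> stalk (obj Y d) p" for y
    proof -
      have "h' p (dif Y d p y) i = a p y i" for i
      proof (cases "i \<in> pos ?ps p")
        case True
        note l = lab[OF True]
        have "h' p (dif Y d p y) i = f i (?ps ! i) (dif Y d (?ps ! i) (res (obj Y d) p (?ps ! i) y))"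
          using True dY(4)[OF p y l(1,2)] by (simp add: h'_def)
        also have "\<dots> = a p y i"
          using fa[OF l(1) sheafD(4)[OF sY p l(1,2) y]] aD(4)[OF p y l] by simp
        finally show ?thesis .
      next
        case False
        obtain x where "x \<in> stalk (obj X d') p" using sheaf_nonempty[OF sX p] by blast
        then show ?thesis using False out(1)[OF False y] by (simp add: h'_def)
      qed
      then show ?thesis by (auto simp: a_def)
    qed
    show "(\<lambda>i. h' p (q d' p x) i - s' p (dif X d' p x) i)
      = (\<lambda>i. g d' p x i + cdif L m d p (s p x) i)" if x: "x \<in> stalk (obj X d') p" for x
    proof -
      have "h' p (q d' p x) i - s' p (dif X d' p x) i = b p x i" for i
      proof (cases "i \<in> pos ?ps p")
        case True
        note l = lab[OF True]
        have "h' p (q d' p x) i - s' p (dif X d' p x) i =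
          f i (?ps ! i) (q d' (?ps ! i) (res (obj X d') p (?ps ! i) x)) -
          e i (?ps ! i) (dif X d' (?ps ! i) (res (obj X d') p (?ps ! i) x))"
          using True qD(4)[OF p x l(1,2)] dX(4)[OF p x l(1,2)] by (simp add: h'_def s'_def)
        also have "\<dots> = b p x i"
          using fb[OF l(1) sheafD(4)[OF sX p l(1,2) x]] bD(4)[OF p x l] by simp
        finally show ?thesis .
      next
        case False
        obtain y where "y \<in> stalk (obj Y d) p" using sheaf_nonempty[OF sY p] by blast
        then show ?thesis using False out(2)[OF False _ x] by (simp add: h'_def s'_def)
      qed
      then show ?thesis by (auto simp: b_def)
    qed
  qed
qed

text \<open>Exactness of the cone of \<open>q\<close> gives the condition \<open>cons\<close> of \<open>lift_step\<close> in the next degree.\<close>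

lemma lift_consistent:
  assumes d': "d' = d + 1" and X: "bounded_complex P X" and Y: "bounded_complex P Y"
    and q: "quasi_isomorphism P X Y q"
    and A: "coord_complex P L m" and g: "coord_chain P X L m g"
    and h': "coord_map P (obj Y d') (L d') h'" and s': "coord_map P (obj X (d' + 1)) (L d') s'"
    and hd: "\<And>y. y \<in> stalk (obj Y d) p \<Longrightarrow> h' p (dif Y d p y) = cdif L m d p (h p y)"
    and hq: "\<And>x. x \<in> stalk (obj X d') p \<Longrightarrow>
      (\<lambda>i. h' p (q d' p x) i - s' p (dif X d' p x) i) = (\<lambda>i. g d' p x i + cdif L m d p (s p x) i)"
    and p: "p \<in> P" and x: "x \<in> stalk (obj X (d' + 1)) p" and y: "y \<in> stalk (obj Y d') p"
    and zero: "is_zero (dif Y d' p y + q (d' + 1) p x)" "is_zero (dif X (d' + 1) p x)"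
  shows "cdif L m d' p (h' p y) i + g (d' + 1) p x i + cdif L m d' p (s' p x) i = 0"
proof -
  note sX = complexD(1)[OF X] and sY = complexD(1)[OF Y]
  note dX = sheaf_homD[OF complexD(2)[OF X]] and dY = sheaf_homD[OF complexD(2)[OF Y]]
  have qc: "chain_map P X Y q" using q by (simp add: quasi_isomorphism_def)
  then have "sheaf_hom P (obj X d) (obj Y d) (q d)" for d by (simp add: chain_map_def)
  note qD = sheaf_homD[OF this]
  have gm: "coord_map P (obj X d) (L d) (g d)" for d using g by (simp add: coord_chain_def)
  have gd: "g (d' + 1) p (dif X d' p v) = cdif L m d' p (g d' p v)" if "v \<in> stalk (obj X d') p" for v
    using g p that by (simp add: coord_chain_def)
  have DD: "cdif L m d' p (cdif L m d p u) = (\<lambda>i. 0)" for u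
    using cdif_cdif[OF A, of d] by (simp add: d')
  obtain n where n: "stalk (obj Y (d' + 1)) p \<subseteq> carrier_vec n"
    using fd_space_dim[OF sheafD(1)[OF sY p]] by blast
  \<comment> \<open>The cocycle condition in the cone makes \<open>q\<close> of \<open>x\<close> a
    coboundary, so injectivity on cohomology yields \<open>x'\<close> with differential
    \<open>x\<close>.\<close>
  have "q (d' + 1) p x = (- 1) \<cdot>\<^sub>v dif Y d' p y"
    using n dY(1)[OF p y] qD(1)[OF p x] by (intro is_zero_add_imp[OF zero(1)]) auto
  also have "\<dots> = dif Y d' p ((- 1) \<cdot>\<^sub>v y)" using p y by (simp add: dY)
  finally have "q (d' + 1) p x \<in> coboundaries Y (d' + 1) p"
    unfolding coboundaries_Suc using sheafD(3)[OF sY p y] by blast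
  moreover have "x \<in> cocycles X (d' + 1) p" using x zero by (simp add: cocycles_def)
  ultimately have "x \<in> coboundaries X (d' + 1) p"
    using q p unfolding quasi_isomorphism_def by blast
  then obtain x' where x': "x' \<in> stalk (obj X d') p" "x = dif X d' p x'"
    unfolding coboundaries_Suc by blast
  \<comment> \<open>This corrected element is a cocycle up to the sign already absorbed in the zero
    condition; surjectivity on cohomology makes it the \<open>q\<close>-image of a cocycle
    \<open>x''\<close> plus the differential of some \<open>y'\<close>. The pair of \<open>y\<close>
    and \<open>x\<close> is thereby exhibited as a boundary in the cone.\<close>
  have w: "y + q d' p x' \<in> stalk (obj Y d') p"
    using sheafD(2)[OF sY p y] qD(1)[OF p x'(1)] by blast
  have "dif Y d' p (y + q d' p x') = dif Y d' p y + q (d' + 1) p x"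
    using qc p x' dY(2)[OF p y qD(1)[OF p x'(1)]] by (simp add: chain_map_def)
  then have "y + q d' p x' \<in> cocycles Y d' p" using w zero by (simp add: cocycles_def)
  then obtain x'' where x'': "x'' \<in> cocycles X d' p" "y + q d' p x' - q d' p x'' \<in> coboundaries Y (d + 1) p"
    using q p d' unfolding quasi_isomorphism_def by blast
  then obtain y' where y': "y' \<in> stalk (obj Y d) p" "y + q d' p x' - q d' p x'' = dif Y d p y'"
    unfolding coboundaries_Suc by blast
  have x2: "x'' \<in> stalk (obj X d') p" "is_zero (dif X d' p x'')" using x'' by (auto simp: cocycles_def)
  have zx: "dif X d' p x'' \<in> stalk (obj X (d' + 1)) p" by (rule dX(1)[OF p x2(1)])
  \<comment> \<open>Every term on the right is governed by \<open>hd\<close> or \<open>hq\<close>,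
    the two identities from the preceding step.\<close>
  have hy: "h' p y = (\<lambda>i. cdif L m d p (h p y') i - h' p (q d' p x') i + h' p (q d' p x'') i)"
  proof -
    have "cdif L m d p (h p y') = h' p (y + q d' p x' - q d' p x'')"
      using hd[OF y'(1)] y'(2) by simp
    also have "\<dots> = (\<lambda>i. h' p y i + h' p (q d' p x') i - h' p (q d' p x'') i)"
      using coord_map_minus[OF sY h' p w qD(1)[OF p x2(1)]] coord_mapD(2)[OF h' p y qD(1)[OF p x'(1)]] by simp
    finally show ?thesis by simp
  qed
  have D: "cdif L m d' p (h' p (q d' p v)) = (\<lambda>i. g (d' + 1) p (dif X d' p v) i + cdif L m d' p (s' p (dif X d' p v)) i)"
    if v: "v \<in> stalk (obj X d') p" for v
  proof -
    have "h' p (q d' p v) = (\<lambda>i. g d' p v i + cdif L m d p (s p v) i + s' p (dif X d' p v) i)"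
      using hq[OF v] by (simp add: fun_eq_iff algebra_simps)
    then show ?thesis by (simp add: cdif_linear DD gd[OF v])
  qed
  show ?thesis
    unfolding hy cdif_linear DD D[OF x'(1)] D[OF x2(1)] x'(2)[symmetric]
      coord_map_zero[OF gm p zx x2(2)] coord_map_zero[OF s' p zx x2(2)]
    by simp
qed

lemma coord_map_const_zero: "coord_map P F ps (\<lambda>p v i. 0)"
  by (simp add: coord_map_def coords_zero)

lemma coord_complex_lower_bound:
  assumes "coord_complex P L m"
  obtains b where "\<And>d. d \<le> b \<Longrightarrow> L d = []"
proof -
  have f: "finite {d. L d \<noteq> []}" by (rule coord_complexD(4)[OF assms])
  show thesis
  proof
    fix d assume d: "d \<le> Min (insert 0 {d. L d \<noteq> []}) - 1"
    show "L d = []"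
    proof (rule ccontr)
      assume "L d \<noteq> []"
      then have "Min (insert 0 {d. L d \<noteq> []}) \<le> d" using f by (intro Min_le) auto
      then show False using d by simp
    qed
  qed
qed

lemma coord_map_Nil: "coord_map P F [] h \<Longrightarrow> p \<in> P \<Longrightarrow> v \<in> stalk F p \<Longrightarrow> h p v = (\<lambda>i. 0)"
  by (drule (2) coord_mapD(1)) (auto simp: coords_def pos_def)

lemma cdif_Nil: "L (d + 1) = [] \<Longrightarrow> cdif L m d p u = (\<lambda>i. 0)"
  by (auto simp: cdif_def app_def pos_def)

text \<open>Upward recursion on the degree, starting where the target complex is still zero. Besides
  the pair of maps the recursion carries the consistency condition for the next step, which
  \<open>lift_consistent\<close> renews.\<close>

theorem lift_quasi_isomorphism:
  assumes X: "bounded_complex P X" and Y: "bounded_complex P Y"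
    and q: "quasi_isomorphism P X Y q"
    and A: "coord_complex P L m" and g: "coord_chain P X L m g"
  obtains h s where "coord_chain P Y L m h" "\<And>d. coord_map P (obj X (d + 1)) (L d) (s d)"
    "\<And>d p x. p \<in> P \<Longrightarrow> x \<in> stalk (obj X (d + 1)) p \<Longrightarrow> h (d + 1) p (q (d + 1) p x) =
      (\<lambda>i. g (d + 1) p x i + cdif L m d p (s d p x) i + s (d + 1) p (dif X (d + 1) p x) i)"
proof -
  have qc: "chain_map P X Y q" using q by (simp add: quasi_isomorphism_def)
  have gm: "coord_map P (obj X d) (L d) (g d)" for d using g by (simp add: coord_chain_def)
  note dX = sheaf_homD[OF complexD(2)[OF X]] and dY = sheaf_homD[OF complexD(2)[OF Y]]
  obtain b' where b': "\<And>d. d \<le> b' \<Longrightarrow> L d = []" using coord_complex_lower_bound[OF A] by blast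
  \<comment> \<open>One degree of slack: the condition at the start also involves \<open>g\<close>
    in degree \<open>b + 1\<close>, so \<open>L\<close> has to be empty there as well.\<close>
  define b where "b = b' - 1"
  have b: "L d = []" if "d \<le> b + 1" for d using b' that by (simp add: b_def)
  \<comment> \<open>The first component of \<open>w\<close> is the lift in degree
    \<open>b + n\<close>, the second is the homotopy from degree \<open>b + n + 1\<close> of
    \<open>X\<close> to degree \<open>b + n\<close> of the target.\<close>
  define good where "good n w \<longleftrightarrow>
    coord_map P (obj Y (b + int n)) (L (b + int n)) (fst w) \<and>
    coord_map P (obj X (b + int n + 1)) (L (b + int n)) (snd w) \<and>
    (\<forall>p x y i. p \<in> P \<longrightarrow> x \<in> stalk (obj X (b + int n + 1)) p \<longrightarrow> y \<in> stalk (obj Y (b + int n)) p \<longrightarrow>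
      is_zero (dif Y (b + int n) p y + q (b + int n + 1) p x) \<longrightarrow> is_zero (dif X (b + int n + 1) p x) \<longrightarrow>
      cdif L m (b + int n) p (fst w p y) i + g (b + int n + 1) p x i + cdif L m (b + int n) p (snd w p x) i = 0)"
    for n :: nat and w
  define step where "step n w w' \<longleftrightarrow>
    (\<forall>p y. p \<in> P \<longrightarrow> y \<in> stalk (obj Y (b + int n)) p \<longrightarrow>
      fst w' p (dif Y (b + int n) p y) = cdif L m (b + int n) p (fst w p y)) \<and>
    (\<forall>p x. p \<in> P \<longrightarrow> x \<in> stalk (obj X (b + int n + 1)) p \<longrightarrow>
      (\<lambda>i. fst w' p (q (b + int n + 1) p x) i - snd w' p (dif X (b + int n + 1) p x) i)
      = (\<lambda>i. g (b + int n + 1) p x i + cdif L m (b + int n) p (snd w p x) i))"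
    for n :: nat and w w'
  have base: "\<exists>w. good 0 w"
  proof
    have "g (b + 1) p x i = 0" if "p \<in> P" "x \<in> stalk (obj X (b + 1)) p" for p x i
      using coord_map_Nil[of P "obj X (b + 1)" "g (b + 1)"] gm[of "b + 1"] b[of "b + 1"] that by simp
    then show "good 0 ((\<lambda>p v i. 0), (\<lambda>p v i. 0))"
      by (simp add: good_def coord_map_const_zero cdif_linear)
  qed
  have "\<exists>w'. good (Suc n) w' \<and> step n w w'" if w: "good n w" for n w
  proof -
    define d where "d = b + int n"
    define e where "e = d + 1"
    note w' = w[unfolded good_def, folded d_def, folded e_def]
    obtain h' s' where hs: "coord_map P (obj Y e) (L e) h'" "coord_map P (obj X (e + 1)) (L e) s'"
      "\<And>p y. p \<in> P \<Longrightarrow> y \<in> stalk (obj Y d) p \<Longrightarrow> h' p (dif Y d p y) = cdif L m d p (fst w p y)"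
      "\<And>p x. p \<in> P \<Longrightarrow> x \<in> stalk (obj X e) p \<Longrightarrow>
      (\<lambda>i. h' p (q e p x) i - s' p (dif X e p x) i) = (\<lambda>i. g e p x i + cdif L m d p (snd w p x) i)"
      by (rule lift_step[OF e_def X Y qc A g, of "fst w" "snd w"]) (use w' in blast)+
    have "good (Suc n) (h', s')"
    proof -
      have e: "b + int (Suc n) = e" by (simp add: e_def d_def)
      show ?thesis unfolding good_def e fst_conv snd_conv
      proof (intro conjI allI impI hs(1,2))
        fix p x y i
        assume px: "p \<in> P" "x \<in> stalk (obj X (e + 1)) p" "y \<in> stalk (obj Y e) p"
          "is_zero (dif Y e p y + q (e + 1) p x)" "is_zero (dif X (e + 1) p x)"
        show "cdif L m e p (h' p y) i + g (e + 1) p x i + cdif L m e p (s' p x) i = 0"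
          by (rule lift_consistent[where h = "fst w" and s = "snd w", OF e_def X Y q A g hs(1,2) hs(3)[OF px(1)] hs(4)[OF px(1)] px])
      qed
    qed
    moreover have "step n w (h', s')"
      unfolding step_def fst_conv snd_conv d_def[symmetric] e_def[symmetric] using hs(3,4) by blast
    ultimately show ?thesis by blast
  qed
  from dependent_nat_choice[of good step, OF base this]
  obtain F where F: "\<And>n. good n (F n)" "\<And>n. step n (F n) (F (Suc n))" by blast
  \<comment> \<open>At the seam \<open>d = b - 1\<close> the value in degree \<open>b\<close> comes
    from the recursion and not from the zero branch, but \<open>L b\<close> is empty, so both sides
    of the identities vanish there too.\<close>
  define h where "h d = (if d < b then (\<lambda>p v i. 0) else fst (F (nat (d - b))))" for d
  define s where "s d = (if d < b then (\<lambda>p v i. 0) else snd (F (nat (d - b))))" for d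
  have nat_eq: "b + int (nat (d - b)) = d" if "\<not> d < b" for d using that by simp
  have h: "coord_map P (obj Y d) (L d) (h d)" for d
    using F(1)[of "nat (d - b)"] nat_eq[of d] by (auto simp: h_def coord_map_const_zero good_def)
  have s: "coord_map P (obj X (d + 1)) (L d) (s d)" for d
    using F(1)[of "nat (d - b)"] nat_eq[of d] by (auto simp: s_def coord_map_const_zero good_def)
  have *: "h (d + 1) p (dif Y d p y) = cdif L m d p (h d p y)"
    "h (d + 1) p (q (d + 1) p x) =
      (\<lambda>i. g (d + 1) p x i + cdif L m d p (s d p x) i + s (d + 1) p (dif X (d + 1) p x) i)"
    if "p \<in> P" "y \<in> stalk (obj Y d) p" "x \<in> stalk (obj X (d + 1)) p" for d p x y
  proof -
    have "h (d + 1) p (dif Y d p y) = cdif L m d p (h d p y) \<and> h (d + 1) p (q (d + 1) p x) =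
      (\<lambda>i. g (d + 1) p x i + cdif L m d p (s d p x) i + s (d + 1) p (dif X (d + 1) p x) i)"
    proof (cases "d < b")
      case True
      then have L: "L (d + 1) = []" by (intro b) simp
      have "sheaf_hom P (obj X (d + 1)) (obj Y (d + 1)) (q (d + 1))" using qc by (simp add: chain_map_def)
      note qD = sheaf_homD(1)[OF this that(1,3)]
      note Nil = coord_map_Nil[OF _ that(1)]
      show ?thesis
        using Nil[OF h[of "d + 1", unfolded L] dY(1)[OF that(1,2)]] Nil[OF h[of "d + 1", unfolded L] qD]
          Nil[OF gm[of "d + 1", unfolded L] that(3)] Nil[OF s[of "d + 1", unfolded L] dX(1)[OF that(1,3)]]
          cdif_Nil[where L = L and m = m, OF L]
        by simp
    next
      case False
      define n where "n = nat (d - b)"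
      have n: "b + int n = d" "nat (d + 1 - b) = Suc n" using False by (auto simp: n_def)
      have fs: "h d = fst (F n)" "s d = snd (F n)" "h (d + 1) = fst (F (Suc n))" "s (d + 1) = snd (F (Suc n))"
        using False n(2) by (simp_all add: h_def s_def n_def)
      have "step n (F n) (F (Suc n))" by (rule F(2))
      then have "h (d + 1) p (dif Y d p y) = cdif L m d p (h d p y)"
        "(\<lambda>i. h (d + 1) p (q (d + 1) p x) i - s (d + 1) p (dif X (d + 1) p x) i)
        = (\<lambda>i. g (d + 1) p x i + cdif L m d p (s d p x) i)"
        using that unfolding step_def n(1) fs[symmetric] by blast+
      then show ?thesis by (simp add: fun_eq_iff algebra_simps)
    qed
    then show "h (d + 1) p (dif Y d p y) = cdif L m d p (h d p y)"
      "h (d + 1) p (q (d + 1) p x) =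
      (\<lambda>i. g (d + 1) p x i + cdif L m d p (s d p x) i + s (d + 1) p (dif X (d + 1) p x) i)" by blast+
  qed
  have "coord_chain P Y L m h"
    unfolding coord_chain_def using h *(1) sheaf_nonempty[OF complexD(1)[OF X]] by blast
  then show thesis
  proof (rule that[of h s])
    fix d p x assume px: "p \<in> P" "x \<in> stalk (obj X (d + 1)) p"
    obtain y where "y \<in> stalk (obj Y d) p" using sheaf_nonempty[OF complexD(1)[OF Y] px(1)] by blast
    then show "h (d + 1) p (q (d + 1) p x) =
        (\<lambda>i. g (d + 1) p x i + cdif L m d p (s d p x) i + s (d + 1) p (dif X (d + 1) p x) i)"
      using *(2) px by blast
  qed (rule s)
qed

section \<open>Quasi-isomorphisms into complexes of injectives\<close>

text \<open>The cohomology conditions are stated in degree \<open>d + 1\<close>, the degree in which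
  \<open>cdif L m d\<close> lands; this keeps subtraction out of the degrees. Coboundaries of the
  target appear as explicit \<open>cdif\<close> values.\<close>

definition coord_qi :: "'p::order set \<Rightarrow> ('p, 'k::field) complex_of_sheaves \<Rightarrow> (int \<Rightarrow> 'p list) \<Rightarrow>
    (int \<Rightarrow> nat \<Rightarrow> nat \<Rightarrow> 'k) \<Rightarrow> (int \<Rightarrow> 'p \<Rightarrow> 'k vec \<Rightarrow> nat \<Rightarrow> 'k) \<Rightarrow> bool" where
  "coord_qi P A L m f \<longleftrightarrow> coord_chain P A L m f \<and>
     (\<forall>d. \<forall>p\<in>P. \<forall>v\<in>cocycles A (d + 1) p. \<forall>u\<in>coords (L d) p.
        f (d + 1) p v = cdif L m d p u \<longrightarrow> v \<in> coboundaries A (d + 1) p) \<and>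
     (\<forall>d. \<forall>p\<in>P. \<forall>w\<in>coords (L (d + 1)) p. cdif L m (d + 1) p w = (\<lambda>i. 0) \<longrightarrow>
        (\<exists>v\<in>cocycles A (d + 1) p. \<exists>u\<in>coords (L d) p. w = (\<lambda>i. f (d + 1) p v i + cdif L m d p u i)))"

lemma coord_qiD:
  assumes "coord_qi P A L m f"
  shows "coord_map P (obj A d) (L d) (f d)"
    and "p \<in> P \<Longrightarrow> v \<in> stalk (obj A d) p \<Longrightarrow> f (d + 1) p (dif A d p v) = cdif L m d p (f d p v)"
    and "p \<in> P \<Longrightarrow> v \<in> cocycles A (d + 1) p \<Longrightarrow> u \<in> coords (L d) p \<Longrightarrow>
      f (d + 1) p v = cdif L m d p u \<Longrightarrow> v \<in> coboundaries A (d + 1) p"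
    and "p \<in> P \<Longrightarrow> w \<in> coords (L (d + 1)) p \<Longrightarrow> cdif L m (d + 1) p w = (\<lambda>i. 0) \<Longrightarrow>
      \<exists>v\<in>cocycles A (d + 1) p. \<exists>u\<in>coords (L d) p. w = (\<lambda>i. f (d + 1) p v i + cdif L m d p u i)"
  subgoal using assms by (simp add: coord_qi_def coord_chain_def)
  subgoal using assms by (simp add: coord_qi_def coord_chain_def)
  subgoal using assms unfolding coord_qi_def by blast
  subgoal using assms by (simp add: coord_qi_def)
  done

lemma cdif_mem: "cdif L m d p u \<in> coords (L (d + 1)) p"
  by (simp add: cdif_def app_mem)

lemma coords_diff: "u \<in> coords ps p \<Longrightarrow> w \<in> coords ps p \<Longrightarrow> (\<lambda>i. u i - w i) \<in> coords ps p"
  unfolding coords_def by (smt (verit, best) diff_zero mem_Collect_eq)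

lemma quasi_isomorphismD:
  assumes "quasi_isomorphism P A B q"
  shows "chain_map P A B q" "sheaf_hom P (obj A d) (obj B d) (q d)"
    and "p \<in> P \<Longrightarrow> v \<in> stalk (obj A d) p \<Longrightarrow> q (d + 1) p (dif A d p v) = dif B d p (q d p v)"
    and "p \<in> P \<Longrightarrow> v \<in> cocycles A d p \<Longrightarrow> q d p v \<in> coboundaries B d p \<Longrightarrow> v \<in> coboundaries A d p"
    and "p \<in> P \<Longrightarrow> w \<in> cocycles B d p \<Longrightarrow> \<exists>v\<in>cocycles A d p. w - q d p v \<in> coboundaries B d p"
  using assms by (simp_all add: quasi_isomorphism_def chain_map_def)

lemma cocycle_image:
  assumes "bounded_complex P A" "quasi_isomorphism P A B q" "p \<in> P" "v \<in> cocycles A d p"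
  shows "q d p v \<in> cocycles B d p"
proof -
  have v: "v \<in> stalk (obj A d) p" "is_zero (dif A d p v)" using assms(4) by (auto simp: cocycles_def)
  have "is_zero (q (d + 1) p (dif A d p v))"
    by (rule sheaf_hom_zero[OF quasi_isomorphismD(2)[OF assms(2)] assms(3) _ v(2)])
      (rule sheaf_homD(1)[OF complexD(2)[OF assms(1)] assms(3) v(1)])
  then show ?thesis
    using quasi_isomorphismD(3)[OF assms(2,3) v(1)] sheaf_homD(1)[OF quasi_isomorphismD(2)[OF assms(2)] assms(3) v(1)]
    by (simp add: cocycles_def)
qed

lemma cocyclesD:
  "v \<in> cocycles A d p \<Longrightarrow> v \<in> stalk (obj A d) p" "v \<in> cocycles A d p \<Longrightarrow> is_zero (dif A d p v)"
  by (auto simp: cocycles_def)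

lemma coord_qi_comp:
  assumes A: "bounded_complex P A" and B: "bounded_complex P B"
    and q: "quasi_isomorphism P A B q" and f: "coord_qi P B L m f"
  shows "coord_qi P A L m (\<lambda>d p v. f d p (q d p v))"
proof -
  note qD = quasi_isomorphismD[OF q] and fD = coord_qiD[OF f]
  note qh = sheaf_homD[OF qD(2)]
  show ?thesis unfolding coord_qi_def coord_chain_def
  proof (intro conjI allI ballI impI)
    fix d show "coord_map P (obj A d) (L d) (\<lambda>p v. f d p (q d p v))"
      by (rule coord_map_comp_hom[OF qD(2) fD(1)])
  next
    fix d p v assume "p \<in> P" "v \<in> stalk (obj A d) p"
    then show "f (d + 1) p (q (d + 1) p (dif A d p v)) = cdif L m d p (f d p (q d p v))"
      by (simp add: qD(3) fD(2) qh)
  next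
    fix d p v u assume "p \<in> P" "v \<in> cocycles A (d + 1) p" "u \<in> coords (L d) p"
      "f (d + 1) p (q (d + 1) p v) = cdif L m d p u"
    then show "v \<in> coboundaries A (d + 1) p"
      using fD(3) qD(4) cocycle_image[OF A q] by blast
  next
    fix d p w assume p: "p \<in> P" and w: "w \<in> coords (L (d + 1)) p" "cdif L m (d + 1) p w = (\<lambda>i. 0)"
    obtain v u where v: "v \<in> cocycles B (d + 1) p" and u: "u \<in> coords (L d) p"
      and wv: "w = (\<lambda>i. f (d + 1) p v i + cdif L m d p u i)" using fD(4)[OF p w] by blast
    obtain v' where v': "v' \<in> cocycles A (d + 1) p" "v - q (d + 1) p v' \<in> coboundaries B (d + 1) p"
      using qD(5)[OF p v] by blast
    obtain b where b: "b \<in> stalk (obj B d) p" "v - q (d + 1) p v' = dif B d p b"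
      using v'(2) unfolding coboundaries_Suc by blast
    have "cdif L m d p (f d p b) = (\<lambda>i. f (d + 1) p v i - f (d + 1) p (q (d + 1) p v') i)"
      unfolding fD(2)[OF p b(1), symmetric] b(2)[symmetric]
      by (rule coord_map_minus[OF complexD(1)[OF B] fD(1) p cocyclesD(1)[OF v] qh(1)[OF p cocyclesD(1)[OF v'(1)]]])
    then have "w = (\<lambda>i. f (d + 1) p (q (d + 1) p v') i + cdif L m d p (\<lambda>i. f d p b i + u i) i)"
      by (simp add: wv cdif_linear fun_eq_iff)
    moreover have "(\<lambda>i. f d p b i + u i) \<in> coords (L d) p"
      by (rule coords_add[OF coord_mapD(1)[OF fD(1) p b(1)] u])
    ultimately show "\<exists>v\<in>cocycles A (d + 1) p. \<exists>u\<in>coords (L d) p.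
        w = (\<lambda>i. f (d + 1) p (q (d + 1) p v) i + cdif L m d p u i)"
      using v'(1) by blast
  qed
qed

text \<open>On cocycles the last homotopy term vanishes and the other one is a coboundary, so
  \<open>h\<close> after \<open>q\<close> agrees with \<open>f\<close> on cohomology. As
  \<open>q\<close> and \<open>f\<close> are isomorphisms there, so is \<open>h\<close>.\<close>

lemma coord_qi_lift:
  assumes A: "bounded_complex P A" and B: "bounded_complex P B"
    and q: "quasi_isomorphism P A B q" and M: "coord_complex P L m" and f: "coord_qi P A L m f"
    and h: "coord_chain P B L m h" and s: "\<And>d. coord_map P (obj A (d + 1)) (L d) (s d)"
    and hq: "\<And>d p x. p \<in> P \<Longrightarrow> x \<in> stalk (obj A (d + 1)) p \<Longrightarrow> h (d + 1) p (q (d + 1) p x) =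
      (\<lambda>i. f (d + 1) p x i + cdif L m d p (s d p x) i + s (d + 1) p (dif A (d + 1) p x) i)"
  shows "coord_qi P B L m h"
proof -
  note qD = quasi_isomorphismD[OF q] and fD = coord_qiD[OF f]
  note qh = sheaf_homD[OF qD(2)]
  note sB = complexD(1)[OF B]
  have hm: "coord_map P (obj B d) (L d) (h d)" for d using h by (simp add: coord_chain_def)
  have hd: "h (d + 1) p (dif B d p v) = cdif L m d p (h d p v)" if "p \<in> P" "v \<in> stalk (obj B d) p" for d p v
    using h that by (simp add: coord_chain_def)
  have hq': "h (d + 1) p (q (d + 1) p x) = (\<lambda>i. f (d + 1) p x i + cdif L m d p (s d p x) i)"
    if "p \<in> P" "x \<in> cocycles A (d + 1) p" for d p x
  proof -
    have "dif A (d + 1) p x \<in> stalk (obj A (d + 1 + 1)) p"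
      by (rule sheaf_homD(1)[OF complexD(2)[OF A] that(1) cocyclesD(1)[OF that(2)]])
    from coord_map_zero[OF s that(1) this cocyclesD(2)[OF that(2)]]
    show ?thesis using hq[OF that(1) cocyclesD(1)[OF that(2)]] by simp
  qed
  show ?thesis unfolding coord_qi_def
  proof (intro conjI allI ballI impI h)
    fix d p y u assume p: "p \<in> P" and y: "y \<in> cocycles B (d + 1) p" and u: "u \<in> coords (L d) p"
      and hy: "h (d + 1) p y = cdif L m d p u"
    note ys = cocyclesD(1)[OF y]
    obtain x where x: "x \<in> cocycles A (d + 1) p" "y - q (d + 1) p x \<in> coboundaries B (d + 1) p"
      using qD(5)[OF p y] by blast
    note xs = cocyclesD(1)[OF x(1)]
    obtain b where b: "b \<in> stalk (obj B d) p" "y - q (d + 1) p x = dif B d p b"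
      using x(2) unfolding coboundaries_Suc by blast
    have "cdif L m d p (h d p b) = (\<lambda>i. h (d + 1) p y i - h (d + 1) p (q (d + 1) p x) i)"
      unfolding hd[OF p b(1), symmetric] b(2)[symmetric]
      by (rule coord_map_minus[OF sB hm p ys qh(1)[OF p xs]])
    \<comment> \<open>The element \<open>x\<close> represents the class of \<open>y\<close> in
      \<open>A\<close>; its image under \<open>f\<close> is now a coboundary, so \<open>x\<close> is
      one, and \<open>y\<close> differs from the image of \<open>x\<close> by a coboundary.\<close>
    then have "f (d + 1) p x = cdif L m d p (\<lambda>i. u i - h d p b i - s d p x i)"
      by (simp add: hq'[OF p x(1)] hy cdif_linear fun_eq_iff)
    moreover have "(\<lambda>i. u i - h d p b i - s d p x i) \<in> coords (L d) p"
      by (intro coords_diff u coord_mapD(1)[OF hm p b(1)] coord_mapD(1)[OF s p xs])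
    ultimately have "x \<in> coboundaries A (d + 1) p" using fD(3)[OF p x(1)] by blast
    then obtain x' where x': "x' \<in> stalk (obj A d) p" "x = dif A d p x'"
      unfolding coboundaries_Suc by blast
    obtain n where n: "stalk (obj B (d + 1)) p \<subseteq> carrier_vec n"
      using fd_space_dim[OF sheafD(1)[OF sB p]] by blast
    have "y \<in> carrier_vec n" "q (d + 1) p x \<in> carrier_vec n"
      using n ys qh(1)[OF p xs] by blast+
    then have "y = (y - q (d + 1) p x) + q (d + 1) p x"
      by (intro eq_vecI) auto
    also have "\<dots> = dif B d p b + dif B d p (q d p x')"
      unfolding b(2) unfolding x'(2) qD(3)[OF p x'(1)] ..
    also have "\<dots> = dif B d p (b + q d p x')"
      by (rule sheaf_homD(2)[OF complexD(2)[OF B] p b(1) qh(1)[OF p x'(1)], symmetric])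
    finally show "y \<in> coboundaries B (d + 1) p"
      unfolding coboundaries_Suc using sheafD(2)[OF sB p b(1) qh(1)[OF p x'(1)]] by blast
  next
    fix d p w assume p: "p \<in> P" and w: "w \<in> coords (L (d + 1)) p" "cdif L m (d + 1) p w = (\<lambda>i. 0)"
    obtain x u where x: "x \<in> cocycles A (d + 1) p" and u: "u \<in> coords (L d) p"
      and wv: "w = (\<lambda>i. f (d + 1) p x i + cdif L m d p u i)" using fD(4)[OF p w] by blast
    have "w = (\<lambda>i. h (d + 1) p (q (d + 1) p x) i + cdif L m d p (\<lambda>i. u i - s d p x i) i)"
      by (simp add: hq'[OF p x] wv cdif_linear fun_eq_iff)
    moreover have "(\<lambda>i. u i - s d p x i) \<in> coords (L d) p"
      by (intro coords_diff u coord_mapD(1)[OF s p cocyclesD(1)[OF x]])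
    ultimately show "\<exists>v\<in>cocycles B (d + 1) p. \<exists>u\<in>coords (L d) p. w = (\<lambda>i. h (d + 1) p v i + cdif L m d p u i)"
      using cocycle_image[OF A q p x] by blast
  qed
qed

text \<open>An arrow towards the current complex is composed with the map; an arrow away from it is
  inverted up to homotopy by lifting. The target stays the same throughout.\<close>

lemma coord_qi_zigzag:
  assumes M: "coord_complex P L m" and AB: "quasi_isomorphic P A B" and A: "coord_qi P A L m f"
  shows "\<exists>g. coord_qi P B L m g"
  using AB[unfolded quasi_isomorphic_def]
proof (induction rule: equivclp_induct)
  case base
  then show ?case using A by blast
next
  case (step B C)
  then obtain g where g: "coord_qi P B L m g" by blast
  from step(2) have BC: "bounded_complex P B" "bounded_complex P C" by auto
  from step(2) consider q where "quasi_isomorphism P B C q" | q where "quasi_isomorphism P C B q" by blast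
  then show ?case
  proof cases
    case 1
    have "coord_chain P B L m g" using g by (simp add: coord_qi_def)
    from lift_quasi_isomorphism[OF BC 1 M this] obtain h s where
      "coord_chain P C L m h" "\<And>d. coord_map P (obj B (d + 1)) (L d) (s d)"
      "\<And>d p x. p \<in> P \<Longrightarrow> x \<in> stalk (obj B (d + 1)) p \<Longrightarrow> h (d + 1) p (q (d + 1) p x) =
        (\<lambda>i. g (d + 1) p x i + cdif L m d p (s d p x) i + s (d + 1) p (dif B (d + 1) p x) i)"
      by blast
    from coord_qi_lift[OF BC 1 M g this] show ?thesis by blast
  next
    case 2
    from coord_qi_comp[OF BC(2,1) 2 g] show ?thesis by blast
  qed
qed

section \<open>Coordinate complexes as complexes of sheaves\<close>

definition coord_sheaves :: "'p::order set \<Rightarrow> (int \<Rightarrow> 'p list) \<Rightarrow> (int \<Rightarrow> nat \<Rightarrow> nat \<Rightarrow> 'k::field) \<Rightarrow> ('p, 'k) complex_of_sheaves" where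
  "coord_sheaves P L m = matrix_complex P L (\<lambda>d. mat (length (L (d + 1))) (length (L d)) (\<lambda>(i, j). m d i j))"

lemma sheaf_hom_cong:
  assumes "sheaf_hom P F G \<phi>" "is_sheaf P F" "\<And>p v. p \<in> P \<Longrightarrow> v \<in> stalk F p \<Longrightarrow> \<phi> p v = \<psi> p v"
  shows "sheaf_hom P F G \<psi>"
  using assms(1) unfolding sheaf_hom_def linear_on_def Pi_iff
  by (auto simp: assms(3)[symmetric] sheafD[OF assms(2)])

lemma stalk_coord_sheaves:
  "coord_complex P L m \<Longrightarrow> stalk (obj (coord_sheaves P L m) d) p = carrier_vec (card (pos (L d) p))"
  by (simp add: coord_sheaves_def matrix_complex_def stalk_inj_sum[OF coord_complexD(1)])

lemma dif_coord_sheaves: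
  assumes M: "coord_complex P L m" and v: "v \<in> stalk (obj (coord_sheaves P L m) d) p"
  shows "dif (coord_sheaves P L m) d p v \<in> stalk (obj (coord_sheaves P L m) (d + 1)) p"
    and "to_coords (L (d + 1)) p (dif (coord_sheaves P L m) d p v) = cdif L m d p (to_coords (L d) p v)"
proof -
  note D = coord_complexD[OF M]
  note * = matrix_map_coords[OF labeled_matrix_mat[OF D(2,1,1), of d]]
  show "dif (coord_sheaves P L m) d p v \<in> stalk (obj (coord_sheaves P L m) (d + 1)) p"
    using *(1) v by (simp add: coord_sheaves_def matrix_complex_def)
  show "to_coords (L (d + 1)) p (dif (coord_sheaves P L m) d p v) = cdif L m d p (to_coords (L d) p v)"
    using *(2) v by (simp add: coord_sheaves_def matrix_complex_def entries_mat[OF D(2)] cdif_def)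
qed

lemma obj_coord_sheaves: "obj (coord_sheaves P L m) d = inj_sum P (L d)"
  by (simp add: coord_sheaves_def matrix_complex_def)

lemma bounded_coord_sheaves:
  fixes m :: "int \<Rightarrow> nat \<Rightarrow> nat \<Rightarrow> 'k::field"
  assumes M: "coord_complex P L m"
  shows "bounded_complex P (coord_sheaves P L m)"
  unfolding bounded_complex_def
proof (intro conjI allI ballI)
  note D = coord_complexD[OF M]
  note st = stalk_coord_sheaves[OF M] and dif = dif_coord_sheaves[OF M]
  fix d
  show sh: "is_sheaf P (obj (coord_sheaves P L m) d)"
    unfolding obj_coord_sheaves by (rule is_sheaf_inj_sum[OF D(1)])
  have "coord_map P (inj_sum P (L d)) (L (d + 1)) (\<lambda>p v. cdif L m d p (to_coords (L d) p v))"
    by (intro coord_map_cdif M coord_map_id D)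
  from hom_of_coord_map[OF is_sheaf_inj_sum[OF D(1)] this D(1)]
  show "sheaf_hom P (obj (coord_sheaves P L m) d) (obj (coord_sheaves P L m) (d + 1)) (dif (coord_sheaves P L m) d)"
    unfolding obj_coord_sheaves
  proof (rule sheaf_hom_cong)
    fix p and v :: "'k vec" assume v: "v \<in> stalk (inj_sum P (L d)) p"
    then have v: "v \<in> stalk (obj (coord_sheaves P L m) d) p" by (simp add: obj_coord_sheaves)
    show "of_coords (L (d + 1)) p (cdif L m d p (to_coords (L d) p v)) = dif (coord_sheaves P L m) d p v"
      using dif[OF v] by (metis of_to_coords st)
  qed (rule is_sheaf_inj_sum[OF D(1)])
  fix p v assume v: "p \<in> P" "v \<in> stalk (obj (coord_sheaves P L m) d) p"
  note w = dif(1)[OF v(2)]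
  show "is_zero (dif (coord_sheaves P L m) (d + 1) p (dif (coord_sheaves P L m) d p v))"
    unfolding is_zero_coords[OF dif(1)[OF w, unfolded st]] dif(2)[OF w] dif(2)[OF v(2)]
    by (rule cdif_cdif[OF M])
next
  have "{d. \<exists>p\<in>P. \<exists>v\<in>stalk (obj (coord_sheaves P L m) d) p. \<not> is_zero v} \<subseteq> {d. L d \<noteq> []}"
    by (auto simp: stalk_coord_sheaves[OF M] pos_def is_zero_iff)
  then show "finite {d. \<exists>p\<in>P. \<exists>v\<in>stalk (obj (coord_sheaves P L m) d) p. \<not> is_zero v}"
    using coord_complexD(4)[OF M] by (rule finite_subset)
qed

lemma coord_qi_id:
  assumes M: "coord_complex P L m"
  shows "coord_qi P (coord_sheaves P L m) L m (\<lambda>d. to_coords (L d))"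
proof -
  note st = stalk_coord_sheaves[OF M] and dif = dif_coord_sheaves[OF M]
  show ?thesis unfolding coord_qi_def coord_chain_def
  proof (intro conjI allI ballI impI)
    fix d show "coord_map P (obj (coord_sheaves P L m) d) (L d) (to_coords (L d))"
      unfolding obj_coord_sheaves by (intro coord_map_id coord_complexD[OF M])
  next
    fix d p v assume "v \<in> stalk (obj (coord_sheaves P L m) d) p"
    then show "to_coords (L (d + 1)) p (dif (coord_sheaves P L m) d p v) = cdif L m d p (to_coords (L d) p v)"
      by (rule dif(2))
  next
    fix d p v u assume v: "v \<in> cocycles (coord_sheaves P L m) (d + 1) p" and u: "u \<in> coords (L d) p"
      and eq: "to_coords (L (d + 1)) p v = cdif L m d p u"
    have b: "of_coords (L d) p u \<in> stalk (obj (coord_sheaves P L m) d) p" by (simp add: st of_coords_carrier)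
    have "dif (coord_sheaves P L m) d p (of_coords (L d) p u) = v"
      using dif[OF b] cocyclesD(1)[OF v]
      by (intro to_coords_inject[of _ "L (d + 1)" p]) (simp_all add: st eq to_of_coords[OF u])
    then show "v \<in> coboundaries (coord_sheaves P L m) (d + 1) p"
      unfolding coboundaries_Suc using b by blast
  next
    fix d p w assume w: "w \<in> coords (L (d + 1)) p" "cdif L m (d + 1) p w = (\<lambda>i. 0)"
    let ?v = "of_coords (L (d + 1)) p w"
    have b: "?v \<in> stalk (obj (coord_sheaves P L m) (d + 1)) p" by (simp add: st of_coords_carrier)
    have "is_zero (dif (coord_sheaves P L m) (d + 1) p ?v)"
      unfolding is_zero_coords[OF dif(1)[OF b, unfolded st]] dif(2)[OF b] to_of_coords[OF w(1)] by (rule w(2))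
    then have "?v \<in> cocycles (coord_sheaves P L m) (d + 1) p"
      using b by (simp add: cocycles_def)
    moreover have "w = (\<lambda>i. to_coords (L (d + 1)) p ?v i + cdif L m d p (\<lambda>i. 0) i)"
      by (simp add: to_of_coords w cdif_linear)
    ultimately show "\<exists>v\<in>cocycles (coord_sheaves P L m) (d + 1) p. \<exists>u\<in>coords (L d) p.
        w = (\<lambda>i. to_coords (L (d + 1)) p v i + cdif L m d p u i)"
      using coords_zero by blast
  qed
qed

lemma chain_map_of_coord_chain:
  assumes A: "bounded_complex P A" and M: "coord_complex P L m" and f: "coord_chain P A L m f"
  shows "chain_map P A (coord_sheaves P L m) (\<lambda>d p v. of_coords (L d) p (f d p v))"
  unfolding chain_map_def
proof (intro conjI allI ballI)
  let ?q = "\<lambda>d p v. of_coords (L d) p (f d p v)" and ?M = "coord_sheaves P L m"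
  note st = stalk_coord_sheaves[OF M] and dif = dif_coord_sheaves[OF M]
  have fm: "coord_map P (obj A d) (L d) (f d)" for d using f by (simp add: coord_chain_def)
  show "sheaf_hom P (obj A d) (obj ?M d) (?q d)" for d
    unfolding obj_coord_sheaves by (rule hom_of_coord_map[OF complexD(1)[OF A] fm coord_complexD(1)[OF M]])
  fix d p v assume s: "p \<in> P" "v \<in> stalk (obj A d) p"
  have mem: "?q d p v \<in> stalk (obj ?M d) p" by (simp add: st of_coords_carrier)
  have "f (d + 1) p (dif A d p v) = cdif L m d p (f d p v)" using f s by (simp add: coord_chain_def)
  then show "?q (d + 1) p (dif A d p v) = dif ?M d p (?q d p v)"
    using dif[OF mem] to_of_coords[OF coord_mapD(1)[OF fm s]]
    by (intro to_coords_inject[of _ "L (d + 1)" p]) (simp_all add: st of_coords_carrier to_of_coords[OF cdif_mem])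
qed

lemma quasi_isomorphism_of_coord_qi:
  assumes A: "bounded_complex P A" and M: "coord_complex P L m" and f: "coord_qi P A L m f"
  shows "quasi_isomorphism P A (coord_sheaves P L m) (\<lambda>d p v. of_coords (L d) p (f d p v))"
proof -
  note st = stalk_coord_sheaves[OF M] and dif = dif_coord_sheaves[OF M] and fD = coord_qiD[OF f]
  let ?q = "\<lambda>d p v. of_coords (L d) p (f d p v)" and ?M = "coord_sheaves P L m"
  have mem: "?q d p v \<in> stalk (obj ?M d) p" for d p v by (simp add: st of_coords_carrier)
  have crd: "to_coords (L d) p (?q d p v) = f d p v" if "p \<in> P" "v \<in> stalk (obj A d) p" for d p v
    by (rule to_of_coords[OF coord_mapD(1)[OF fD(1) that]])
  have inj: "v = w" if "v \<in> stalk (obj ?M d) p" "w \<in> stalk (obj ?M d) p"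
    "to_coords (L d) p v = to_coords (L d) p w" for d p v w
    using that by (intro to_coords_inject[of v "L d" p w]) (simp_all add: st)
  have "chain_map P A ?M ?q"
    using chain_map_of_coord_chain[OF A M] f by (simp add: coord_qi_def)
  then show ?thesis unfolding quasi_isomorphism_def
  proof (intro conjI allI ballI impI)
    fix d p v assume s: "p \<in> P" "v \<in> cocycles A d p" "?q d p v \<in> coboundaries ?M d p"
    define e where "e = d - 1"
    have d: "d = e + 1" by (simp add: e_def)
    obtain b where b: "b \<in> stalk (obj ?M e) p" "?q (e + 1) p v = dif ?M e p b"
      using s(3) unfolding d coboundaries_Suc by blast
    have "f (e + 1) p v = cdif L m e p (to_coords (L e) p b)"
      using crd[of p v "e + 1"] cocyclesD(1)[OF s(2)] s(1) dif(2)[OF b(1)] by (simp add: d b(2)[symmetric])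
    then show "v \<in> coboundaries A d p"
      using fD(3)[OF s(1) s(2)[unfolded d] to_coords_mem] by (simp add: d)
  next
    fix d p w assume s: "p \<in> P" "w \<in> cocycles ?M d p"
    define e where "e = d - 1"
    have d: "d = e + 1" by (simp add: e_def)
    note w = cocyclesD[OF s(2), unfolded d]
    have "cdif L m (e + 1) p (to_coords (L (e + 1)) p w) = (\<lambda>i. 0)"
      using w(2) unfolding is_zero_coords[OF dif(1)[OF w(1), unfolded st]] dif(2)[OF w(1)] .
    from fD(4)[OF s(1) to_coords_mem this] obtain v u where
      v: "v \<in> cocycles A (e + 1) p" and u: "u \<in> coords (L e) p" and
      eq: "to_coords (L (e + 1)) p w = (\<lambda>i. f (e + 1) p v i + cdif L m e p u i)" by blast
    let ?b = "of_coords (L e) p u"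
    have b: "?b \<in> stalk (obj ?M e) p" by (simp add: st of_coords_carrier)
    have "to_coords (L (e + 1)) p (w - ?q (e + 1) p v) = (\<lambda>i. to_coords (L (e + 1)) p w i - f (e + 1) p v i)"
      using coord_map_minus[OF is_sheaf_inj_sum coord_map_id, of "L (e + 1)" P p w "?q (e + 1) p v"]
        coord_complexD(1)[OF M] s(1) w(1) mem[of "e + 1" p v] crd[OF s(1) cocyclesD(1)[OF v]]
      by (simp add: obj_coord_sheaves)
    then have "w - ?q (e + 1) p v = dif ?M e p ?b"
      using w(1) mem[of "e + 1" p v]
      by (intro inj[OF _ dif(1)[OF b]]) (simp_all add: st eq dif(2)[OF b] to_of_coords[OF u])
    then show "\<exists>v\<in>cocycles A d p. w - ?q d p v \<in> coboundaries ?M d p"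
      using v b unfolding d coboundaries_Suc by blast
  qed
qed

section \<open>Radical complexes\<close>

text \<open>Together with \<open>labeled\<close> this says that nonzero entries have strictly
  smaller row label than column label.\<close>

definition radical :: "(int \<Rightarrow> 'p list) \<Rightarrow> (int \<Rightarrow> nat \<Rightarrow> nat \<Rightarrow> 'k::field) \<Rightarrow> bool" where
  "radical L m \<longleftrightarrow> (\<forall>d i j. m d i j \<noteq> 0 \<longrightarrow> L (d + 1) ! i \<noteq> L d ! j)"

text \<open>After sorting the indices along a linear extension of the order this is an upper
  unitriangular matrix; the present form avoids choosing one and treats repeated labels
  evenly.\<close>

definition unipotent :: "'p::order list \<Rightarrow> (nat \<Rightarrow> nat \<Rightarrow> 'k::field) \<Rightarrow> bool" where
  "unipotent ps T \<longleftrightarrow> (\<forall>i<length ps. \<forall>j<length ps. T i j \<noteq> (if i = j then 1 else 0) \<longrightarrow> ps ! i < ps ! j)"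

lemma unipotent_apply:
  assumes T: "unipotent ps T" and i: "i < length ps"
    and u: "\<And>j. j < length ps \<Longrightarrow> ps ! i < ps ! j \<Longrightarrow> u j = 0"
  shows "(\<Sum>j<length ps. T i j * u j) = u i"
proof -
  have "(\<Sum>j<length ps. T i j * u j) = (\<Sum>j<length ps. if j = i then u j else 0)"
  proof (rule sum.cong)
    fix j assume "j \<in> {..<length ps}"
    then have j: "j < length ps" by simp
    show "T i j * u j = (if j = i then u j else 0)"
    proof (cases "ps ! i < ps ! j")
      case True
      then show ?thesis using u[OF j] by auto
    next
      case False
      then have "T i j = (if i = j then 1 else 0)" using T i j unfolding unipotent_def by blast
      then show ?thesis by simp
    qed
  qed simp
  then show ?thesis using i by simp
qed

text \<open>At an index of the support of \<open>u\<close> with maximal label, \<open>T\<close>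
  reproduces the value of \<open>u\<close>. The set \<open>I\<close> is there because
  \<open>app\<close> at a point supplies only the equations with indices in
  \<open>pos ps p\<close>.\<close>

lemma unipotent_inj:
  assumes T: "unipotent ps T" and I: "I \<subseteq> {..<length ps}" and u: "\<And>i. i \<notin> I \<Longrightarrow> u i = 0"
    and zero: "\<And>i. i \<in> I \<Longrightarrow> (\<Sum>j<length ps. T i j * u j) = 0"
  shows "u i = 0"
proof (rule ccontr)
  assume "u i \<noteq> 0"
  define S where "S = {ps ! i |i. i \<in> I \<and> u i \<noteq> 0}"
  have "finite I" using I finite_subset by blast
  then have "finite S" by (simp add: S_def)
  moreover have "S \<noteq> {}" using \<open>u i \<noteq> 0\<close> u by (auto simp: S_def)
  ultimately obtain \<pi> where \<pi>: "\<pi> \<in> S" "\<And>\<tau>. \<tau> \<in> S \<Longrightarrow> \<pi> \<le> \<tau> \<Longrightarrow> \<pi> = \<tau>"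
    using finite_has_maximal by metis
  then obtain k where k: "k \<in> I" "u k \<noteq> 0" "\<pi> = ps ! k" by (auto simp: S_def)
  have "(\<Sum>j<length ps. T k j * u j) = u k"
  proof (rule unipotent_apply[OF T])
    show "k < length ps" using k I by auto
    fix j assume "ps ! k < ps ! j"
    then have "ps ! j \<notin> S" using \<pi>(2)[of "ps ! j"] k(3) by (metis less_le)
    then show "u j = 0" using u by (force simp: S_def)
  qed
  then show False using zero[OF k(1)] k(2) by simp
qed

text \<open>Solve by successive correction: \<open>w\<close> itself is a first approximation, and
  the error lies at labels strictly below the support of \<open>w\<close>. The induction counts the
  indices, among those present at \<open>p\<close>, at or below that support.\<close>

lemma unipotent_surj:
  assumes T: "unipotent ps T"
  shows "w \<in> coords ps p \<Longrightarrow> \<exists>u\<in>coords ps p. app ps p T (length ps) u = w"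
proof (induction "card {i \<in> pos ps p. \<exists>j. w j \<noteq> 0 \<and> ps ! i \<le> ps ! j}" arbitrary: w rule: less_induct)
  case less
  show ?case
  proof (cases "w = (\<lambda>i. 0)")
    case True
    then show ?thesis by (intro bexI[of _ "\<lambda>i. 0"]) (simp_all add: coords_zero app_zero)
  next
    case False
    let ?D = "\<lambda>w. {i \<in> pos ps p. \<exists>j. w j \<noteq> 0 \<and> ps ! i \<le> ps ! j}"
    define w' where "w' = (\<lambda>i. w i - app ps p T (length ps) w i)"
    have w': "w' \<in> coords ps p"
      unfolding w'_def by (intro coords_diff less.prems app_mem)
    have lt: "\<exists>j. w j \<noteq> 0 \<and> ps ! i < ps ! j" if "w' i \<noteq> 0" for i
    proof (rule ccontr)
      assume no: "\<not> ?thesis"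
      have i: "i \<in> pos ps p" using that w' by (auto simp: coords_def)
      then have "app ps p T (length ps) w i = w i"
        using no unipotent_apply[OF T, of i w] by (auto simp: app_def pos_def)
      then show False using that by (simp add: w'_def)
    qed
    have "finite {ps ! i |i. i \<in> pos ps p \<and> w i \<noteq> 0}" by simp
    moreover have "{ps ! i |i. i \<in> pos ps p \<and> w i \<noteq> 0} \<noteq> {}"
      using False less.prems by (auto simp: coords_def fun_eq_iff)
    ultimately obtain k where k: "k \<in> pos ps p" "w k \<noteq> 0"
      and max: "\<And>j. j \<in> pos ps p \<Longrightarrow> w j \<noteq> 0 \<Longrightarrow> ps ! k \<le> ps ! j \<Longrightarrow> ps ! k = ps ! j"
      using finite_has_maximal[of "{ps ! i |i. i \<in> pos ps p \<and> w i \<noteq> 0}"] by auto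
    \<comment> \<open>A maximal label of the support of \<open>w\<close> is not below the support of
      the error, so the count drops.\<close>
    have "k \<notin> ?D w'"
    proof
      assume "k \<in> ?D w'"
      then obtain i where "w' i \<noteq> 0" "ps ! k \<le> ps ! i" by auto
      then obtain j where j: "w j \<noteq> 0" "ps ! k < ps ! j" using lt by (meson order_le_less_trans)
      moreover have "j \<in> pos ps p" using j less.prems by (auto simp: coords_def)
      ultimately show False using max[of j] by (simp add: less_le)
    qed
    moreover have "k \<in> ?D w" using k by auto
    moreover have "?D w' \<subseteq> ?D w" using lt by (force intro: order_trans less_imp_le)
    ultimately have "card (?D w') < card (?D w)" by (intro psubset_card_mono) auto
    from less.hyps[OF this w'] obtain u where u: "u \<in> coords ps p" "app ps p T (length ps) u = w'" by blast
    have "app ps p T (length ps) (\<lambda>i. w i + u i) = w"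
      by (simp add: app_add u(2)) (simp add: w'_def)
    then show ?thesis using coords_add[OF less.prems u(1)] by blast
  qed
qed

text \<open>Fewer equations than unknowns: with trivial kernel the \<open>n\<close> columns would be
  distinct and independent in the span of \<open>m\<close> unit vectors.\<close>

lemma nontrivial_kernel:
  fixes A :: "nat \<Rightarrow> nat \<Rightarrow> 'k::field"
  assumes "m < n"
  shows "\<exists>u. (\<forall>j\<ge>n. u j = 0) \<and> (\<exists>j. u j \<noteq> 0) \<and> (\<forall>i<m. (\<Sum>j<n. A i j * u j) = 0)"
proof (rule ccontr)
  assume no: "\<not> ?thesis"
  have inj: "u j = 0" if "\<And>j. j \<ge> n \<Longrightarrow> u j = 0" "\<And>i. i < m \<Longrightarrow> (\<Sum>j<n. A i j * u j) = 0" for u j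
    using that no by blast
  interpret V: vector_space "\<lambda>a (v :: nat \<Rightarrow> 'k) i. a * v i"
    by unfold_locales (auto simp: algebra_simps)
  define a where "a j = (\<lambda>i. if i < m then A i j else 0)" for j
  have sum_fun: "(\<Sum>x\<in>X. f x) i = (\<Sum>x\<in>X. f x i)" for f :: "'c \<Rightarrow> nat \<Rightarrow> 'k" and X i
    by (induction X rule: infinite_finite_induct) auto
  \<comment> \<open>Independence speaks of sets, so repeated columns are excluded first; two equal
    columns give the kernel vector \<open>unit j - unit k\<close>.\<close>
  have inj_a: "inj_on a {..<n}"
  proof (rule inj_onI, rule ccontr)
    fix j k assume jk: "j \<in> {..<n}" "k \<in> {..<n}" "a j = a k" "j \<noteq> k"
    define u :: "nat \<Rightarrow> 'k" where "u = (\<lambda>i. unit j i - unit k i)"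
    have "A i j = A i k" if "i < m" for i using fun_cong[OF jk(3), of i] that by (simp add: a_def)
    moreover have su: "(\<Sum>l<n. A i l * unit j l) = A i j" if "j < n" for i j
      using that by (simp add: unit_def if_distrib cong: if_cong)
    ultimately have "(\<Sum>l<n. A i l * u l) = 0" if "i < m" for i
      using jk that by (simp add: u_def right_diff_distrib sum_subtractf)
    moreover have "u l = 0" if "l \<ge> n" for l using jk that by (simp add: u_def unit_def)
    ultimately have "u j = 0" using inj by blast
    then show False using jk(4) by (simp add: u_def unit_def)
  qed
  have "V.independent (a ` {..<n})"
  proof
    assume "V.dependent (a ` {..<n})"
    then obtain c where c: "\<exists>v\<in>a ` {..<n}. c v \<noteq> 0" "(\<Sum>v\<in>a ` {..<n}. (\<lambda>i. c v * v i)) = 0"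
      using V.dependent_finite[of "a ` {..<n}"] by auto
    define u where "u j = (if j < n then c (a j) else 0)" for j
    have "(\<Sum>j<n. A i j * u j) = 0" if "i < m" for i
    proof -
      have "(\<Sum>v\<in>a ` {..<n}. (\<lambda>i. c v * v i)) = (\<Sum>j<n. (\<lambda>i. c (a j) * a j i))"
        by (simp add: sum.reindex[OF inj_a])
      then have "(\<Sum>j<n. c (a j) * a j i) = 0" using c(2) sum_fun[of "\<lambda>j i. c (a j) * a j i" "{..<n}" i] by simp
      then show ?thesis using that by (simp add: a_def u_def mult.commute)
    qed
    moreover have "u l = 0" if "l \<ge> n" for l using that by (simp add: u_def)
    ultimately have "u j = 0" for j using inj by blast
    then have "c (a j) = 0" if "j < n" for j using that by (metis u_def)
    then show False using c(1) by auto
  qed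
  moreover have "a ` {..<n} \<subseteq> V.span (unit ` {..<m})"
  proof
    fix v assume "v \<in> a ` {..<n}"
    then obtain j where j: "v = a j" by blast
    have "a j = (\<Sum>i<m. (\<lambda>l. A i j * unit i l))"
      by (rule ext) (simp add: sum_fun a_def unit_def if_distrib cong: if_cong)
    also have "\<dots> \<in> V.span (unit ` {..<m})"
      by (intro V.span_sum V.span_scale V.span_base) simp
    finally show "v \<in> V.span (unit ` {..<m})" by (simp add: j)
  qed
  ultimately have "card (a ` {..<n}) \<le> card (unit ` {..<m} :: (nat \<Rightarrow> 'k) set)"
    using V.independent_span_bound[of "unit ` {..<m}" "a ` {..<n}"] by auto
  also have "\<dots> \<le> m" using card_image_le[of "{..<m}" unit] by simp
  finally show False using assms card_image[OF inj_a] by simp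
qed

text \<open>\<open>f\<close> goes from the radical complex to the other one. Lifting the identity of
  the radical complex along \<open>f\<close> gives \<open>h\<close> with \<open>h f\<close>
  homotopic to the identity; in matrices, \<open>B A\<close> is the identity plus two products of
  the homotopy \<open>S\<close> with the differential \<open>n\<close>.\<close>

lemma radical_compare:
  fixes n :: "int \<Rightarrow> nat \<Rightarrow> nat \<Rightarrow> 'k::field"
  assumes M: "coord_complex P L m" and N: "coord_complex P K n" and rad: "radical K n"
    and f: "coord_qi P (coord_sheaves P K n) L m f"
  obtains A B h where "\<And>d. labeled (L d) (K d) (A d)" "\<And>d. labeled (K d) (L d) (B d)"
    "\<And>d. unipotent (K d) (mmult (length (L d)) (B d) (A d))"
    "coord_qi P (coord_sheaves P L m) K n h"
    "\<And>d p v. p \<in> P \<Longrightarrow> v \<in> stalk (inj_sum P (L d)) p \<Longrightarrow>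
      h d p v = app (K d) p (B d) (length (L d)) (to_coords (L d) p v)"
    "\<And>d p v. p \<in> P \<Longrightarrow> v \<in> stalk (inj_sum P (K d)) p \<Longrightarrow>
      f d p v = app (L d) p (A d) (length (K d)) (to_coords (K d) p v)"
proof -
  let ?M = "coord_sheaves P L m" and ?N = "coord_sheaves P K n"
  note MD = coord_complexD[OF M] and ND = coord_complexD[OF N]
  note bM = bounded_coord_sheaves[OF M] and bN = bounded_coord_sheaves[OF N]
  have q: "quasi_isomorphism P ?N ?M (\<lambda>d p v. of_coords (L d) p (f d p v))"
    by (rule quasi_isomorphism_of_coord_qi[OF bN M f])
  note idN = coord_qi_id[OF N]
  have "coord_chain P ?N K n (\<lambda>d. to_coords (K d))" using idN by (simp add: coord_qi_def)
  from lift_quasi_isomorphism[OF bN bM q N this] obtain h s where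
    h: "coord_chain P ?M K n h" and s: "\<And>d. coord_map P (obj ?N (d + 1)) (K d) (s d)" and
    hq: "\<And>d p x. p \<in> P \<Longrightarrow> x \<in> stalk (obj ?N (d + 1)) p \<Longrightarrow> h (d + 1) p (of_coords (L (d + 1)) p (f (d + 1) p x)) =
      (\<lambda>i. to_coords (K (d + 1)) p x i + cdif K n d p (s d p x) i + s (d + 1) p (dif ?N (d + 1) p x) i)"
    by blast
  have hqi: "coord_qi P ?M K n h" by (rule coord_qi_lift[OF bN bM q N idN h s hq])
  obtain A where A: "\<And>d. labeled (L d) (K d) (A d)"
    "\<And>d p v. p \<in> P \<Longrightarrow> v \<in> stalk (inj_sum P (K d)) p \<Longrightarrow>
      f d p v = app (L d) p (A d) (length (K d)) (to_coords (K d) p v)"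
    by (rule coord_map_matrices[OF coord_qiD(1)[OF f, unfolded obj_coord_sheaves] ND(1) MD(1)]) (rule that)
  obtain B where B: "\<And>d. labeled (K d) (L d) (B d)"
    "\<And>d p v. p \<in> P \<Longrightarrow> v \<in> stalk (inj_sum P (L d)) p \<Longrightarrow>
      h d p v = app (K d) p (B d) (length (L d)) (to_coords (L d) p v)"
    by (rule coord_map_matrices[OF coord_qiD(1)[OF hqi, unfolded obj_coord_sheaves] MD(1) ND(1)]) (rule that)
  obtain S where S: "\<And>d. labeled (K d) (K (d + 1)) (S d)"
    "\<And>d p v. p \<in> P \<Longrightarrow> v \<in> stalk (inj_sum P (K (d + 1))) p \<Longrightarrow>
      s d p v = app (K d) p (S d) (length (K (d + 1))) (to_coords (K (d + 1)) p v)"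
    by (rule coord_map_matrices[where ps = "\<lambda>d. K (d + 1)" and qs = K, OF s[unfolded obj_coord_sheaves] ND(1) ND(1)]) (rule that)
  have "unipotent (K d) (mmult (length (L d)) (B d) (A d))" for d
    unfolding unipotent_def
  proof (intro allI impI)
    fix i j assume i: "i < length (K d)" and j: "j < length (K d)"
      and ne: "mmult (length (L d)) (B d) (A d) i j \<noteq> (if i = j then 1 else 0)"
    have le: "K d ! i \<le> K d ! j"
      using ne labeled_mmult[OF B(1) A(1), of d "length (L d)"] by (auto simp: labeled_def split: if_splits)
    have "K d ! i \<noteq> K d ! j"
    proof
      assume eq: "K d ! i = K d ! j"
      define e where "e = d - 1"
      have d: "d = e + 1" by (simp add: e_def)
      \<comment> \<open>Evaluating the homotopy identity at the row label on the unit vector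
        \<open>j\<close> isolates the entry \<open>(i, j)\<close>; with equal labels the summand
        \<open>j\<close> is present at this point.\<close>
      define p where "p = K d ! i"
      have p: "p \<in> P" "i \<in> pos (K d) p" "j \<in> pos (K d) p"
        using i j ND(1)[of d] eq by (auto simp: p_def pos_def)
      define x :: "'k vec" where "x = of_coords (K d) p (unit j)"
      have x: "x \<in> stalk (obj ?N (e + 1)) p" "x \<in> stalk (inj_sum P (K (e + 1))) p"
        by (simp_all add: x_def d stalk_coord_sheaves[OF N] stalk_inj_sum[OF ND(1)] of_coords_carrier)
      have tx: "to_coords (K (e + 1)) p x = unit j"
        using p(3) by (simp add: x_def d to_of_coords unit_mem)
      have dx: "dif ?N d p x \<in> stalk (inj_sum P (K (d + 1))) p"
        "to_coords (K (d + 1)) p (dif ?N d p x) = cdif K n d p (unit j)"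
        using dif_coord_sheaves[OF N x(1)[folded d]] tx by (simp_all add: obj_coord_sheaves d)
      have fx: "f (e + 1) p x = app (L d) p (A d) (length (K d)) (unit j)"
        using A(2)[OF p(1) x(2)] tx by (simp add: d)
      have "of_coords (L (e + 1)) p (f (e + 1) p x) \<in> stalk (inj_sum P (L (e + 1))) p"
        by (simp add: stalk_inj_sum[OF MD(1)] of_coords_carrier)
      from B(2)[OF p(1) this]
      have "h (e + 1) p (of_coords (L (e + 1)) p (f (e + 1) p x)) = app (K d) p (B d) (length (L d)) (app (L d) p (A d) (length (K d)) (unit j))"
        by (simp add: fx[folded d] to_of_coords app_mem flip: d)
      then have "app (K d) p (mmult (length (L d)) (B d) (A d)) (length (K d)) (unit j) i
        = unit j i + cdif K n e p (s e p x) i + s d p (dif ?N d p x) i"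
        using fun_cong[OF hq[OF p(1) x(1)], of i] by (simp add: tx[folded d] app_mmult[OF B(1)] flip: d)
      then have eq2: "mmult (length (L d)) (B d) (A d) i j = unit j i + cdif K n e p (s e p x) i + s d p (dif ?N d p x) i"
        using p j by (simp add: app_unit)
      have "cdif K n e p (s e p x) i = mmult (length (K e)) (n e) (S e) i j"
      proof -
        have "cdif K n e p (s e p x) = app (K d) p (mmult (length (K e)) (n e) (S e)) (length (K d)) (unit j)"
          unfolding cdif_def S(2)[OF p(1) x(2)] tx app_mmult[OF ND(2)] d ..
        then show ?thesis using p j by (simp add: app_unit)
      qed
      \<comment> \<open>The label of \<open>k\<close> lies between two equal labels, hence equals
        them, and the entry of \<open>n\<close> contradicts radicality. The second product below
        vanishes in the same way.\<close>
      also have "\<dots> = 0" unfolding mmult_def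
      proof (rule sum.neutral, rule ballI, rule ccontr)
        fix k assume "n e i k * S e k j \<noteq> 0"
        then have "n e i k \<noteq> 0" "S e k j \<noteq> 0" by auto
        then have "K d ! i \<le> K e ! k" "K e ! k \<le> K d ! j" "K d ! i \<noteq> K e ! k"
          using ND(2)[of e] S(1)[of e] rad d by (auto simp: labeled_def radical_def)
        then show False using eq by simp
      qed
      finally have z1: "cdif K n e p (s e p x) i = 0" .
      have "s d p (dif ?N d p x) i = mmult (length (K (d + 1))) (S d) (n d) i j"
      proof -
        have "s d p (dif ?N d p x) = app (K d) p (mmult (length (K (d + 1))) (S d) (n d)) (length (K d)) (unit j)"
          unfolding S(2)[OF p(1) dx(1)] dx(2) cdif_def app_mmult[OF S(1)] ..
        then show ?thesis using p j by (simp add: app_unit)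
      qed
      also have "\<dots> = 0" unfolding mmult_def
      proof (rule sum.neutral, rule ballI, rule ccontr)
        fix k assume "S d i k * n d k j \<noteq> 0"
        then have "S d i k \<noteq> 0" "n d k j \<noteq> 0" by auto
        then have "K d ! i \<le> K (d + 1) ! k" "K (d + 1) ! k \<le> K d ! j" "K (d + 1) ! k \<noteq> K d ! j"
          using ND(2)[of d] S(1)[of d] rad by (auto simp: labeled_def radical_def)
        then show False using eq by simp
      qed
      finally have "s d p (dif ?N d p x) i = 0" .
      then show False using ne eq2 z1 by (simp add: unit_def)
    qed
    then show "K d ! i < K d ! j" using le by simp
  qed
  then show thesis by (rule that[OF A(1) B(1) _ hqi B(2) A(2)])
qed

text \<open>If \<open>A\<close> had more columns than rows, it would kill a nonzero vector, and so
  would \<open>B A\<close>, against \<open>unipotent_inj\<close>.\<close>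

lemma unipotent_length:
  assumes T: "unipotent ps (mmult (length qs) B A)"
  shows "length ps \<le> length qs"
proof (rule ccontr)
  assume "\<not> ?thesis"
  then have "length qs < length ps" by simp
  from nontrivial_kernel[OF this, of A] obtain u where
    u: "\<And>j. j \<ge> length ps \<Longrightarrow> u j = 0" "\<exists>j. u j \<noteq> 0"
    "\<And>i. i < length qs \<Longrightarrow> (\<Sum>j<length ps. A i j * u j) = 0" by blast
  have "u j = 0" for j
  proof (rule unipotent_inj[OF T subset_refl])
    fix i assume "i \<notin> {..<length ps}"
    then show "u i = 0" using u(1) by simp
  next
    fix i
    have "(\<Sum>j<length ps. mmult (length qs) B A i j * u j) = (\<Sum>j<length ps. \<Sum>k<length qs. B i k * (A k j * u j))"
      by (simp add: mmult_def sum_distrib_right mult.assoc)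
    also have "\<dots> = (\<Sum>k<length qs. B i k * (\<Sum>j<length ps. A k j * u j))"
      by (subst sum.swap) (simp add: sum_distrib_left)
    also have "\<dots> = 0" by (rule sum.neutral) (simp add: u(3))
    finally show "(\<Sum>j<length ps. mmult (length qs) B A i j * u j) = 0" .
  qed
  then show False using u(2) by blast
qed

lemma radical_length:
  fixes m :: "int \<Rightarrow> nat \<Rightarrow> nat \<Rightarrow> 'k::field"
  assumes M: "coord_complex P L m" and N: "coord_complex P K n" and rad: "radical K n"
    and qi: "quasi_isomorphic P (coord_sheaves P L m) (coord_sheaves P K n)"
  shows "length (K d) \<le> length (L d)"
proof -
  obtain f where f: "coord_qi P (coord_sheaves P K n) L m f"
    using coord_qi_zigzag[OF M qi coord_qi_id[OF M]] by blast
  show ?thesis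
  proof (rule radical_compare[OF M N rad f])
    fix A B :: "int \<Rightarrow> nat \<Rightarrow> nat \<Rightarrow> 'k"
    assume "\<And>d. unipotent (K d) (mmult (length (L d)) (B d) (A d))"
    then show ?thesis by (rule unipotent_length)
  qed
qed

text \<open>One and the same map \<open>h\<close> is compared twice. As a left inverse up to
  homotopy of \<open>f\<close>, it has a unipotent composite with \<open>A\<close> and is
  surjective; it also has a left inverse up to homotopy of its own, which makes it
  injective.\<close>

theorem radical_iso:
  assumes M: "coord_complex P L m" and N: "coord_complex P K n" and rad: "radical L m" "radical K n"
    and qi: "quasi_isomorphic P (coord_sheaves P L m) (coord_sheaves P K n)"
  shows "complex_iso P (coord_sheaves P L m) (coord_sheaves P K n)"
proof -
  let ?M = "coord_sheaves P L m" and ?N = "coord_sheaves P K n"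
  obtain f where f: "coord_qi P ?N L m f"
    using coord_qi_zigzag[OF M qi coord_qi_id[OF M]] by blast
  obtain A B h where A: "\<And>d. labeled (L d) (K d) (A d)" and B: "\<And>d. labeled (K d) (L d) (B d)"
    and BA: "\<And>d. unipotent (K d) (mmult (length (L d)) (B d) (A d))"
    and h: "coord_qi P ?M K n h" and hB: "\<And>d p v. p \<in> P \<Longrightarrow> v \<in> stalk (inj_sum P (L d)) p \<Longrightarrow>
      h d p v = app (K d) p (B d) (length (L d)) (to_coords (L d) p v)"
    and "\<And>d p v. p \<in> P \<Longrightarrow> v \<in> stalk (inj_sum P (K d)) p \<Longrightarrow>
      f d p v = app (L d) p (A d) (length (K d)) (to_coords (K d) p v)"
    by (rule radical_compare[OF M N rad(2) f]) (rule that)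
  \<comment> \<open>The comparison is now applied to \<open>h\<close> itself, using radicality of
    the other complex; thus \<open>A'\<close> and the earlier \<open>B\<close> both represent
    \<open>h\<close>.\<close>
  obtain A' B' h' where "\<And>d. labeled (K d) (L d) (A' d)" and B': "\<And>d. labeled (L d) (K d) (B' d)"
    and BA': "\<And>d. unipotent (L d) (mmult (length (K d)) (B' d) (A' d))"
    and "coord_qi P ?N L m h'"
    and "\<And>d p v. p \<in> P \<Longrightarrow> v \<in> stalk (inj_sum P (K d)) p \<Longrightarrow>
      h' d p v = app (L d) p (B' d) (length (K d)) (to_coords (K d) p v)"
    and hA': "\<And>d p v. p \<in> P \<Longrightarrow> v \<in> stalk (inj_sum P (L d)) p \<Longrightarrow>
      h d p v = app (K d) p (A' d) (length (L d)) (to_coords (L d) p v)"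
    by (rule radical_compare[OF N M rad(1) h]) (rule that)
  let ?q = "\<lambda>d p v. of_coords (K d) p (h d p v)"
  have "quasi_isomorphism P ?M ?N ?q"
    by (rule quasi_isomorphism_of_coord_qi[OF bounded_coord_sheaves[OF M] N h])
  then have "chain_map P ?M ?N ?q" by (rule quasi_isomorphismD)
  moreover have "bij_betw (?q d p) (stalk (obj ?M d) p) (stalk (obj ?N d) p)" if p: "p \<in> P" for d p
  proof -
    note st = stalk_coord_sheaves[OF M] stalk_coord_sheaves[OF N]
    have mem: "h d p v \<in> coords (K d) p" if "v \<in> stalk (obj ?M d) p" for v
      by (rule coord_mapD(1)[OF coord_qiD(1)[OF h] p that])
    show ?thesis unfolding bij_betw_def
    proof (intro conjI equalityI subsetI)
      show "inj_on (?q d p) (stalk (obj ?M d) p)"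
      proof (rule inj_onI)
        fix v w assume vw: "v \<in> stalk (obj ?M d) p" "w \<in> stalk (obj ?M d) p" "?q d p v = ?q d p w"
        define u where "u = (\<lambda>i. to_coords (L d) p v i - to_coords (L d) p w i)"
        have u: "u \<in> coords (L d) p" unfolding u_def by (intro coords_diff to_coords_mem)
        have "h d p v = h d p w" using vw mem to_of_coords by metis
        then have "app (K d) p (A' d) (length (L d)) u = (\<lambda>i. 0)"
          using hA'[OF p, of v d] hA'[OF p, of w d] vw(1,2) by (simp add: u_def app_diff obj_coord_sheaves)
        then have "app (L d) p (mmult (length (K d)) (B' d) (A' d)) (length (L d)) u = (\<lambda>i. 0)"
          unfolding app_mmult[OF B', symmetric] by (simp add: app_zero)
        then have z: "(\<Sum>j<length (L d). mmult (length (K d)) (B' d) (A' d) i j * u j) = 0" if "i \<in> pos (L d) p" for i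
          using that by (auto simp: app_def fun_eq_iff split: if_splits)
        have "u i = 0" for i
          by (rule unipotent_inj[OF BA'[of d], of "pos (L d) p"])
            (use u z in \<open>auto simp: coords_def pos_def\<close>)
        then have "to_coords (L d) p v = to_coords (L d) p w" by (simp add: u_def fun_eq_iff)
        then show "v = w" using vw(1,2) unfolding st by (rule to_coords_inject[rotated 2])
      qed
    next
      fix w assume "w \<in> ?q d p ` stalk (obj ?M d) p"
      then show "w \<in> stalk (obj ?N d) p" unfolding st using of_coords_carrier by blast
    next
      fix w assume w: "w \<in> stalk (obj ?N d) p"
      obtain u where u: "u \<in> coords (K d) p"
        "app (K d) p (mmult (length (L d)) (B d) (A d)) (length (K d)) u = to_coords (K d) p w"
        using unipotent_surj[OF BA to_coords_mem] by blast
      let ?v = "of_coords (L d) p (app (L d) p (A d) (length (K d)) u)"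
      have v: "?v \<in> stalk (obj ?M d) p" unfolding st by (rule of_coords_carrier)
      have "h d p ?v = to_coords (K d) p w"
        unfolding hB[OF p v[unfolded obj_coord_sheaves]] to_of_coords[OF app_mem] app_mmult[OF B] u(2) ..
      then have "w = ?q d p ?v" using w unfolding st by (simp add: of_to_coords)
      then show "w \<in> ?q d p ` stalk (obj ?M d) p" using v by blast
    qed
  qed
  ultimately show ?thesis unfolding complex_iso_def by blast
qed

section \<open>Isomorphisms of complexes\<close>

lemma quasi_isomorphism_of_iso:
  assumes A: "bounded_complex P A" and B: "bounded_complex P B" and f: "chain_map P A B f"
    and bij: "\<And>d p. p \<in> P \<Longrightarrow> bij_betw (f d p) (stalk (obj A d) p) (stalk (obj B d) p)"
  shows "quasi_isomorphism P A B f"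
  unfolding quasi_isomorphism_def
proof (intro conjI allI ballI impI f)
  have fh: "sheaf_hom P (obj A d) (obj B d) (f d)" for d using f by (simp add: chain_map_def)
  note fD = sheaf_homD[OF fh]
  have fd: "f (d + 1) p (dif A d p v) = dif B d p (f d p v)" if "p \<in> P" "v \<in> stalk (obj A d) p" for d p v
    using f that by (simp add: chain_map_def)
  note dA = sheaf_homD(1)[OF complexD(2)[OF A]]
  have inj: "v = w" if "p \<in> P" "v \<in> stalk (obj A d) p" "w \<in> stalk (obj A d) p" "f d p v = f d p w" for d p v w
    using bij[OF that(1)] that by (meson bij_betw_def inj_onD)
  have surj: "\<exists>v\<in>stalk (obj A d) p. w = f d p v" if "p \<in> P" "w \<in> stalk (obj B d) p" for d p w
    using bij[OF that(1), of d] that by (auto simp: bij_betw_def)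
  fix d :: int and p assume p: "p \<in> P"
  define e where "e = d - 1"
  have d: "d = e + 1" by (simp add: e_def)
  show "v \<in> coboundaries A d p" if v: "v \<in> cocycles A d p" "f d p v \<in> coboundaries B d p" for v
  proof -
    obtain b where b: "b \<in> stalk (obj B e) p" "f d p v = dif B e p b"
      using v(2) unfolding d coboundaries_Suc by blast
    obtain a where a: "a \<in> stalk (obj A e) p" "b = f e p a" using surj[OF p b(1)] by blast
    have "v = dif A e p a"
      using inj[OF p cocyclesD(1)[OF v(1)], of "dif A e p a"] dA[OF p a(1)] b(2) fd[OF p a(1)]
      by (simp add: a(2) d)
    then show ?thesis using a(1) unfolding d coboundaries_Suc by blast
  qed
  show "\<exists>v\<in>cocycles A d p. w - f d p v \<in> coboundaries B d p" if w: "w \<in> cocycles B d p" for w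
  proof -
    obtain v where v: "v \<in> stalk (obj A d) p" "w = f d p v" using surj[OF p cocyclesD(1)[OF w]] by blast
    have dv: "dif A d p v \<in> stalk (obj A (d + 1)) p" by (rule dA[OF p v(1)])
    have z: "is_zero (f (d + 1) p (dif A d p v))" using cocyclesD(2)[OF w] fd[OF p v(1)] v(2) by simp
    \<comment> \<open>Injectivity reflects zero: a vector whose image is zero has the same image as
      its own zero multiple.\<close>
    have "f (d + 1) p (0 \<cdot>\<^sub>v dif A d p v) = f (d + 1) p (dif A d p v)"
      using fD(3)[OF p dv, of 0] is_zero_smult[OF z] by simp
    then have "0 \<cdot>\<^sub>v dif A d p v = dif A d p v"
      by (rule inj[OF p sheafD(3)[OF complexD(1)[OF A] p dv] dv])
    then have "is_zero (dif A d p v)" using is_zero_zero_smult by metis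
    then have vc: "v \<in> cocycles A d p" using v by (simp add: cocycles_def)
    obtain b where b: "b \<in> stalk (obj B e) p" using sheaf_nonempty[OF complexD(1)[OF B] p] by blast
    obtain n where n: "stalk (obj B (e + 1)) p \<subseteq> carrier_vec n"
      using fd_space_dim[OF sheafD(1)[OF complexD(1)[OF B] p]] by blast
    note db = sheaf_homD[OF complexD(2)[OF B] p b]
    have "w \<in> carrier_vec n" "dif B e p b \<in> carrier_vec n"
      using n db(1) cocyclesD(1)[OF w] d by blast+
    then have "w - f d p v = 0 \<cdot>\<^sub>v dif B e p b"
      by (intro eq_vecI) (auto simp: v(2)[symmetric])
    also have "\<dots> = dif B e p (0 \<cdot>\<^sub>v b)" by (rule db(3)[symmetric])
    finally have "w - f d p v \<in> coboundaries B (e + 1) p"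
      unfolding coboundaries_Suc using sheafD(3)[OF complexD(1)[OF B] p b] by blast
    then show ?thesis using vc d by blast
  qed
qed

lemma quasi_isomorphic_step:
  "bounded_complex P A \<Longrightarrow> bounded_complex P B \<Longrightarrow> quasi_isomorphism P A B f \<Longrightarrow> quasi_isomorphic P A B"
  unfolding quasi_isomorphic_def by (intro r_into_equivclp) blast

lemma quasi_isomorphic_sym: "quasi_isomorphic P A B \<Longrightarrow> quasi_isomorphic P B A"
  unfolding quasi_isomorphic_def by (rule equivclp_sym)

lemma quasi_isomorphic_trans: "quasi_isomorphic P A B \<Longrightarrow> quasi_isomorphic P B C \<Longrightarrow> quasi_isomorphic P A C"
  unfolding quasi_isomorphic_def by (rule equivclp_trans)

lemma quasi_isomorphic_of_iso:
  assumes "bounded_complex P A" "bounded_complex P B" "complex_iso P A B"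
  shows "quasi_isomorphic P A B"
proof -
  obtain f where "chain_map P A B f" "\<And>d p. p \<in> P \<Longrightarrow> bij_betw (f d p) (stalk (obj A d) p) (stalk (obj B d) p)"
    using assms(3) unfolding complex_iso_def by blast
  from quasi_isomorphic_step[OF assms(1,2) quasi_isomorphism_of_iso[OF assms(1,2) this]] show ?thesis .
qed

lemma sheaf_hom_comp:
  assumes "sheaf_hom P F G \<phi>" "sheaf_hom P G H \<psi>"
  shows "sheaf_hom P F H (\<lambda>p v. \<psi> p (\<phi> p v))"
  unfolding sheaf_hom_def linear_on_def Pi_iff
  by (auto simp: sheaf_homD[OF assms(1)] sheaf_homD[OF assms(2)])

lemma complex_iso_trans:
  assumes "complex_iso P A B" "complex_iso P B C"
  shows "complex_iso P A C"
proof -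
  obtain f where f: "chain_map P A B f" "\<And>d p. p \<in> P \<Longrightarrow> bij_betw (f d p) (stalk (obj A d) p) (stalk (obj B d) p)"
    using assms(1) unfolding complex_iso_def by blast
  obtain g where g: "chain_map P B C g" "\<And>d p. p \<in> P \<Longrightarrow> bij_betw (g d p) (stalk (obj B d) p) (stalk (obj C d) p)"
    using assms(2) unfolding complex_iso_def by blast
  have "chain_map P A C (\<lambda>d p v. g d p (f d p v))"
    unfolding chain_map_def
  proof (intro conjI allI ballI)
    have fh: "sheaf_hom P (obj A d) (obj B d) (f d)" and gh: "sheaf_hom P (obj B d) (obj C d) (g d)" for d
      using f g by (auto simp: chain_map_def)
    show "sheaf_hom P (obj A d) (obj C d) (\<lambda>p v. g d p (f d p v))" for d
      by (rule sheaf_hom_comp[OF fh gh])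
    fix d p v assume "p \<in> P" "v \<in> stalk (obj A d) p"
    then show "g (d + 1) p (f (d + 1) p (dif A d p v)) = dif C d p (g d p (f d p v))"
      using f(1) g(1) sheaf_homD(1)[OF fh] by (simp add: chain_map_def)
  qed
  moreover have "bij_betw (\<lambda>v. g d p (f d p v)) (stalk (obj A d) p) (stalk (obj C d) p)" if "p \<in> P" for d p
    using bij_betw_trans[OF f(2) g(2), OF that that] by (simp add: comp_def)
  ultimately show ?thesis unfolding complex_iso_def by blast
qed

lemma sheaf_hom_inverse:
  assumes F: "is_sheaf P F" and \<phi>: "sheaf_hom P F G \<phi>"
    and bij: "\<And>p. p \<in> P \<Longrightarrow> bij_betw (\<phi> p) (stalk F p) (stalk G p)"
  shows "sheaf_hom P G F (\<lambda>p. inv_into (stalk F p) (\<phi> p))"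
proof -
  let ?i = "\<lambda>p. inv_into (stalk F p) (\<phi> p)"
  have mem: "?i p w \<in> stalk F p" "\<phi> p (?i p w) = w" if "p \<in> P" "w \<in> stalk G p" for p w
    using bij[OF that(1)] that by (auto simp: bij_betw_def inv_into_into f_inv_into_f)
  have eq: "?i p (\<phi> p v) = v" if "p \<in> P" "v \<in> stalk F p" for p v
    using bij[OF that(1)] that by (auto simp: bij_betw_def inv_into_f_f)
  note hD = sheaf_homD[OF \<phi>] and sF = sheafD[OF F]
  show ?thesis unfolding sheaf_hom_def linear_on_def Pi_iff
  proof (intro conjI ballI allI impI)
    fix p w assume s: "p \<in> P" "w \<in> stalk G p"
    note m = mem[OF s]
    show "?i p w \<in> stalk F p" by (rule m)
    show "?i p (c \<cdot>\<^sub>v w) = c \<cdot>\<^sub>v ?i p w" for c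
      using eq[OF s(1) sF(3)[OF s(1) m(1)]] hD(3)[OF s(1) m(1)] by (simp add: m(2))
    show "?i p (w + w') = ?i p w + ?i p w'" if "w' \<in> stalk G p" for w'
      using eq[OF s(1) sF(2)[OF s(1) m(1) mem(1)[OF s(1) that]]] hD(2)[OF s(1) m(1) mem(1)[OF s(1) that]]
      by (simp add: m(2) mem(2)[OF s(1) that])
    fix \<tau> assume t: "\<tau> \<in> P" "p \<le> \<tau>"
    show "?i \<tau> (res G p \<tau> w) = res F p \<tau> (?i p w)"
      using eq[OF t(1) sF(4)[OF s(1) t m(1)]] hD(4)[OF s(1) m(1) t] by (simp add: m(2))
  qed
qed

section \<open>Injective complexes represented by matrices\<close>

lemma bij_of_coords: "bij_betw (of_coords ps p) (coords ps p) (carrier_vec (card (pos ps p)))"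
  by (rule bij_betw_byWitness[where f' = "to_coords ps p"])
    (auto simp: to_of_coords of_to_coords of_coords_carrier to_coords_mem)

lemma bij_to_coords: "bij_betw (to_coords ps p) (carrier_vec (card (pos ps p))) (coords ps p)"
  by (rule bij_betw_byWitness[where f' = "of_coords ps p"])
    (auto simp: to_of_coords of_to_coords of_coords_carrier to_coords_mem)

text \<open>Transport of structure: since \<open>g\<close> is bijective at every point, the square
  of \<open>m\<close> vanishes because that of the differential of \<open>J\<close> does.\<close>

lemma coord_complex_of_iso:
  assumes J: "bounded_complex P J" and L: "\<And>d. set (L d) \<subseteq> P"
    and m: "\<And>d. labeled (L (d + 1)) (L d) (m d)" and g: "coord_chain P J L m g"
    and bij: "\<And>d p. p \<in> P \<Longrightarrow> bij_betw (g d p) (stalk (obj J d) p) (coords (L d) p)"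
  shows "coord_complex P L m" and "complex_iso P J (coord_sheaves P L m)"
proof -
  have gm: "coord_map P (obj J d) (L d) (g d)" for d using g by (simp add: coord_chain_def)
  have gd: "g (d + 1) p (dif J d p v) = cdif L m d p (g d p v)" if "p \<in> P" "v \<in> stalk (obj J d) p" for d p v
    using g that by (simp add: coord_chain_def)
  note dJ = sheaf_homD(1)[OF complexD(2)[OF J]]
  have surj: "\<exists>v\<in>stalk (obj J d) p. u = g d p v" if "p \<in> P" "u \<in> coords (L d) p" for d p u
    using bij[OF that(1), of d] that(2) by (auto simp: bij_betw_def)
  have "mmult (length (L (d + 1))) (m (d + 1)) (m d) = (\<lambda>i j. 0)" for d
  proof (rule labeled_eqI[OF labeled_mmult[OF m m] _ L])
    show "labeled (L (d + 1 + 1)) (L d) (\<lambda>i j. 0)" by (simp add: labeled_def)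
    fix p and u :: "nat \<Rightarrow> 'b" assume s: "p \<in> P" "u \<in> coords (L d) p"
    obtain v where v: "v \<in> stalk (obj J d) p" "u = g d p v" using surj[OF s] by blast
    have "app (L (d + 1 + 1)) p (mmult (length (L (d + 1))) (m (d + 1)) (m d)) (length (L d)) u
      = cdif L m (d + 1) p (cdif L m d p (g d p v))"
      unfolding cdif_def app_mmult[OF m] v(2) ..
    also have "\<dots> = g (d + 1 + 1) p (dif J (d + 1) p (dif J d p v))"
      unfolding gd[OF s(1) v(1), symmetric] gd[OF s(1) dJ[OF s(1) v(1)], symmetric] ..
    also have "\<dots> = (\<lambda>i. 0)"
      by (rule coord_map_zero[OF gm s(1) dJ[OF s(1) dJ[OF s(1) v(1)]] complexD(3)[OF J s(1) v(1)]])
    also have "\<dots> = app (L (d + 1 + 1)) p (\<lambda>i j. 0) (length (L d)) u" by (auto simp: app_def)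
    finally show "app (L (d + 1 + 1)) p (mmult (length (L (d + 1))) (m (d + 1)) (m d)) (length (L d)) u
      = app (L (d + 1 + 1)) p (\<lambda>i j. 0) (length (L d)) u" .
  qed
  moreover have "finite {d. L d \<noteq> []}"
  proof (rule finite_subset)
    show "finite {d. \<exists>p\<in>P. \<exists>v\<in>stalk (obj J d) p. \<not> is_zero v}" using J by (simp add: bounded_complex_def)
    show "{d. L d \<noteq> []} \<subseteq> {d. \<exists>p\<in>P. \<exists>v\<in>stalk (obj J d) p. \<not> is_zero v}"
    proof
      fix d assume "d \<in> {d. L d \<noteq> []}"
      \<comment> \<open>A summand has a nonzero section at its own label, so a nonempty list makes
        \<open>J\<close> nonzero in that degree; boundedness of \<open>J\<close> therefore bounds
        \<open>L\<close>.\<close>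
      then have l0: "L d ! 0 \<in> P" "0 \<in> pos (L d) (L d ! 0)" using L[of d] by (auto simp: pos_def)
      obtain v where v: "v \<in> stalk (obj J d) (L d ! 0)" "unit 0 = g d (L d ! 0) v"
        using surj[OF l0(1) unit_mem[OF l0(2)]] by blast
      have "\<not> is_zero v"
      proof
        assume "is_zero v"
        from coord_map_zero[OF gm l0(1) v(1) this] v(2) have "unit 0 (0 :: nat) = (0 :: 'b)" by metis
        then show False by (simp add: unit_def)
      qed
      then show "d \<in> {d. \<exists>p\<in>P. \<exists>v\<in>stalk (obj J d) p. \<not> is_zero v}" using l0(1) v(1) by blast
    qed
  qed
  ultimately show M: "coord_complex P L m" unfolding coord_complex_def using L m by blast
  have "bij_betw (\<lambda>v. of_coords (L d) p (g d p v)) (stalk (obj J d) p) (stalk (obj (coord_sheaves P L m) d) p)"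
    if "p \<in> P" for d p
    using bij_betw_trans[OF bij[OF that, of d] bij_of_coords] by (simp add: stalk_coord_sheaves[OF M] comp_def)
  then show "complex_iso P J (coord_sheaves P L m)"
    unfolding complex_iso_def using chain_map_of_coord_chain[OF J M g] by blast
qed

text \<open>The decompositions \<open>L\<close> may be prescribed freely in each degree; the
  differentials are conjugated by the chosen isomorphisms and become matrices by
  \<open>coord_map_matrices\<close>.\<close>

lemma representation:
  fixes J :: "('p::order, 'k::field) complex_of_sheaves"
  assumes J: "bounded_complex P J" and L: "\<And>d. set (L d) \<subseteq> P"
    and iso: "\<And>d. sheaf_iso P (obj J d) (inj_sum P (L d))"
  obtains m where "coord_complex P L m" "complex_iso P J (coord_sheaves P L m)"
proof -
  have "\<exists>\<phi>. sheaf_hom P (obj J d) (inj_sum P (L d)) \<phi> \<and>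
      (\<forall>p\<in>P. bij_betw (\<phi> p) (stalk (obj J d) p) (stalk (inj_sum P (L d)) p))" for d
    using iso[of d] by (simp add: sheaf_iso_def)
  then obtain \<phi> where \<phi>: "\<And>d. sheaf_hom P (obj J d) (inj_sum P (L d)) (\<phi> d)"
    "\<And>d p. p \<in> P \<Longrightarrow> bij_betw (\<phi> d p) (stalk (obj J d) p) (stalk (inj_sum P (L d)) p)" by metis
  define \<psi> where "\<psi> d = (\<lambda>p. inv_into (stalk (obj J d) p) (\<phi> d p))" for d
  have \<psi>: "sheaf_hom P (inj_sum P (L d)) (obj J d) (\<psi> d)" for d
    unfolding \<psi>_def by (rule sheaf_hom_inverse[OF complexD(1)[OF J] \<phi>])
  have \<psi>\<phi>: "\<psi> d p (\<phi> d p v) = v" if "p \<in> P" "v \<in> stalk (obj J d) p" for d p v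
    using \<phi>(2)[OF that(1), of d] that(2) by (auto simp: \<psi>_def bij_betw_def inv_into_f_f)
  define g where "g d p v = to_coords (L d) p (\<phi> d p v)" for d p v
  have gm: "coord_map P (obj J d) (L d) (g d)" for d
    unfolding g_def by (rule coord_map_of_hom[OF \<phi>(1) L])
  have cm: "coord_map P (inj_sum P (L d)) (L (d + 1)) (\<lambda>p w. g (d + 1) p (dif J d p (\<psi> d p w)))" for d
    by (rule coord_map_comp_hom[OF \<psi> coord_map_comp_hom[OF complexD(2)[OF J] gm]])
  obtain m where m: "\<And>d. labeled (L (d + 1)) (L d) (m d)"
    "\<And>d p w. p \<in> P \<Longrightarrow> w \<in> stalk (inj_sum P (L d)) p \<Longrightarrow>
      g (d + 1) p (dif J d p (\<psi> d p w)) = app (L (d + 1)) p (m d) (length (L d)) (to_coords (L d) p w)"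
    by (rule coord_map_matrices[where ps = L and qs = "\<lambda>d. L (d + 1)", OF cm L L]) (rule that)
  have "coord_chain P J L m g"
    unfolding coord_chain_def cdif_def
  proof (intro conjI allI ballI gm)
    fix d p v assume s: "p \<in> P" "v \<in> stalk (obj J d) p"
    show "g (d + 1) p (dif J d p v) = app (L (d + 1)) p (m d) (length (L d)) (g d p v)"
      using m(2)[OF s(1) sheaf_homD(1)[OF \<phi>(1) s]] by (simp add: \<psi>\<phi>[OF s] g_def)
  qed
  moreover have "bij_betw (g d p) (stalk (obj J d) p) (coords (L d) p)" if "p \<in> P" for d p
    using bij_betw_trans[OF \<phi>(2)[OF that, of d, unfolded stalk_inj_sum[OF L]] bij_to_coords]
    by (simp add: comp_def g_def[abs_def])
  ultimately show thesis using coord_complex_of_iso[where L = L and m = m, OF J L m(1)] that by blast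
qed

lemma coord_sheaves_entries:
  assumes "\<And>d. \<eta> d \<in> carrier_mat (length (L (d + 1))) (length (L d))"
  shows "coord_sheaves P L (\<lambda>d. entries (\<eta> d)) = matrix_complex P L \<eta>"
proof -
  have "mat (length (L (d + 1))) (length (L d)) (\<lambda>(i, j). entries (\<eta> d) i j) = \<eta> d" for d
    using assms[of d] by (intro eq_matI) (auto simp: entries_def)
  then show ?thesis by (simp add: coord_sheaves_def)
qed

text \<open>\<open>represented_by\<close> asks neither that the matrices compose to zero nor that
  almost all lists are empty; both are inherited from \<open>J\<close> through the
  isomorphism.\<close>

lemma represented_by_coord_complex:
  assumes J: "bounded_complex P J" and rep: "represented_by P J L \<eta>"
  shows "coord_complex P L (\<lambda>d. entries (\<eta> d))" "complex_iso P J (coord_sheaves P L (\<lambda>d. entries (\<eta> d)))"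
proof -
  have lm: "labeled_matrix P (L (d + 1)) (L d) (\<eta> d)" for d using rep by (simp add: represented_by_def)
  have L: "set (L d) \<subseteq> P" for d using lm[of d] by (simp add: labeled_matrix_def)
  obtain \<phi> where \<phi>: "chain_map P J (matrix_complex P L \<eta>) \<phi>" and
    bij: "\<And>d p. p \<in> P \<Longrightarrow> bij_betw (\<phi> d p) (stalk (obj J d) p) (stalk (inj_sum P (L d)) p)"
    using rep by (auto simp: represented_by_def complex_iso_def matrix_complex_def)
  have hom: "sheaf_hom P (obj J d) (inj_sum P (L d)) (\<phi> d)" for d
    using \<phi> by (simp add: chain_map_def matrix_complex_def)
  have "coord_chain P J L (\<lambda>d. entries (\<eta> d)) (\<lambda>d p v. to_coords (L d) p (\<phi> d p v))"
    unfolding coord_chain_def cdif_def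
  proof (intro conjI allI ballI)
    show "coord_map P (obj J d) (L d) (\<lambda>p v. to_coords (L d) p (\<phi> d p v))" for d
      by (rule coord_map_of_hom[OF hom L])
    fix d p v assume s: "p \<in> P" "v \<in> stalk (obj J d) p"
    have "\<phi> (d + 1) p (dif J d p v) = matrix_map P (L (d + 1)) (L d) (\<eta> d) p (\<phi> d p v)"
      using \<phi> s by (simp add: chain_map_def matrix_complex_def)
    then show "to_coords (L (d + 1)) p (\<phi> (d + 1) p (dif J d p v)) =
        app (L (d + 1)) p (entries (\<eta> d)) (length (L d)) (to_coords (L d) p (\<phi> d p v))"
      using matrix_map_coords(2)[OF lm sheaf_homD(1)[OF hom s]] by simp
  qed
  moreover have "bij_betw (\<lambda>v. to_coords (L d) p (\<phi> d p v)) (stalk (obj J d) p) (coords (L d) p)" if "p \<in> P" for d p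
    using bij_betw_trans[OF bij[OF that, of d, unfolded stalk_inj_sum[OF L]] bij_to_coords] by (simp add: comp_def)
  ultimately show "coord_complex P L (\<lambda>d. entries (\<eta> d))" "complex_iso P J (coord_sheaves P L (\<lambda>d. entries (\<eta> d)))"
    using coord_complex_of_iso[where L = L and m = "\<lambda>d. entries (\<eta> d)", OF J L labeled_entries[OF lm]] by blast+
qed

lemma sheaf_iso_refl: "is_sheaf P F \<Longrightarrow> sheaf_iso P F F"
  unfolding sheaf_iso_def sheaf_hom_def linear_on_def
  by (intro exI[of _ "\<lambda>p v. v"]) (auto simp: bij_betw_def)

text \<open>Place the two sums in degree \<open>0\<close>: complexes with zero differential are radical.\<close>

lemma summands_unique:
  fixes P :: "'p::order set"
  assumes ps: "set ps \<subseteq> P" and qs: "set qs \<subseteq> P"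
    and iso: "sheaf_iso P (inj_sum P ps :: ('p, 'k::field) sheaf) (inj_sum P qs)"
  shows "length qs \<le> length ps"
proof -
  define L where "L d = (if d = 0 then ps else [])" for d :: int
  define K where "K d = (if d = 0 then qs else [])" for d :: int
  define m :: "int \<Rightarrow> nat \<Rightarrow> nat \<Rightarrow> 'k" where "m = (\<lambda>d i j. 0)"
  have "finite {d. L d \<noteq> []}" by (rule finite_subset[of _ "{0}"]) (auto simp: L_def)
  then have M: "coord_complex P L m"
    using ps by (auto simp: coord_complex_def L_def m_def labeled_def mmult_def)
  note bM = bounded_coord_sheaves[OF M]
  have "sheaf_iso P (obj (coord_sheaves P L m) d) (inj_sum P (K d))" for d
    using iso sheaf_iso_refl[OF complexD(1)[OF bM, of d]] by (auto simp: obj_coord_sheaves L_def K_def)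
  then obtain n where n: "coord_complex P K n" "complex_iso P (coord_sheaves P L m) (coord_sheaves P K n)"
    using representation[OF bM, of K] qs by (auto simp: K_def)
  \<comment> \<open>In every degree the row list or the column list is empty.\<close>
  have "n d i j = 0" for d i j
    using coord_complexD(2)[OF n(1), of d] by (auto simp: labeled_def K_def split: if_splits)
  then have "radical K n" by (simp add: radical_def)
  from radical_length[OF M n(1) this quasi_isomorphic_of_iso[OF bM bounded_coord_sheaves[OF n(1)] n(2)], of 0]
  show ?thesis by (simp add: L_def K_def)
qed

section \<open>Minimal complexes are radical\<close>

text \<open>Cut off at \<open>n\<close>, so that the identity array respects the support condition
  in \<open>labeled\<close>.\<close>

definition ident :: "nat \<Rightarrow> nat \<Rightarrow> nat \<Rightarrow> 'k::field" where
  "ident n = (\<lambda>i j. if i = j \<and> i < n then 1 else 0)"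

lemma mmult_ident_left: "labeled ps qs A \<Longrightarrow> mmult (length ps) (ident (length ps)) A = A"
proof (intro ext)
  fix i j assume A: "labeled ps qs A"
  have "mmult (length ps) (ident (length ps)) A i j = (\<Sum>k<length ps. if i = k then A k j else 0)"
    unfolding mmult_def ident_def by (rule sum.cong) auto
  then show "mmult (length ps) (ident (length ps)) A i j = A i j"
    using A by (auto simp: labeled_def)
qed

lemma mmult_ident_right: "labeled ps qs A \<Longrightarrow> mmult (length qs) A (ident (length qs)) = A"
proof (intro ext)
  fix i j assume A: "labeled ps qs A"
  have "mmult (length qs) A (ident (length qs)) i j = (\<Sum>k<length qs. if k = j then A i k else 0)"
    unfolding mmult_def ident_def by (rule sum.cong) auto
  then show "mmult (length qs) A (ident (length qs)) i j = A i j"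
    using A by (auto simp: labeled_def)
qed

lemma mmult_diff_left: "mmult n (\<lambda>i j. A i j - B i j) C = (\<lambda>i j. mmult n A C i j - mmult n B C i j)"
  and mmult_diff_right: "mmult n C (\<lambda>i j. A i j - B i j) = (\<lambda>i j. mmult n C A i j - mmult n C B i j)"
  by (auto simp: mmult_def fun_eq_iff algebra_simps sum_subtractf)

lemma mmult_zero_left: "mmult n (\<lambda>i j. 0) A = (\<lambda>i j. 0)"
  and mmult_zero_right: "mmult n A (\<lambda>i j. 0) = (\<lambda>i j. 0)"
  by (auto simp: mmult_def)

lemma app_ident: "u \<in> coords ps p \<Longrightarrow> app ps p (ident (length ps)) (length ps) u = u"
proof
  fix i assume u: "u \<in> coords ps p"
  have "(\<Sum>j<length ps. ident (length ps) i j * u j) = (\<Sum>j<length ps. if i = j then u j else 0)"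
    unfolding ident_def by (rule sum.cong) auto
  then show "app ps p (ident (length ps)) (length ps) u i = u i"
    using u by (auto simp: app_def coords_def pos_def)
qed

lemma app_diff_matrix:
  "app ps p (\<lambda>i j. A i j - B i j) n u = (\<lambda>i. app ps p A n u i - app ps p B n u i)"
  by (auto simp: app_def algebra_simps sum_subtractf)

text \<open>The idempotent \<open>g f = 1 - (\<partial> t + t \<partial>)\<close> commutes with the differential \<open>m\<close>, so \<open>f m g\<close> is a
  differential on \<open>L'\<close>.\<close>

lemma homotopy_retract:
  fixes m :: "int \<Rightarrow> nat \<Rightarrow> nat \<Rightarrow> 'k::field"
  assumes M: "coord_complex P L m" and L': "\<And>d. set (L' d) \<subseteq> P" and fin: "finite {d. L' d \<noteq> []}"
    and f: "\<And>d. labeled (L' d) (L d) (f d)" and g: "\<And>d. labeled (L d) (L' d) (g d)"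
    and t: "\<And>d. labeled (L d) (L (d + 1)) (t d)"
    and fg: "\<And>d. mmult (length (L d)) (f d) (g d) = ident (length (L' d))"
    and gf: "\<And>d. mmult (length (L' d)) (g d) (f d) = (\<lambda>i j. ident (length (L d)) i j
      - mmult (length (L (d - 1))) (m (d - 1)) (t (d - 1)) i j - mmult (length (L (d + 1))) (t d) (m d) i j)"
  obtains m' where "coord_complex P L' m'"
    "quasi_isomorphic P (coord_sheaves P L m) (coord_sheaves P L' m')"
proof -
  let ?N = "\<lambda>d. length (L d)" and ?N' = "\<lambda>d. length (L' d)"
  note MD = coord_complexD[OF M]
  define m' where "m' d = mmult (?N (d + 1)) (f (d + 1)) (mmult (?N d) (m d) (g d))" for d
  define e where "e d = mmult (?N' d) (g d) (f d)" for d
  have lab_e: "labeled (L d) (L d) (e d)" for d unfolding e_def by (rule labeled_mmult[OF g f])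
  have mm: "mmult (?N d) (m d) (m (d - 1)) = (\<lambda>i j. 0)" for d using MD(3)[of "d - 1"] by simp
  \<comment> \<open>Both sides equal \<open>m - m t m\<close>: each of the two remaining terms
    contains two consecutive differentials.\<close>
  have C: "mmult (?N d) (m d) (e d) = mmult (?N (d + 1)) (e (d + 1)) (m d)" for d
  proof -
    have "mmult (?N d) (m d) (e d) = (\<lambda>i j. m d i j - mmult (?N d) (m d) (mmult (?N (d + 1)) (t d) (m d)) i j)"
      unfolding e_def gf mmult_diff_right mmult_ident_right[OF MD(2)]
      unfolding mmult_assoc[symmetric] mm mmult_zero_left by simp
    moreover have "mmult (?N (d + 1)) (e (d + 1)) (m d) = (\<lambda>i j. m d i j - mmult (?N d) (m d) (mmult (?N (d + 1)) (t d) (m d)) i j)"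
      unfolding e_def gf mmult_diff_left mmult_ident_left[OF MD(2)] mmult_assoc MD(3) mmult_zero_right by simp
    ultimately show ?thesis by simp
  qed
  have fe: "mmult (?N d) (f d) (e d) = f d" for d
    unfolding e_def mmult_assoc[symmetric] fg by (rule mmult_ident_left[OF f])
  have eg: "mmult (?N d) (e d) (g d) = g d" for d
    unfolding e_def mmult_assoc fg by (rule mmult_ident_right[OF g])
  \<comment> \<open>This and \<open>mf\<close> say that \<open>g\<close> and \<open>f\<close> are
    chain maps between the two differentials.\<close>
  have gm: "mmult (?N' (d + 1)) (g (d + 1)) (m' d) = mmult (?N d) (m d) (g d)" for d
  proof -
    have "mmult (?N' (d + 1)) (g (d + 1)) (m' d) = mmult (?N (d + 1)) (e (d + 1)) (mmult (?N d) (m d) (g d))"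
      by (simp only: m'_def e_def mmult_assoc)
    also have "\<dots> = mmult (?N d) (m d) (mmult (?N d) (e d) (g d))"
      unfolding mmult_assoc[symmetric] C ..
    finally show ?thesis by (simp only: eg)
  qed
  have mf: "mmult (?N' d) (m' d) (f d) = mmult (?N (d + 1)) (f (d + 1)) (m d)" for d
  proof -
    have "mmult (?N' d) (m' d) (f d) = mmult (?N (d + 1)) (f (d + 1)) (mmult (?N d) (m d) (e d))"
      by (simp only: m'_def e_def mmult_assoc)
    also have "\<dots> = mmult (?N (d + 1)) (mmult (?N (d + 1)) (f (d + 1)) (e (d + 1))) (m d)"
      unfolding C mmult_assoc ..
    finally show ?thesis by (simp only: fe)
  qed
  have lab: "labeled (L' (d + 1)) (L' d) (m' d)" for d
    unfolding m'_def by (rule labeled_mmult[OF f labeled_mmult[OF MD(2) g]])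
  have "mmult (?N' (d + 1)) (m' (d + 1)) (m' d) = (\<lambda>i j. 0)" for d
  proof -
    have "mmult (?N' (d + 1)) (m' (d + 1)) (m' d)
      = mmult (?N (d + 1 + 1)) (f (d + 1 + 1)) (mmult (?N (d + 1)) (m (d + 1)) (mmult (?N' (d + 1)) (g (d + 1)) (m' d)))"
      unfolding m'_def[of "d + 1"] mmult_assoc ..
    also have "\<dots> = mmult (?N (d + 1 + 1)) (f (d + 1 + 1)) (mmult (?N d) (mmult (?N (d + 1)) (m (d + 1)) (m d)) (g d))"
      unfolding gm mmult_assoc ..
    finally show ?thesis unfolding MD(3) mmult_zero_left mmult_zero_right .
  qed
  then have M': "coord_complex P L' m'"
    unfolding coord_complex_def using L' fin lab by blast
  let ?M = "coord_sheaves P L m"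
  define \<phi> where "\<phi> d p v = app (L' d) p (f d) (?N d) (to_coords (L d) p v)" for d p v
  have "coord_qi P ?M L' m' \<phi>"
    unfolding coord_qi_def coord_chain_def
  proof (intro conjI allI ballI impI)
    fix d show "coord_map P (obj ?M d) (L' d) (\<phi> d)"
      unfolding \<phi>_def[abs_def] obj_coord_sheaves by (rule coord_map_app[OF coord_map_id[OF MD(1)] f])
  next
    fix d p v assume v: "v \<in> stalk (obj ?M d) p"
    show "\<phi> (d + 1) p (dif ?M d p v) = cdif L' m' d p (\<phi> d p v)"
      unfolding \<phi>_def dif_coord_sheaves(2)[OF M v] cdif_def app_mmult[OF f] app_mmult[OF lab] mf ..
  next
    fix d p v w assume p: "p \<in> P" and v: "v \<in> cocycles ?M (d + 1) p" and w: "w \<in> coords (L' d) p"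
      and eq: "\<phi> (d + 1) p v = cdif L' m' d p w"
    note vs = cocyclesD(1)[OF v]
    define u where "u = to_coords (L (d + 1)) p v"
    have u: "u \<in> coords (L (d + 1)) p" unfolding u_def by (rule to_coords_mem)
    have du: "cdif L m (d + 1) p u = (\<lambda>i. 0)"
      using cocyclesD(2)[OF v] unfolding is_zero_coords[OF dif_coord_sheaves(1)[OF M vs, unfolded stalk_coord_sheaves[OF M]]]
        dif_coord_sheaves(2)[OF M vs] u_def .
    \<comment> \<open>For a cocycle \<open>u\<close> the idempotent changes \<open>u\<close> only by
      the coboundary of \<open>t u\<close>. If \<open>f u\<close> is a coboundary, then so is
      \<open>g f u\<close>, as \<open>g\<close> is a chain map, and hence \<open>u\<close>.\<close>
    have "app (L (d + 1)) p (g (d + 1)) (?N' (d + 1)) (\<phi> (d + 1) p v)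
      = app (L (d + 1)) p (e (d + 1)) (?N (d + 1)) u"
      unfolding \<phi>_def u_def app_mmult[OF g] e_def ..
    also have "\<dots> = (\<lambda>i. u i - cdif L m d p (app (L d) p (t d) (?N (d + 1)) u) i)"
    proof -
      have "app (L (d + 1)) p (mmult (?N (d + 1 + 1)) (t (d + 1)) (m (d + 1))) (?N (d + 1)) u = (\<lambda>i. 0)"
        using du unfolding app_mmult[OF t, symmetric] cdif_def by (simp only: app_zero)
      then show ?thesis
        unfolding e_def gf add_diff_cancel_right' app_diff_matrix app_ident[OF u] cdif_def app_mmult[OF MD(2)] by simp
    qed
    also have "app (L (d + 1)) p (g (d + 1)) (?N' (d + 1)) (\<phi> (d + 1) p v)
      = cdif L m d p (app (L d) p (g d) (?N' d) w)"
      unfolding eq cdif_def app_mmult[OF g] app_mmult[OF MD(2)] gm ..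
    finally have "u = cdif L m d p (\<lambda>i. app (L d) p (g d) (?N' d) w i + app (L d) p (t d) (?N (d + 1)) u i)"
      by (simp add: cdif_linear fun_eq_iff algebra_simps)
    moreover have "(\<lambda>i. app (L d) p (g d) (?N' d) w i + app (L d) p (t d) (?N (d + 1)) u i) \<in> coords (L d) p"
      by (intro coords_add app_mem)
    ultimately obtain x where x: "x \<in> coords (L d) p" "u = cdif L m d p x" by blast
    show "v \<in> coboundaries ?M (d + 1) p"
      by (rule coord_qiD(3)[OF coord_qi_id[OF M] p v x(1)]) (use x(2) in \<open>simp add: u_def\<close>)
  next
    fix d p w assume w: "w \<in> coords (L' (d + 1)) p" "cdif L' m' (d + 1) p w = (\<lambda>i. 0)"
    \<comment> \<open>Since \<open>f g\<close> is the identity, \<open>g w\<close> is a cocycle that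
      \<open>f\<close> sends exactly to \<open>w\<close>.\<close>
    define x where "x = app (L (d + 1)) p (g (d + 1)) (?N' (d + 1)) w"
    have x: "x \<in> coords (L (d + 1)) p" unfolding x_def by (rule app_mem)
    let ?v = "of_coords (L (d + 1)) p x"
    have v: "?v \<in> stalk (obj ?M (d + 1)) p" unfolding stalk_coord_sheaves[OF M] by (rule of_coords_carrier)
    have "cdif L m (d + 1) p x = app (L (d + 1 + 1)) p (g (d + 1 + 1)) (?N' (d + 1 + 1)) (cdif L' m' (d + 1) p w)"
      unfolding x_def cdif_def app_mmult[OF g] app_mmult[OF MD(2)] gm ..
    also have "\<dots> = (\<lambda>i. 0)" unfolding w(2) app_zero ..
    finally have "is_zero (dif ?M (d + 1) p ?v)"
      unfolding is_zero_coords[OF dif_coord_sheaves(1)[OF M v, unfolded stalk_coord_sheaves[OF M]]]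
        dif_coord_sheaves(2)[OF M v] to_of_coords[OF x] .
    then have "?v \<in> cocycles ?M (d + 1) p" using v by (simp add: cocycles_def)
    moreover have "\<phi> (d + 1) p ?v = w"
      unfolding \<phi>_def to_of_coords[OF x] unfolding x_def app_mmult[OF f] fg by (rule app_ident[OF w(1)])
    then have "w = (\<lambda>i. \<phi> (d + 1) p ?v i + cdif L' m' d p (\<lambda>i. 0) i)" by (simp add: cdif_linear)
    ultimately show "\<exists>v\<in>cocycles ?M (d + 1) p. \<exists>u\<in>coords (L' d) p. w = (\<lambda>i. \<phi> (d + 1) p v i + cdif L' m' d p u i)"
      using coords_zero by blast
  qed
  from quasi_isomorphic_step[OF bounded_coord_sheaves[OF M] bounded_coord_sheaves[OF M']
      quasi_isomorphism_of_coord_qi[OF bounded_coord_sheaves[OF M] M' this]]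
  show thesis using M' that by blast
qed

text \<open>Gaussian elimination of the pivot: \<open>t\<close> has the single entry \<open>1 / m c i0 j0\<close>, and \<open>e\<close> splits over the
  indices other than \<open>j0\<close> in degree \<open>c\<close> and \<open>i0\<close> in degree \<open>c + 1\<close>.\<close>

lemma eliminate:
  fixes m :: "int \<Rightarrow> nat \<Rightarrow> nat \<Rightarrow> 'k::field"
  assumes M: "coord_complex P L m" and piv: "m c i0 j0 \<noteq> 0" and same: "L (c + 1) ! i0 = L c ! j0"
  obtains L' m' where "coord_complex P L' m'" "length (L' c) < length (L c)"
    "quasi_isomorphic P (coord_sheaves P L m) (coord_sheaves P L' m')"
proof -
  note MD = coord_complexD[OF M]
  let ?N = "\<lambda>d. length (L d)"
  have i0: "i0 < ?N (c + 1)" and j0: "j0 < ?N c"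
    using piv MD(2)[of c] by (auto simp: labeled_def)
  define S where "S d = {..<?N d} - (if d = c then {j0} else if d = c + 1 then {i0} else {})" for d
  define \<epsilon> where "\<epsilon> d r = sorted_list_of_set (S d) ! r" for d r
  define L' where "L' d = map ((!) (L d)) (sorted_list_of_set (S d))" for d
  have fin: "finite (S d)" for d by (simp add: S_def)
  have len: "length (L' d) = card (S d)" for d by (simp add: L'_def fin)
  have bij: "bij_betw (\<epsilon> d) {..<card (S d)} (S d)" for d
    unfolding \<epsilon>_def using bij_betw_nth[of "sorted_list_of_set (S d)"] fin by simp
  have \<epsilon>: "\<epsilon> d r \<in> S d" "\<epsilon> d r < ?N d" "L' d ! r = L d ! \<epsilon> d r" if "r < length (L' d)" for d r
  proof -
    show *: "\<epsilon> d r \<in> S d" using bij_betwE[OF bij] that len by auto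
    then show "\<epsilon> d r < ?N d" by (simp add: S_def)
    show "L' d ! r = L d ! \<epsilon> d r" using that by (simp add: L'_def \<epsilon>_def)
  qed
  have \<epsilon>_inj: "\<epsilon> d r = \<epsilon> d s \<longleftrightarrow> r = s" if "r < length (L' d)" "s < length (L' d)" for d r s
    using bij[of d] that len[of d] by (auto simp: bij_betw_def inj_on_def)
  define t where "t d i j = (if d = c \<and> i = j0 \<and> j = i0 then 1 / m c i0 j0 else 0)" for d i j
  \<comment> \<open>\<open>t\<close> runs against the pivot, so its label inequality is the reverse
    of the pivot's; equality of the two labels supplies it.\<close>
  have lab_t: "labeled (L d) (L (d + 1)) (t d)" for d
    using i0 j0 same by (auto simp: labeled_def t_def)
  define e where "e d = (\<lambda>i j. ident (?N d) i j - mmult (?N (d - 1)) (m (d - 1)) (t (d - 1)) i j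
      - mmult (?N (d + 1)) (t d) (m d) i j)" for d
  have lab_e: "labeled (L d) (L d) (e d)" for d
  proof -
    have "labeled (L d) (L d) (mmult (?N (d - 1)) (m (d - 1)) (t (d - 1)))"
      using labeled_mmult[OF MD(2)[of "d - 1"] lab_t[of "d - 1"]] by simp
    moreover have "labeled (L d) (L d) (mmult (?N (d + 1)) (t d) (m d))"
      by (rule labeled_mmult[OF lab_t MD(2)])
    moreover have "labeled (L d) (L d) (ident (?N d))"
      by (simp add: labeled_def ident_def)
    ultimately show ?thesis
      unfolding labeled_def e_def by (metis diff_zero)
  qed
  \<comment> \<open>The homotopy lives in degree \<open>c\<close> only. So \<open>e\<close> differs
    from the identity just in row \<open>j0\<close> of degree \<open>c\<close> and in column
    \<open>i0\<close> of degree \<open>c + 1\<close>.\<close>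
  have e: "e d i j = ident (?N d) i j - (if d = c + 1 \<and> j = i0 then m c i j0 / m c i0 j0 else 0)
      - (if d = c \<and> i = j0 then m c i0 j / m c i0 j0 else 0)" for d i j
  proof -
    have "mmult (?N (d - 1)) (m (d - 1)) (t (d - 1)) i j
      = (\<Sum>k<?N (d - 1). if k = j0 then (if d = c + 1 \<and> j = i0 then m c i j0 / m c i0 j0 else 0) else 0)"
      unfolding mmult_def t_def by (rule sum.cong) auto
    also have "\<dots> = (if d = c + 1 \<and> j = i0 then m c i j0 / m c i0 j0 else 0)" using j0 by auto
    finally have 1: "mmult (?N (d - 1)) (m (d - 1)) (t (d - 1)) i j = \<dots>" .
    have "mmult (?N (d + 1)) (t d) (m d) i j
      = (\<Sum>k<?N (d + 1). if k = i0 then (if d = c \<and> i = j0 then m c i0 j / m c i0 j0 else 0) else 0)"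
      unfolding mmult_def t_def by (rule sum.cong) auto
    also have "\<dots> = (if d = c \<and> i = j0 then m c i0 j / m c i0 j0 else 0)" using i0 by auto
    finally show ?thesis using 1 by (simp add: e_def)
  qed
  have row: "e d a j = ident (?N d) a j" if "d \<noteq> c + 1" "a \<in> S d" for d a j
    using that by (auto simp: e S_def split: if_splits)
  have col: "e d i a = ident (?N d) i a" if "d = c + 1" "a \<in> S d" for d i a
    using that by (auto simp: e S_def split: if_splits)
  \<comment> \<open>The pivot cancels the diagonal entry at the removed index, so in degree
    \<open>c\<close> column \<open>j0\<close> of \<open>e\<close> vanishes entirely, and in degree
    \<open>c + 1\<close> row \<open>i0\<close> does (\<open>row0\<close>). This is what lets
    \<open>e\<close> factor through the indices in \<open>S\<close>.\<close>
  have col0: "e d i j = 0" if "d \<noteq> c + 1" "j \<notin> S d" for d i j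
  proof (cases "j < ?N d")
    case True
    then have "d = c" "j = j0" using that by (auto simp: S_def split: if_splits)
    then show ?thesis using piv j0 by (simp add: e ident_def)
  next
    case False
    then show ?thesis using lab_e[of d] by (auto simp: labeled_def)
  qed
  have row0: "e d i j = 0" if "d = c + 1" "i \<notin> S d" for d i j
  proof (cases "i < ?N d")
    case True
    then have "i = i0" using that by (auto simp: S_def split: if_splits)
    then show ?thesis using piv i0 that(1) by (simp add: e ident_def)
  next
    case False
    then show ?thesis using lab_e[of d] by (auto simp: labeled_def)
  qed
  \<comment> \<open>The splitting of \<open>e\<close>: \<open>f\<close> keeps its rows and
    \<open>g\<close> its columns with index in \<open>S\<close>.\<close>
  define f where "f d r j = (if r < length (L' d) then e d (\<epsilon> d r) j else 0)" for d r j
  define g where "g d i r = (if r < length (L' d) then e d i (\<epsilon> d r) else 0)" for d i r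
  show thesis
  proof (rule homotopy_retract[of P L m L' f g t])
    have "set (L' d) \<subseteq> set (L d)" for d
      using fin by (auto simp: L'_def S_def)
    then show "set (L' d) \<subseteq> P" for d using MD(1) by blast
    show "finite {d. L' d \<noteq> []}"
    proof (rule finite_subset[OF _ MD(4)])
      have "L' d = []" if "L d = []" for d using that by (simp add: L'_def S_def)
      then show "{d. L' d \<noteq> []} \<subseteq> {d. L d \<noteq> []}" by blast
    qed
    show "labeled (L' d) (L d) (f d)" for d
      using lab_e[of d] \<epsilon>(3) by (auto simp: labeled_def f_def split: if_splits)
    show "labeled (L d) (L' d) (g d)" for d
      using lab_e[of d] \<epsilon>(3) by (auto simp: labeled_def g_def split: if_splits)
    fix d
    show "labeled (L d) (L (d + 1)) (t d)" by (rule lab_t)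
    show "mmult (?N d) (f d) (g d) = ident (length (L' d))"
    proof (intro ext)
      fix r s
      show "mmult (?N d) (f d) (g d) r s = ident (length (L' d)) r s"
      proof (cases "r < length (L' d) \<and> s < length (L' d)")
        case True
        note r = \<epsilon>[of r d] and s = \<epsilon>[of s d]
        have "mmult (?N d) (f d) (g d) r s = (\<Sum>k<?N d. e d (\<epsilon> d r) k * e d k (\<epsilon> d s))"
          using True by (simp add: mmult_def f_def g_def)
        also have "\<dots> = ident (?N d) (\<epsilon> d r) (\<epsilon> d s)"
        proof (cases "d = c + 1")
          case False
          then have "(\<Sum>k<?N d. e d (\<epsilon> d r) k * e d k (\<epsilon> d s)) = (\<Sum>k<?N d. if k = \<epsilon> d r then e d k (\<epsilon> d s) else 0)"
            using r True by (intro sum.cong) (auto simp: row ident_def)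
          then show ?thesis using r True False by (simp add: row)
        next
          case d: True
          then have "(\<Sum>k<?N d. e d (\<epsilon> d r) k * e d k (\<epsilon> d s)) = (\<Sum>k<?N d. if k = \<epsilon> d s then e d (\<epsilon> d r) k else 0)"
            using s True by (intro sum.cong) (auto simp: col ident_def)
          then show ?thesis using s True d by (simp add: col)
        qed
        also have "\<dots> = ident (length (L' d)) r s" using True r s \<epsilon>_inj[of r d s] by (simp add: ident_def)
        finally show ?thesis .
      next
        case False
        then show ?thesis by (auto simp: mmult_def f_def g_def ident_def)
      qed
    qed
    show "mmult (length (L' d)) (g d) (f d) = (\<lambda>i j. ident (?N d) i j
      - mmult (?N (d - 1)) (m (d - 1)) (t (d - 1)) i j - mmult (?N (d + 1)) (t d) (m d) i j)"
    proof (intro ext)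
      fix i j
      have "mmult (length (L' d)) (g d) (f d) i j = (\<Sum>r<card (S d). e d i (\<epsilon> d r) * e d (\<epsilon> d r) j)"
        by (simp add: mmult_def f_def g_def len)
      also have "\<dots> = (\<Sum>a\<in>S d. e d i a * e d a j)"
        using sum.reindex_bij_betw[OF bij, of "\<lambda>a. e d i a * e d a j"] .
      also have "\<dots> = e d i j"
      proof (cases "d = c + 1")
        case False
        then have "(\<Sum>a\<in>S d. e d i a * e d a j) = (\<Sum>a\<in>S d. if a = j then e d i a else 0)"
          by (intro sum.cong) (auto simp: row ident_def S_def)
        then show ?thesis using False col0[of d j i] fin by simp
      next
        case True
        then have "(\<Sum>a\<in>S d. e d i a * e d a j) = (\<Sum>a\<in>S d. if a = i then e d a j else 0)"
          by (intro sum.cong) (auto simp: col ident_def S_def)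
        then show ?thesis using True row0[of d i j] fin by simp
      qed
      finally show "mmult (length (L' d)) (g d) (f d) i j = ident (?N d) i j
        - mmult (?N (d - 1)) (m (d - 1)) (t (d - 1)) i j - mmult (?N (d + 1)) (t d) (m d) i j"
        by (simp add: e_def)
    qed
  next
    fix m' assume "coord_complex P L' m'" "quasi_isomorphic P (coord_sheaves P L m) (coord_sheaves P L' m')"
    moreover have "length (L' c) < length (L c)"
      using j0 by (simp add: len S_def card_Diff_singleton)
    ultimately show thesis using that by blast
  qed (rule M)
qed

lemma bounded_injective_coord_sheaves:
  assumes M: "coord_complex P L m"
  shows "bounded_injective_complex P (coord_sheaves P L m)"
    and "injective_with_summands P (obj (coord_sheaves P L m) d) (length (L d))"
proof -
  have sh: "is_sheaf P (inj_sum P (L d))" for d by (rule is_sheaf_inj_sum[OF coord_complexD(1)[OF M]])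
  have i: "injective_with_summands P (obj (coord_sheaves P L m) d) (length (L d))" for d
    unfolding injective_with_summands_def obj_coord_sheaves
    using sheaf_iso_refl[OF sh] coord_complexD(1)[OF M] by blast
  then show "bounded_injective_complex P (coord_sheaves P L m)"
    unfolding bounded_injective_complex_def injective_sheaf_def
    using bounded_coord_sheaves[OF M] complexD(1)[OF bounded_coord_sheaves[OF M]] by blast
  show "injective_with_summands P (obj (coord_sheaves P L m) d) (length (L d))" by (rule i)
qed

text \<open>Eliminating a pivot would remove a summand in the source degree \<open>c\<close> without
  leaving the quasi-isomorphism class of \<open>A\<close>.\<close>

lemma minimal_imp_radical:
  assumes A: "minimal_injective_complex P A" and M: "coord_complex P L m"
    and iso: "complex_iso P A (coord_sheaves P L m)"
  shows "radical L m"
proof (rule ccontr)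
  assume "\<not> radical L m"
  then obtain c i0 j0 where "m c i0 j0 \<noteq> 0" "L (c + 1) ! i0 = L c ! j0" by (auto simp: radical_def)
  from eliminate[OF M this] obtain L' m' where M': "coord_complex P L' m'" and lt: "length (L' c) < length (L c)"
    and qi: "quasi_isomorphic P (coord_sheaves P L m) (coord_sheaves P L' m')" by blast
  have bA: "bounded_complex P A"
    using A by (simp add: minimal_injective_complex_def bounded_injective_complex_def)
  have "quasi_isomorphic P A (coord_sheaves P L' m')"
    by (rule quasi_isomorphic_trans[OF quasi_isomorphic_of_iso[OF bA bounded_coord_sheaves[OF M] iso] qi])
  moreover have "injective_with_summands P (obj A c) (length (L c))"
    using iso coord_complexD(1)[OF M]
    unfolding injective_with_summands_def complex_iso_def chain_map_def sheaf_iso_def obj_coord_sheaves by blast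
  ultimately have "length (L c) \<le> length (L' c)"
    using A bounded_injective_coord_sheaves[OF M'] unfolding minimal_injective_complex_def by blast
  then show False using lt by simp
qed

text \<open>Minimality compares arbitrary decompositions on both sides. The competitor is therefore
  represented with the given decomposition \<open>ps\<close> in degree \<open>d\<close>, and the
  count \<open>k\<close> is compared with \<open>length (L d)\<close> by
  \<open>summands_unique\<close>.\<close>

lemma radical_imp_minimal:
  fixes P :: "'p::order set" and m :: "int \<Rightarrow> nat \<Rightarrow> nat \<Rightarrow> 'k::field"
  assumes M: "coord_complex P L m" and rad: "radical L m"
  shows "minimal_injective_complex P (coord_sheaves P L m)"
  unfolding minimal_injective_complex_def
proof (intro conjI allI impI bounded_injective_coord_sheaves(1)[OF M])
  fix B d k n
  assume B: "bounded_injective_complex P B \<and> quasi_isomorphic P (coord_sheaves P L m) B"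
    and kn: "injective_with_summands P (obj (coord_sheaves P L m) d) k \<and> injective_with_summands P (obj B d) n"
  obtain ps where ps: "set ps \<subseteq> P" "length ps = n" "sheaf_iso P (obj B d) (inj_sum P ps)"
    using kn by (auto simp: injective_with_summands_def)
  have bB: "bounded_complex P B" using B by (simp add: bounded_injective_complex_def)
  have "\<exists>qs. set qs \<subseteq> P \<and> sheaf_iso P (obj B e) (inj_sum P qs) \<and> (e = d \<longrightarrow> qs = ps)" for e
    using B ps unfolding bounded_injective_complex_def injective_sheaf_def injective_with_summands_def
    by (cases "e = d") blast+
  then obtain K where K: "\<And>e. set (K e) \<subseteq> P" "\<And>e. sheaf_iso P (obj B e) (inj_sum P (K e))" "K d = ps" by metis
  obtain w where w: "coord_complex P K w" "complex_iso P B (coord_sheaves P K w)"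
    using representation[OF bB K(1,2)] by blast
  have "quasi_isomorphic P (coord_sheaves P L m) (coord_sheaves P K w)"
    using B quasi_isomorphic_of_iso[OF bB bounded_coord_sheaves[OF w(1)] w(2)] quasi_isomorphic_trans by blast
  from radical_length[OF w(1) M rad quasi_isomorphic_sym[OF this], of d]
  have "length (L d) \<le> n" using K(3) ps(2) by simp
  moreover obtain qs where qs: "set qs \<subseteq> P" "length qs = k" "sheaf_iso P (inj_sum P (L d) :: ('p, 'k) sheaf) (inj_sum P qs)"
    using kn by (auto simp: injective_with_summands_def obj_coord_sheaves)
  have "k \<le> length (L d)"
    using summands_unique[OF coord_complexD(1)[OF M] qs(1,3)] qs(2) by simp
  ultimately show "k \<le> n" by simp
qed

section \<open>Proper pullback\<close>

lemma finite_positions [simp]: "finite (positions ps S)"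
  by (simp add: positions_def)

lemma length_restrict_labels: "length (restrict_labels ps S) = card (positions ps S)"
  by (simp add: restrict_labels_def positions_def length_filter_conv_card)

lemma nth_restrict_labels:
  assumes "r < length (restrict_labels ps S)"
  shows "restrict_labels ps S ! r = ps ! pick (positions ps S) r"
proof -
  have "restrict_labels ps S = nths ps (positions ps S)"
    unfolding restrict_labels_def positions_def by (rule filter_eq_nths)
  moreover have "{i. i < length ps \<and> i \<in> positions ps S} = positions ps S" by (auto simp: positions_def)
  ultimately show ?thesis using assms nth_nths[of r ps "positions ps S"] by (metis length_restrict_labels)
qed

lemma entries_labeled_submatrix:
  assumes "M \<in> carrier_mat (length rs) (length cs)"
  shows "labeled_submatrix rs cs M S T \<in> carrier_mat (length (restrict_labels rs S)) (length (restrict_labels cs T))"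
    and "r < length (restrict_labels rs S) \<Longrightarrow> s < length (restrict_labels cs T) \<Longrightarrow>
      entries (labeled_submatrix rs cs M S T) r s = entries M (pick (positions rs S) r) (pick (positions cs T) s)"
proof -
  have eq: "{i. i < length rs \<and> i \<in> positions rs S} = positions rs S"
    "{i. i < length cs \<and> i \<in> positions cs T} = positions cs T" by (auto simp: positions_def)
  show c: "labeled_submatrix rs cs M S T \<in> carrier_mat (length (restrict_labels rs S)) (length (restrict_labels cs T))"
    using assms by (simp add: labeled_submatrix_def submatrix_def eq length_restrict_labels)
  show "entries (labeled_submatrix rs cs M S T) r s = entries M (pick (positions rs S) r) (pick (positions cs T) s)"
    if "r < length (restrict_labels rs S)" "s < length (restrict_labels cs T)"
  proof -
    have "pick (positions rs S) r \<in> positions rs S" "pick (positions cs T) s \<in> positions cs T"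
      using that by (auto simp: length_restrict_labels intro: pick_in_set_le)
    then show ?thesis
      using assms c that eq
      by (simp add: entries_def positions_def) (simp add: labeled_submatrix_def submatrix_def length_restrict_labels positions_def)
  qed
qed

text \<open>\<open>I\<close> is only isomorphic to its matrix complex, so everything is read through
  the coordinates \<open>g\<close>. Sections of the pullback are those whose nonzero coordinates
  have labels in \<open>Z\<close>; deleting the other coordinates gives the isomorphism
  \<open>h\<close> onto the complex with labels \<open>K\<close>.\<close>

lemma pullback_coordinates:
  fixes I :: "('p::order, 'k::field) complex_of_sheaves"
  assumes lc: "locally_closed P Z" and I: "bounded_complex P I" and rep: "represented_by P I L \<eta>"
  defines "K \<equiv> \<lambda>d. restrict_labels (L d) Z"
    and "\<kappa> \<equiv> \<lambda>d. labeled_submatrix (L (d + 1)) (L d) (\<eta> d) Z Z"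
  shows "bounded_complex Z (proper_pullback_complex P Z I)"
    and "labeled_matrix Z (K (d + 1)) (K d) (\<kappa> d)"
    and "coord_complex Z K (\<lambda>d. entries (\<kappa> d))"
    and "complex_iso Z (proper_pullback_complex P Z I) (coord_sheaves Z K (\<lambda>d. entries (\<kappa> d)))"
proof -
  let ?X = "proper_pullback_complex P Z I"
  define m where "m = (\<lambda>d. entries (\<eta> d))"
  define k where "k = (\<lambda>d. entries (\<kappa> d))"
  have lm: "labeled_matrix P (L (d + 1)) (L d) (\<eta> d)" for d using rep by (simp add: represented_by_def)
  then have car: "\<eta> d \<in> carrier_mat (length (L (d + 1))) (length (L d))" for d by (simp add: labeled_matrix_def)
  have M: "coord_complex P L m" and iso: "complex_iso P I (coord_sheaves P L m)"
    unfolding m_def by (rule represented_by_coord_complex[OF I rep])+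
  note MD = coord_complexD[OF M]
  obtain \<phi> where \<phi>: "chain_map P I (coord_sheaves P L m) \<phi>" and
    bij\<phi>: "\<And>d p. p \<in> P \<Longrightarrow> bij_betw (\<phi> d p) (stalk (obj I d) p) (carrier_vec (card (pos (L d) p)))"
    using iso by (auto simp: complex_iso_def stalk_coord_sheaves[OF M])
  define g where "g d p v = to_coords (L d) p (\<phi> d p v)" for d p v
  have bij: "bij_betw (g d p) (stalk (obj I d) p) (coords (L d) p)" if "p \<in> P" for d p
    using bij_betw_trans[OF bij\<phi>[OF that, of d] bij_to_coords] by (simp add: comp_def g_def[abs_def])
  have hom: "sheaf_hom P (obj I d) (inj_sum P (L d)) (\<phi> d)" for d
    using \<phi> by (simp add: chain_map_def obj_coord_sheaves)
  have gm: "coord_map P (obj I d) (L d) (g d)" for d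
    unfolding g_def[abs_def] by (rule coord_map_of_hom[OF hom MD(1)])
  note gD = coord_mapD[OF gm]
  have gd: "g (d + 1) p (dif I d p v) = cdif L m d p (g d p v)" if "p \<in> P" "v \<in> stalk (obj I d) p" for d p v
  proof -
    have "\<phi> d p v \<in> stalk (obj (coord_sheaves P L m) d) p"
      using sheaf_homD(1)[OF hom that] by (simp add: obj_coord_sheaves)
    from dif_coord_sheaves(2)[OF M this] show ?thesis
      using \<phi> that by (simp add: g_def chain_map_def)
  qed
  note sI = sheafD[OF complexD(1)[OF I]] and dI = sheaf_homD[OF complexD(2)[OF I]]
  have ZP: "Z \<subseteq> P" using lc by (simp add: locally_closed_def)
  have conv: "b \<in> Z" if "a \<in> Z" "c \<in> Z" "b \<in> P" "a \<le> b" "b \<le> c" for a b c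
    using lc that unfolding locally_closed_def by blast
  have zero_iff: "is_zero v \<longleftrightarrow> g d p v = (\<lambda>i. 0)" if s: "p \<in> P" "v \<in> stalk (obj I d) p" for d p v
  proof
    assume "g d p v = (\<lambda>i. 0)"
    then have "g d p (0 \<cdot>\<^sub>v v) = g d p v" using gD(3)[OF s, of 0] by simp
    then have "0 \<cdot>\<^sub>v v = v" using bij[OF s(1), of d] s sI(3)[OF s] by (auto simp: bij_betw_def dest: inj_onD)
    then show "is_zero v" using is_zero_zero_smult by metis
  qed (rule coord_map_zero[OF gm s])
  have st: "stalk (obj ?X d) \<zeta> = {v \<in> stalk (obj I d) \<zeta>. \<forall>i. g d \<zeta> v i \<noteq> 0 \<longrightarrow> L d ! i \<in> Z}"
    if \<zeta>: "\<zeta> \<in> Z" for d \<zeta>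
  proof -
    have \<zeta>P: "\<zeta> \<in> P" using \<zeta> ZP by blast
    have "(\<forall>\<tau>\<in>St P \<zeta> - Z. is_zero (res (obj I d) \<zeta> \<tau> v)) \<longleftrightarrow> (\<forall>i. g d \<zeta> v i \<noteq> 0 \<longrightarrow> L d ! i \<in> Z)"
      if v: "v \<in> stalk (obj I d) \<zeta>" for v
    proof (intro iffI ballI allI impI)
      fix i assume z: "\<forall>\<tau>\<in>St P \<zeta> - Z. is_zero (res (obj I d) \<zeta> \<tau> v)" and ne: "g d \<zeta> v i \<noteq> 0"
      \<comment> \<open>The test point is the label of the coordinate itself, where this coordinate
        is still present.\<close>
      let ?\<tau> = "L d ! i"
      have i: "i \<in> pos (L d) \<zeta>" using gD(1)[OF \<zeta>P v] ne by (auto simp: coords_def)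
      then have \<tau>: "?\<tau> \<in> P" "\<zeta> \<le> ?\<tau>" "i \<in> pos (L d) ?\<tau>" using MD(1)[of d] by (auto simp: pos_def)
      show "?\<tau> \<in> Z"
      proof (rule ccontr)
        assume "?\<tau> \<notin> Z"
        then have "is_zero (res (obj I d) \<zeta> ?\<tau> v)" using z \<tau> by (simp add: St_def)
        then have "g d ?\<tau> (res (obj I d) \<zeta> ?\<tau> v) i = 0"
          using zero_iff[OF \<tau>(1) sI(4)[OF \<zeta>P \<tau>(1,2) v]] by simp
        then show False using ne gD(4)[OF \<zeta>P v \<tau>] by simp
      qed
    next
      fix \<tau> assume z: "\<forall>i. g d \<zeta> v i \<noteq> 0 \<longrightarrow> L d ! i \<in> Z" and t: "\<tau> \<in> St P \<zeta> - Z"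
      have \<tau>: "\<tau> \<in> P" "\<zeta> \<le> \<tau>" using t by (auto simp: St_def)
      note rv = sI(4)[OF \<zeta>P \<tau> v]
      have "g d \<tau> (res (obj I d) \<zeta> \<tau> v) i = 0" for i
      proof (cases "i \<in> pos (L d) \<tau>")
        case True
        \<comment> \<open>The point \<open>\<tau>\<close> lies between \<open>\<zeta>\<close> and
          the label of \<open>i\<close>, so a label in \<open>Z\<close> would force
          \<open>\<tau> \<in> Z\<close>.\<close>
        have "g d \<zeta> v i = 0"
        proof (rule ccontr)
          assume "g d \<zeta> v i \<noteq> 0"
          then have "L d ! i \<in> Z" using z by blast
          then have "\<tau> \<in> Z" using conv[OF \<zeta> _ \<tau>] True by (auto simp: pos_def)
          then show False using t by simp
        qed
        then show ?thesis using gD(4)[OF \<zeta>P v \<tau> True] by simp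
      next
        case False
        then show ?thesis using gD(1)[OF \<tau>(1) rv] by (auto simp: coords_def)
      qed
      then show "is_zero (res (obj I d) \<zeta> \<tau> v)" using zero_iff[OF \<tau>(1) rv] by blast
    qed
    then show ?thesis by (auto simp: proper_pullback_complex_def proper_pullback_def)
  qed
  have resX: "res (obj ?X d) = res (obj I d)" and difX: "dif ?X d = dif I d" for d
    by (simp_all add: proper_pullback_complex_def proper_pullback_def)
  have sub: "p \<in> P" "v \<in> stalk (obj I d) p" "g d p v i \<noteq> 0 \<Longrightarrow> L d ! i \<in> Z"
    if "p \<in> Z" "v \<in> stalk (obj ?X d) p" for p v d i
    using that ZP st by auto
  have add: "u + v \<in> stalk (obj ?X d) p" if s: "p \<in> Z" "u \<in> stalk (obj ?X d) p" "v \<in> stalk (obj ?X d) p" for p u v d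
    using s sub[OF s(1,2)] sub[OF s(1,3)] unfolding st[OF s(1)]
    by (auto simp: gD(2) sI(2)) (metis add.right_neutral)
  have smult: "c \<cdot>\<^sub>v u \<in> stalk (obj ?X d) p" if s: "p \<in> Z" "u \<in> stalk (obj ?X d) p" for p u c d
    using s sub[OF s] unfolding st[OF s(1)] by (auto simp: gD(3) sI(3))
  have resm: "res (obj I d) p \<tau> v \<in> stalk (obj ?X d) \<tau>"
    if s: "p \<in> Z" "v \<in> stalk (obj ?X d) p" and t: "\<tau> \<in> Z" "p \<le> \<tau>" for p \<tau> v d
  proof -
    note v = sub[OF s]
    have \<tau>: "\<tau> \<in> P" using t ZP by blast
    note rv = sI(4)[OF v(1) \<tau> t(2) v(2)]
    have "L d ! i \<in> Z" if "g d \<tau> (res (obj I d) p \<tau> v) i \<noteq> 0" for i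
    proof -
      have "i \<in> pos (L d) \<tau>" using that gD(1)[OF \<tau> rv] by (auto simp: coords_def)
      then show ?thesis using that gD(4)[OF v(1,2) \<tau> t(2)] v(3) by simp
    qed
    then show ?thesis using rv by (simp add: st[OF t(1)])
  qed
  have difm: "dif I d p v \<in> stalk (obj ?X (d + 1)) p" if s: "p \<in> Z" "v \<in> stalk (obj ?X d) p" for p v d
  proof -
    note v = sub[OF s]
    \<comment> \<open>A nonzero output coordinate comes from an input coordinate with label in
      \<open>Z\<close>; its own label lies between \<open>p\<close> and that one, so local
      closedness applies once more.\<close>
    have "L (d + 1) ! i \<in> Z" if "g (d + 1) p (dif I d p v) i \<noteq> 0" for i
    proof -
      have i: "i \<in> pos (L (d + 1)) p" and "(\<Sum>j<length (L d). m d i j * g d p v j) \<noteq> 0"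
        using that unfolding gd[OF v(1,2)] cdif_def app_def by (auto split: if_splits)
      then obtain j where "m d i j * g d p v j \<noteq> 0" by (meson sum.not_neutral_contains_not_neutral)
      then have "m d i j \<noteq> 0" "g d p v j \<noteq> 0" by auto
      then have "L (d + 1) ! i \<le> L d ! j" "L d ! j \<in> Z" using MD(2)[of d] v(3) by (auto simp: labeled_def)
      moreover have "L (d + 1) ! i \<in> P" "p \<le> L (d + 1) ! i" using i MD(1)[of "d + 1"] by (auto simp: pos_def)
      ultimately show ?thesis using conv s(1) by blast
    qed
    then show ?thesis using dI(1)[OF v(1,2)] by (simp add: st[OF s(1)])
  qed
  show bX: "bounded_complex Z ?X"
    unfolding bounded_complex_def
  proof (intro conjI allI ballI)
    fix d
    show "is_sheaf Z (obj ?X d)"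
      unfolding is_sheaf_def linear_on_def Pi_iff resX
    proof (intro conjI allI ballI impI)
      fix p assume s: "p \<in> Z"
      then have sP: "p \<in> P" using ZP by blast
      obtain n where n: "stalk (obj I d) p \<subseteq> carrier_vec n" "0\<^sub>v n \<in> stalk (obj I d) p"
        using fd_spaceE[OF sI(1)[OF sP]] by metis
      have "g d p (0\<^sub>v n) = (\<lambda>i. 0)"
        using zero_iff[OF sP n(2)] by (simp add: is_zero_def)
      then have "0\<^sub>v n \<in> stalk (obj ?X d) p" using n(2) by (simp add: st[OF s])
      moreover have "stalk (obj ?X d) p \<subseteq> carrier_vec n" using n(1) by (auto simp: st[OF s])
      ultimately show "fd_space (stalk (obj ?X d) p)"
        unfolding fd_space_def using add[OF s] smult[OF s] by blast
      show "res (obj I d) p p v = v" if "v \<in> stalk (obj ?X d) p" for v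
        using complexD(1)[OF I, of d] sub[OF s that] by (simp add: is_sheaf_def)
      fix \<tau> assume t: "\<tau> \<in> Z"
      then have tP: "\<tau> \<in> P" using ZP by blast
      show "res (obj I d) \<tau> \<rho> (res (obj I d) p \<tau> v) = res (obj I d) p \<rho> v"
        if "\<rho> \<in> Z" "p \<le> \<tau> \<and> \<tau> \<le> \<rho>" "v \<in> stalk (obj ?X d) p" for \<rho> v
        using sI(7)[OF sP tP] that sub[OF s that(3)] ZP by blast
      assume le: "p \<le> \<tau>"
      fix u assume u: "u \<in> stalk (obj ?X d) p"
      show "res (obj I d) p \<tau> u \<in> stalk (obj ?X d) \<tau>" by (rule resm[OF s u t le])
      show "res (obj I d) p \<tau> (c \<cdot>\<^sub>v u) = c \<cdot>\<^sub>v res (obj I d) p \<tau> u" for c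
        by (rule sI(6)[OF sP tP le sub(2)[OF s u]])
      show "res (obj I d) p \<tau> (u + v) = res (obj I d) p \<tau> u + res (obj I d) p \<tau> v"
        if "v \<in> stalk (obj ?X d) p" for v
        by (rule sI(5)[OF sP tP le sub(2)[OF s u] sub(2)[OF s that]])
    qed
    show "sheaf_hom Z (obj ?X d) (obj ?X (d + 1)) (dif ?X d)"
      unfolding sheaf_hom_def linear_on_def Pi_iff resX difX
    proof (intro conjI allI ballI impI)
      fix p u assume s: "p \<in> Z" and u: "u \<in> stalk (obj ?X d) p"
      note uI = sub[OF s u]
      show "dif I d p u \<in> stalk (obj ?X (d + 1)) p" by (rule difm[OF s u])
      show "dif I d p (c \<cdot>\<^sub>v u) = c \<cdot>\<^sub>v dif I d p u" for c by (rule dI(3)[OF uI(1,2)])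
      show "dif I d p (u + v) = dif I d p u + dif I d p v" if "v \<in> stalk (obj ?X d) p" for v
        by (rule dI(2)[OF uI(1,2) sub(2)[OF s that]])
      fix \<tau> assume "\<tau> \<in> Z" "p \<le> \<tau>"
      then show "dif I d \<tau> (res (obj I d) p \<tau> u) = res (obj I (d + 1)) p \<tau> (dif I d p u)"
        using dI(4)[OF uI(1,2)] ZP by blast
    qed
    fix p v assume s: "p \<in> Z" "v \<in> stalk (obj ?X d) p"
    show "is_zero (dif ?X (d + 1) p (dif ?X d p v))"
      unfolding difX by (rule complexD(3)[OF I sub(1,2)[OF s]])
  next
    show "finite {d. \<exists>p\<in>Z. \<exists>v\<in>stalk (obj ?X d) p. \<not> is_zero v}"
    proof (rule finite_subset)
      show "finite {d. \<exists>p\<in>P. \<exists>v\<in>stalk (obj I d) p. \<not> is_zero v}" using I by (simp add: bounded_complex_def)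
    qed (use sub in blast)
  qed
  define \<epsilon> where "\<epsilon> d r = pick (positions (L d) Z) r" for d r
  have lenK: "length (K d) = card (positions (L d) Z)" for d by (simp add: K_def length_restrict_labels)
  have \<epsilon>: "\<epsilon> d r \<in> positions (L d) Z" "K d ! r = L d ! \<epsilon> d r" "\<epsilon> d r < length (L d)" if "r < length (K d)" for d r
  proof -
    show *: "\<epsilon> d r \<in> positions (L d) Z" using that by (simp add: \<epsilon>_def lenK pick_in_set_le)
    then show "\<epsilon> d r < length (L d)" by (simp add: positions_def)
    show "K d ! r = L d ! \<epsilon> d r" using that nth_restrict_labels by (simp add: K_def \<epsilon>_def)
  qed
  have \<epsilon>_pos: "\<epsilon> d r \<in> pos (L d) p" if "r \<in> pos (K d) p" for d r p
    using that \<epsilon>[of r d] by (auto simp: pos_def)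
  have setK: "set (K d) \<subseteq> Z" for d by (auto simp: K_def restrict_labels_def)
  have carK: "\<kappa> d \<in> carrier_mat (length (K (d + 1))) (length (K d))" for d
    unfolding \<kappa>_def K_def by (rule entries_labeled_submatrix(1)[OF car])
  have ent: "k d r s = m d (\<epsilon> (d + 1) r) (\<epsilon> d s)" if "r < length (K (d + 1))" "s < length (K d)" for d r s
    using entries_labeled_submatrix(2)[OF car, of r d Z s Z] that by (simp add: k_def \<kappa>_def m_def K_def \<epsilon>_def)
  have labk: "labeled (K (d + 1)) (K d) (k d)" for d
    unfolding labeled_def
  proof (intro allI impI)
    fix r s assume ne: "k d r s \<noteq> 0"
    then have rs: "r < length (K (d + 1))" "s < length (K d)"
      using carK[of d] by (auto simp: k_def entries_def split: if_splits)
    then show "r < length (K (d + 1)) \<and> s < length (K d) \<and> K (d + 1) ! r \<le> K d ! s"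
      using ne MD(2)[of d] \<epsilon>(2) by (auto simp: ent labeled_def)
  qed
  show "labeled_matrix Z (K (d + 1)) (K d) (\<kappa> d)"
    unfolding labeled_matrix_def
  proof (intro conjI setK carK allI impI)
    fix i j assume "i < length (K (d + 1))" "j < length (K d)" "\<kappa> d $$ (i, j) \<noteq> 0"
    then have "k d i j \<noteq> 0" using carK[of d] by (simp add: k_def entries_def)
    then show "K (d + 1) ! i \<le> K d ! j" using labk[of d] by (simp add: labeled_def)
  qed
  define h where "h d p v = (\<lambda>r. if r < length (K d) then g d p v (\<epsilon> d r) else 0)" for d p v
  have hm: "coord_map Z (obj ?X d) (K d) (h d)" for d
    unfolding coord_map_def resX
  proof (intro conjI ballI allI impI)
    fix p v assume s: "p \<in> Z" "v \<in> stalk (obj ?X d) p"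
    note v = sub[OF s]
    show "h d p v \<in> coords (K d) p"
      using gD(1)[OF v(1,2)] \<epsilon>[of _ d] by (fastforce simp: coords_def h_def pos_def)
    show "h d p (c \<cdot>\<^sub>v v) = (\<lambda>i. c * h d p v i)" for c by (auto simp: h_def gD(3)[OF v(1,2)])
    show "h d p (v + w) = (\<lambda>i. h d p v i + h d p w i)" if "w \<in> stalk (obj ?X d) p" for w
      by (auto simp: h_def gD(2)[OF v(1,2) sub(2)[OF s(1) that]])
    fix \<tau> i assume t: "\<tau> \<in> Z" "p \<le> \<tau>" "i \<in> pos (K d) \<tau>"
    then show "h d \<tau> (res (obj I d) p \<tau> v) i = h d p v i"
      using gD(4)[OF v(1,2) _ t(2) \<epsilon>_pos[OF t(3)]] ZP by (auto simp: h_def pos_def)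
  qed
  have "h (d + 1) p (dif I d p v) = cdif K k d p (h d p v)" if s: "p \<in> Z" "v \<in> stalk (obj ?X d) p" for d p v
  proof
    note v = sub[OF s]
    fix r
    show "h (d + 1) p (dif I d p v) r = cdif K k d p (h d p v) r"
    proof (cases "r \<in> pos (K (d + 1)) p")
      case True
      then have r: "r < length (K (d + 1))" by (simp add: pos_def)
      have "h (d + 1) p (dif I d p v) r = (\<Sum>j<length (L d). m d (\<epsilon> (d + 1) r) j * g d p v j)"
        using r \<epsilon>_pos[OF True] by (simp add: h_def gd[OF v(1,2)] cdif_def app_def)
      \<comment> \<open>Columns with labels outside \<open>Z\<close> meet only zero coordinates of
        \<open>v\<close>; hence the surviving entries are those of the submatrix.\<close>
      also have "\<dots> = (\<Sum>s<card (positions (L d) Z). m d (\<epsilon> (d + 1) r) (\<epsilon> d s) * g d p v (\<epsilon> d s))"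
        unfolding \<epsilon>_def[of d]
      proof (rule sum_pos[symmetric])
        fix j assume j: "j \<notin> positions (L d) Z"
        have "g d p v j = 0"
        proof (rule ccontr)
          assume ne: "g d p v j \<noteq> 0"
          then have "j \<in> pos (L d) p" using gD(1)[OF v(1,2)] by (auto simp: coords_def)
          then show False using j v(3)[OF ne] by (auto simp: positions_def pos_def)
        qed
        then show "m d (\<epsilon> (d + 1) r) j * g d p v j = 0" by simp
      qed (auto simp: positions_def)
      also have "\<dots> = (\<Sum>s<length (K d). k d r s * h d p v s)"
        unfolding lenK[symmetric] using r by (intro sum.cong) (auto simp: ent h_def)
      finally show ?thesis using True by (simp add: cdif_def app_def)
    next
      case False
      have "h (d + 1) p (dif I d p v) \<in> coords (K (d + 1)) p"
        by (rule coord_mapD(1)[OF hm s(1) difm[OF s]])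
      then show ?thesis using False by (auto simp: coords_def cdif_def app_def)
    qed
  qed
  then have hc: "coord_chain Z ?X K k h" unfolding coord_chain_def difX using hm by blast
  have bijh: "bij_betw (h d p) (stalk (obj ?X d) p) (coords (K d) p)" if s: "p \<in> Z" for d p
    unfolding bij_betw_def
  proof (intro conjI equalityI subsetI)
    have sP: "p \<in> P" using s ZP by blast
    let ?c = "\<lambda>i. card {a \<in> positions (L d) Z. a < i}"
    have c: "\<epsilon> d (?c i) = i" "?c i < length (K d)" if "i \<in> positions (L d) Z" for i
    proof -
      show "\<epsilon> d (?c i) = i" unfolding \<epsilon>_def by (rule pick_card_in_set[OF that])
      show "?c i < length (K d)" unfolding lenK by (rule psubset_card_mono) (use that in auto)
    qed
    show "inj_on (h d p) (stalk (obj ?X d) p)"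
    proof (rule inj_onI)
      fix v w assume v: "v \<in> stalk (obj ?X d) p" and w: "w \<in> stalk (obj ?X d) p" and eq: "h d p v = h d p w"
      have "g d p v i = g d p w i" for i
      proof (cases "i \<in> positions (L d) Z")
        case True
        then show ?thesis using fun_cong[OF eq, of "?c i"] c[OF True] by (simp add: h_def)
      next
        case False
        have "g d p x i = 0" if x: "x \<in> stalk (obj ?X d) p" for x
        proof (rule ccontr)
          assume ne: "g d p x i \<noteq> 0"
          then have "i \<in> pos (L d) p" using gD(1)[OF sub(1,2)[OF s x]] by (auto simp: coords_def)
          then show False using False sub(3)[OF s x ne] by (auto simp: positions_def pos_def)
        qed
        then show ?thesis using v w by simp
      qed
      then have "g d p v = g d p w" by blast
      then show "v = w" using bij[OF sP, of d] sub(2)[OF s v] sub(2)[OF s w] by (auto simp: bij_betw_def dest: inj_onD)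
    qed
    show "u \<in> coords (K d) p" if "u \<in> h d p ` stalk (obj ?X d) p" for u
      using that coord_mapD(1)[OF hm s] by blast
    show "u \<in> h d p ` stalk (obj ?X d) p" if u: "u \<in> coords (K d) p" for u
    proof -
      \<comment> \<open>\<open>u\<close> is put back at the positions with label in \<open>Z\<close>
        and extended by zero, so that the section with coordinates \<open>x\<close> belongs to the
        pullback.\<close>
      define x where "x i = (if i \<in> positions (L d) Z then u (?c i) else 0)" for i
      have x0: "i \<in> positions (L d) Z \<and> ?c i \<in> pos (K d) p" if "x i \<noteq> 0" for i
        using that u by (auto simp: x_def coords_def split: if_splits)
      have "x \<in> coords (L d) p"
        unfolding coords_def using x0 \<epsilon>_pos c(1) by fastforce
      then obtain v where v: "v \<in> stalk (obj I d) p" "g d p v = x"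
        using bij[OF sP, of d] unfolding bij_betw_def by (metis imageE)
      have "v \<in> stalk (obj ?X d) p" unfolding st[OF s] using v x0 by (auto simp: positions_def)
      moreover have "h d p v = u"
      proof
        fix r show "h d p v r = u r"
        proof (cases "r < length (K d)")
          case True
          then have "?c (\<epsilon> d r) = r" unfolding \<epsilon>_def lenK by (rule card_pick_le)
          then show ?thesis using True \<epsilon>(1)[OF True] by (simp add: h_def v(2) x_def)
        next
          case False
          then show ?thesis using u by (auto simp: h_def coords_def pos_def)
        qed
      qed
      ultimately show ?thesis by blast
    qed
  qed
  show "coord_complex Z K (\<lambda>d. entries (\<kappa> d))"
    and "complex_iso Z ?X (coord_sheaves Z K (\<lambda>d. entries (\<kappa> d)))"
    using coord_complex_of_iso[where L = K and m = k, OF bX setK labk hc bijh] unfolding k_def by blast+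
qed

text \<open>The complex of the submatrices is itself radical, hence a minimal resolution; this
  settles existence. Any other resolution is isomorphic to it by \<open>radical_iso\<close>, and
  \<open>represented_by\<close> asks for no more.\<close>

theorem proposition5p22:
  fixes P Z :: "'p::order set"
    and I :: "('p, 'k::field) complex_of_sheaves"
    and L :: "int \<Rightarrow> 'p list"
    and \<eta> :: "int \<Rightarrow> 'k mat"
  assumes "finite P"
    and "locally_closed P Z"
    and "minimal_injective_complex P I"
    and "represented_by P I L \<eta>"
  shows "(\<exists>J. minimal_injective_resolution Z (proper_pullback_complex P Z I) J) \<and>
         (\<forall>J. minimal_injective_resolution Z (proper_pullback_complex P Z I) J \<longrightarrow>
            represented_by Z J
              (\<lambda>d. restrict_labels (L d) Z)
              (\<lambda>d. labeled_submatrix (L (d + 1)) (L d) (\<eta> d) Z Z))"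
proof -
  let ?X = "proper_pullback_complex P Z I"
  define K where "K = (\<lambda>d. restrict_labels (L d) Z)"
  define \<kappa> where "\<kappa> = (\<lambda>d. labeled_submatrix (L (d + 1)) (L d) (\<eta> d) Z Z)"
  define k where "k = (\<lambda>d. entries (labeled_submatrix (L (d + 1)) (L d) (\<eta> d) Z Z))"
  have I: "bounded_complex P I"
    using assms(3) by (simp add: minimal_injective_complex_def bounded_injective_complex_def)
  note pb = pullback_coordinates[OF assms(2) I assms(4), folded K_def k_def]
  note X = pb(1) and N = pb(3) and XN = pb(4)
  have lm: "labeled_matrix Z (K (d + 1)) (K d) (\<kappa> d)" for d
    using pb(2)[of d] by (simp add: K_def \<kappa>_def)
  have "radical L (\<lambda>d. entries (\<eta> d))"
    by (rule minimal_imp_radical[OF assms(3) represented_by_coord_complex[OF I assms(4)]])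
  moreover have car: "\<eta> d \<in> carrier_mat (length (L (d + 1))) (length (L d))" for d
    using assms(4) by (simp add: represented_by_def labeled_matrix_def)
  have "k d r s \<noteq> 0 \<Longrightarrow> \<exists>i j. entries (\<eta> d) i j \<noteq> 0 \<and> K (d + 1) ! r = L (d + 1) ! i \<and> K d ! s = L d ! j" for d r s
  proof -
    assume ne: "k d r s \<noteq> 0"
    then have rs: "r < length (K (d + 1))" "s < length (K d)"
      using coord_complexD(2)[OF N, of d] by (auto simp: labeled_def)
    then show ?thesis
      using ne entries_labeled_submatrix(2)[OF car, of r d Z s Z]
        nth_restrict_labels[of r "L (d + 1)" Z] nth_restrict_labels[of s "L d" Z]
      unfolding k_def \<kappa>_def K_def by metis
  qed
  ultimately have rad: "radical K k" unfolding radical_def by metis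
  have qX: "quasi_isomorphic Z ?X (coord_sheaves Z K k)"
    by (rule quasi_isomorphic_of_iso[OF X bounded_coord_sheaves[OF N] XN])
  have "minimal_injective_resolution Z ?X (coord_sheaves Z K k)"
    unfolding minimal_injective_resolution_def
    using X qX radical_imp_minimal[OF N rad] by blast
  moreover have "represented_by Z J K \<kappa>" if J: "minimal_injective_resolution Z ?X J" for J
  proof -
    have min: "minimal_injective_complex Z J" and XJ: "quasi_isomorphic Z ?X J"
      using J by (auto simp: minimal_injective_resolution_def)
    have bJ: "bounded_complex Z J"
      using min by (simp add: minimal_injective_complex_def bounded_injective_complex_def)
    \<comment> \<open>\<open>J\<close> first receives matrices of its own, from arbitrary
      decompositions; they are radical because \<open>J\<close> is minimal, which puts both
      complexes within reach of \<open>radical_iso\<close>.\<close>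
    have "\<exists>ps. set ps \<subseteq> Z \<and> sheaf_iso Z (obj J d) (inj_sum Z ps)" for d
      using min unfolding minimal_injective_complex_def bounded_injective_complex_def
        injective_sheaf_def injective_with_summands_def by blast
    then obtain LJ where LJ: "\<And>d. set (LJ d) \<subseteq> Z" "\<And>d. sheaf_iso Z (obj J d) (inj_sum Z (LJ d))"
      by metis
    obtain mJ where mJ: "coord_complex Z LJ mJ" "complex_iso Z J (coord_sheaves Z LJ mJ)"
      using representation[OF bJ LJ] by blast
    have "quasi_isomorphic Z (coord_sheaves Z LJ mJ) (coord_sheaves Z K k)"
      using quasi_isomorphic_of_iso[OF bJ bounded_coord_sheaves[OF mJ(1)] mJ(2)] XJ qX
        quasi_isomorphic_sym quasi_isomorphic_trans by blast
    from radical_iso[OF mJ(1) N minimal_imp_radical[OF min mJ] rad this]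
    have "complex_iso Z J (coord_sheaves Z K k)" by (rule complex_iso_trans[OF mJ(2)])
    moreover have "coord_sheaves Z K k = matrix_complex Z K \<kappa>"
      unfolding k_def \<kappa>_def by (rule coord_sheaves_entries) (use lm in \<open>simp add: labeled_matrix_def \<kappa>_def\<close>)
    ultimately show ?thesis using lm by (simp add: represented_by_def)
  qed
  ultimately show ?thesis unfolding K_def \<kappa>_def by blast
qed

end
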